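(* Let $G=\langle x_1,\dots,x_n\mid r_1,\dots,r_m\rangle$ be a commutator-relators group, and let $S=\mathbb{Z}[s_1,\dots,s_n]$. Then the linearized Alexander invariant of $G$ is isomorphic to the infinitesimal Alexander invariant of $G$: $$\mathfrak{B}_G\cong B(\mathfrak{H}(G))$$ as graded $S$-modules.
   Context: A commutator-relators group is a group with a finite presentation $G=\langle x_1,\dots,x_n\mid r_1,\dots,r_m\rangle$ in which every $r_k$ lies in the commutator subgroup of the free group $\mathbf{F}_n=\langle x_1,\dots,x_n\rangle$. Then $H_1G=G/G'=\mathbb{Z}^n$ with basis $y_1,\dots,y_n$ (the classes of the $x_i$). Linearized Alexander invariant. Let $\varphi\colon\mathbf{F}_n\to G$ and $\alpha\colon G\to G/G'$ be the projections, $t_i=\alpha\varphi(x_i)$, $\Lambda=\mathbb{Z}(G/G')=\mathbb{Z}[t_1^{\pm1},\dots,t_n^{\pm1}]$. Let $\partial_j=\partial/\partial x_j\colon\mathbf{F}_n\to\mathbb{Z}\mathbf{F}_n$ be the Fox derivatives, and let $D_G\colon\Lambda^m\to\Lambda^n$ be the Alexander matrix, sending the $k$-th basis element to $\sum_j\alpha\varphi(\partial_j r_k)\,e_j$. Let $\mu\colon\Lambda\to P=\mathbb{Z}[[s_1,\dots,s_n]]$, $\mu(t_i)=1+s_i$, be the Magnus embedding, $\mathfrak{m}=(s_1,\dots,s_n)$, and $\mu^{(1)}\colon\Lambda\to P/\mathfrak{m}^2$ its first truncation. Since the relators are commutators, the entries of $D_G^{(1)}:=\mu^{(1)}(D_G)$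 lie in $\mathfrak{m}/\mathfrak{m}^2$, so they are linear forms in $S$, and $D_G^{(1)}$ is viewed as an $S$-linear map $S^m\to S^n$. The linearized Alexander module is $\mathfrak{A}_G=\operatorname{coker}(D_G^{(1)})$. Let $d_1\colon S^n=S\otimes H_1G\to S$, $d_1(e_i)=s_i$ (first Koszul differential; $e_i$ in degree $1$), with image the ideal $\mathfrak{m}=(s_1,\dots,s_n)$ of $S$. Then $d_1\circ D_G^{(1)}=0$, so $d_1$ induces an epimorphism $\mathfrak{A}_G\to\mathfrak{m}$, and $\mathfrak{B}_G:=\ker(\mathfrak{A}_G\to\mathfrak{m})$, a graded $S$-module. Infinitesimal Alexander invariant. Let $\mathfrak{H}(G)$ be the integral holonomy Lie algebra: $\mathfrak{H}(G)=\mathbf{L}^*(H_1G)/\text{ideal}(\operatorname{im}\overline\partial)$, where $\mathbf{L}^*(H_1G)$ is the free $\mathbb{Z}$-Lie algebra on $H_1G$ in degree $1$, and $\overline\partial\colon H_2G\to\operatorname{Hom}(H^2G,\mathbb{Z})\to\bigwedge^2H_1G=\mathbf{L}^2(H_1G)$ is the Kronecker map followed by the dual of the cup product $\bigwedge^2H^1G\to H^2G$. Then $B(\mathfrak{H}(G))=\mathfrak{H}(G)'/\mathfrak{H}(G)''$ (derived subalgebra modulo second derived subalgebra), with the grading inherited from $\mathfrak{H}(G)$ (so starting in degree $2$), and with $\operatorname{Sym}(H_1G)=\mathbb{Z}[y_1,\dots,y_n]$ acting by the adjoint representation, where $\operatorname{Sym}$ denotes the symmetric algebra; it is regarded as an $S$-module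 by renaming $y_i$ to $s_i$. *)

theory Defs
  imports "HOL-Algebra.Algebra" "HOL-Library.Poly_Mapping"
begin

text \<open>
  Conventions. Indices run over \<open>{..<n}\<close> instead of \<open>1, ..., n\<close>. The free abelian group on a
  type of basis elements is \<open>'a \<Rightarrow>\<^sub>0 int\<close>, with basis elements \<open>frag_of x\<close> and linear extension
  \<open>frag_extend\<close>. As in \<open>HOL-Algebra.Module\<close>, modules are records extending rings whose
  multiplicative components \<open>mult\<close>, \<open>one\<close> are never used.
\<close>

section \<open>Free groups and presented groups\<close>

text \<open>The letter \<open>(True, i)\<close> stands for \<open>x\<^sub>i\<close> and \<open>(False, i)\<close> for its inverse.\<close>

type_synonym letter = "bool \<times> nat"
type_synonym word = "letter list"

definition letter_inv :: "letter \<Rightarrow> letter" where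
  "letter_inv a = (\<not> fst a, snd a)"

definition reduced :: "word \<Rightarrow> bool" where
  "reduced w \<longleftrightarrow> successively (\<lambda>a b. b \<noteq> letter_inv a) w"

fun cons_reduce :: "letter \<Rightarrow> word \<Rightarrow> word" where
  "cons_reduce a [] = [a]"
| "cons_reduce a (b # w) = (if b = letter_inv a then w else a # b # w)"

definition free_group :: "nat \<Rightarrow> word monoid" where
  "free_group n =
    \<lparr>carrier = {w. reduced w \<and> snd ` set w \<subseteq> {..<n}},
     monoid.mult = (\<lambda>u v. foldr cons_reduce u v),
     one = []\<rparr>"

definition normal_closure :: "('a, 'b) monoid_scheme \<Rightarrow> 'a set \<Rightarrow> 'a set" where
  "normal_closure G R = \<Inter>{N. N \<lhd> G \<and> R \<subseteq> N}"

definition relation_subgroup :: "nat \<Rightarrow> nat \<Rightarrow> (nat \<Rightarrow> word) \<Rightarrow> word set" where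
  "relation_subgroup n m r = normal_closure (free_group n) (r ` {..<m})"

definition presented_group :: "nat \<Rightarrow> nat \<Rightarrow> (nat \<Rightarrow> word) \<Rightarrow> word set monoid" where
  "presented_group n m r = free_group n Mod relation_subgroup n m r"

text \<open>The projection \<open>\<phi>\<close> from the free group onto the presented group.\<close>

definition presented_proj :: "nat \<Rightarrow> nat \<Rightarrow> (nat \<Rightarrow> word) \<Rightarrow> word \<Rightarrow> word set" where
  "presented_proj n m r w = relation_subgroup n m r #>\<^bsub>free_group n\<^esub> w"

definition presented_gen :: "nat \<Rightarrow> nat \<Rightarrow> (nat \<Rightarrow> word) \<Rightarrow> nat \<Rightarrow> word set" where
  "presented_gen n m r i = presented_proj n m r [(True, i)]"

definition commutator_relators :: "nat \<Rightarrow> nat \<Rightarrow> (nat \<Rightarrow> word) \<Rightarrow> bool" where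
  "commutator_relators n m r \<longleftrightarrow>
    (\<forall>k<m. r k \<in> derived (free_group n) (carrier (free_group n)))"

section \<open>Abelianization\<close>

definition abelianization :: "('g, 'b) monoid_scheme \<Rightarrow> 'g set monoid" where
  "abelianization G = G Mod derived G (carrier G)"

definition ab_proj :: "('g, 'b) monoid_scheme \<Rightarrow> 'g \<Rightarrow> 'g set" where
  "ab_proj G g = derived G (carrier G) #>\<^bsub>G\<^esub> g"

text \<open>
  Coordinates of an element \<open>h\<close> of the abelianization with respect to the classes of
  \<open>x 0, ..., x (n - 1)\<close>; they are well defined whenever these classes form a basis.
\<close>

definition ab_coord :: "('g, 'b) monoid_scheme \<Rightarrow> nat \<Rightarrow> (nat \<Rightarrow> 'g) \<Rightarrow> 'g set \<Rightarrow> nat \<Rightarrow> int" where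
  "ab_coord G n x h =
    (THE a. (\<forall>i\<ge>n. a i = 0) \<and>
      h = (\<Otimes>\<^bsub>abelianization G\<^esub>i\<in>{..<n}. ab_proj G (x i) [^]\<^bsub>abelianization G\<^esub> a i))"

section \<open>Fox derivatives and the Alexander matrix\<close>

text \<open>Elements of the integral group ring of a group are finitely supported integer functions on it.\<close>

fun fox_letter :: "nat \<Rightarrow> letter \<Rightarrow> (word \<Rightarrow>\<^sub>0 int)" where
  "fox_letter j (True, i) = (if i = j then frag_of [] else 0)"
| "fox_letter j (False, i) = (if i = j then - frag_of [(False, i)] else 0)"

text \<open>\<open>fox n j\<close> is \<open>\<partial>/\<partial>x\<^sub>j\<close>, computed from \<open>\<partial>(u v) = \<partial>u + u \<partial>v\<close> for group elements \<open>u\<close>, \<open>v\<close>.\<close>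

fun fox :: "nat \<Rightarrow> nat \<Rightarrow> word \<Rightarrow> (word \<Rightarrow>\<^sub>0 int)" where
  "fox n j [] = 0"
| "fox n j (a # w) =
    fox_letter j a + frag_extend (\<lambda>v. frag_of ([a] \<otimes>\<^bsub>free_group n\<^esub> v)) (fox n j w)"

text \<open>
  The coefficient of \<open>e\<^sub>j\<close> in the image of the \<open>k\<close>-th basis element, an element of the group ring
  of the abelianization.
\<close>

definition alexander_matrix ::
  "nat \<Rightarrow> nat \<Rightarrow> (nat \<Rightarrow> word) \<Rightarrow> nat \<Rightarrow> nat \<Rightarrow> (word set set \<Rightarrow>\<^sub>0 int)" where
  "alexander_matrix n m r k j =
    frag_extend (\<lambda>w. frag_of (ab_proj (presented_group n m r) (presented_proj n m r w)))
      (fox n j (r k))"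

section \<open>Polynomials, power series and the Magnus embedding\<close>

type_synonym monom = "nat \<Rightarrow>\<^sub>0 nat"
type_synonym ipoly = "monom \<Rightarrow>\<^sub>0 int"

definition monom_deg :: "monom \<Rightarrow> nat" where
  "monom_deg e = (\<Sum>i\<in>Poly_Mapping.keys e. Poly_Mapping.lookup e i)"

definition var :: "nat \<Rightarrow> ipoly" where
  "var i = frag_of (Poly_Mapping.single i 1)"

definition S_ring :: "nat \<Rightarrow> ipoly ring" where
  "S_ring n =
    \<lparr>carrier = {p. \<forall>e\<in>Poly_Mapping.keys p. Poly_Mapping.keys e \<subseteq> {..<n}},
     monoid.mult = (*), one = 1, ring.zero = 0, ring.add = (+)\<rparr>"

definition S_deg :: "nat \<Rightarrow> nat \<Rightarrow> ipoly set" where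
  "S_deg n d = {p \<in> carrier (S_ring n). \<forall>e\<in>Poly_Mapping.keys p. monom_deg e = d}"

text \<open>A power series in \<open>s\<^sub>0, ..., s\<^sub>n\<^sub>-\<^sub>1\<close> is given by its coefficient function.\<close>

definition power_series_ring :: "nat \<Rightarrow> (monom \<Rightarrow> int) ring" where
  "power_series_ring n =
    \<lparr>carrier = {f. \<forall>e. f e \<noteq> 0 \<longrightarrow> Poly_Mapping.keys e \<subseteq> {..<n}},
     monoid.mult = (\<lambda>f g e. \<Sum>(a, b)\<in>{(a, b). a + b = e}. f a * g b),
     one = Poly_Mapping.lookup (1 :: ipoly),
     ring.zero = (\<lambda>e. 0),
     ring.add = (\<lambda>f g e. f e + g e)\<rparr>"

text \<open>
  The Magnus embedding on the group ring of the abelianization: the group element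
  \<open>t\<^sub>0\<^bsup>a0\<^esup> ... t\<^sub>n\<^sub>-\<^sub>1\<^bsup>an-1\<^esup>\<close> goes to the product of the \<open>(1 + s\<^sub>i)\<^bsup>ai\<^esup>\<close>.
\<close>

definition magnus_group ::
  "('g, 'b) monoid_scheme \<Rightarrow> nat \<Rightarrow> (nat \<Rightarrow> 'g) \<Rightarrow> 'g set \<Rightarrow> (monom \<Rightarrow> int)" where
  "magnus_group G n x h =
    (\<Otimes>\<^bsub>power_series_ring n\<^esub>i\<in>{..<n}.
       Poly_Mapping.lookup (1 + var i) [^]\<^bsub>power_series_ring n\<^esub> ab_coord G n x h i)"

definition magnus ::
  "('g, 'b) monoid_scheme \<Rightarrow> nat \<Rightarrow> (nat \<Rightarrow> 'g) \<Rightarrow> ('g set \<Rightarrow>\<^sub>0 int) \<Rightarrow> (monom \<Rightarrow> int)" where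
  "magnus G n x p =
    (\<lambda>e. \<Sum>h\<in>Poly_Mapping.keys p. Poly_Mapping.lookup p h * magnus_group G n x h e)"

text \<open>
  Reduction modulo the square of the maximal ideal; a residue class is represented by its unique
  polynomial representative of degree at most 1.
\<close>

definition trunc1 :: "nat \<Rightarrow> (monom \<Rightarrow> int) \<Rightarrow> ipoly" where
  "trunc1 n f =
    (\<Sum>e\<in>{e. Poly_Mapping.keys e \<subseteq> {..<n} \<and> monom_deg e \<le> 1}. Poly_Mapping.single e (f e))"

definition linearized_matrix ::
  "nat \<Rightarrow> nat \<Rightarrow> (nat \<Rightarrow> word) \<Rightarrow> nat \<Rightarrow> nat \<Rightarrow> ipoly" where
  "linearized_matrix n m r k j =
    trunc1 n (magnus (presented_group n m r) n (presented_gen n m r) (alexander_matrix n m r k j))"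

section \<open>Graded modules\<close>

definition quotient_module ::
  "('a, 'b, 'c) module_scheme \<Rightarrow> 'b set \<Rightarrow> ('a, 'b set) module" where
  "quotient_module M N =
    \<lparr>carrier = a_rcosets\<^bsub>M\<^esub> N, monoid.mult = undefined, one = undefined,
     ring.zero = N, ring.add = set_add M,
     smult = (\<lambda>p C. \<Union>v\<in>C. N +>\<^bsub>M\<^esub> (p \<odot>\<^bsub>M\<^esub> v))\<rparr>"

definition graded_module ::
  "('a, 'c) ring_scheme \<Rightarrow> (nat \<Rightarrow> 'a set) \<Rightarrow> ('a, 'b, 'd) module_scheme \<Rightarrow> (nat \<Rightarrow> 'b set) \<Rightarrow> bool"
  where
  "graded_module R R_deg M M_deg \<longleftrightarrow>
    module R M \<and>
    (\<forall>d. additive_subgroup (M_deg d) M) \<and>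
    (\<forall>a b. \<forall>p\<in>R_deg a. \<forall>v\<in>M_deg b. p \<odot>\<^bsub>M\<^esub> v \<in> M_deg (a + b)) \<and>
    (\<forall>v\<in>carrier M. \<exists>!f. (\<forall>d. f d \<in> M_deg d) \<and> finite {d. f d \<noteq> \<zero>\<^bsub>M\<^esub>} \<and>
       v = (\<Oplus>\<^bsub>M\<^esub>d\<in>{d. f d \<noteq> \<zero>\<^bsub>M\<^esub>}. f d))"

definition graded_module_iso ::
  "('a, 'c) ring_scheme \<Rightarrow> (nat \<Rightarrow> 'a set) \<Rightarrow>
   ('a, 'b, 'd) module_scheme \<Rightarrow> (nat \<Rightarrow> 'b set) \<Rightarrow>
   ('a, 'e, 'f) module_scheme \<Rightarrow> (nat \<Rightarrow> 'e set) \<Rightarrow> bool"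
  where
  "graded_module_iso R R_deg M M_deg N N_deg \<longleftrightarrow>
    graded_module R R_deg M M_deg \<and> graded_module R R_deg N N_deg \<and>
    (\<exists>\<phi>. bij_betw \<phi> (carrier M) (carrier N) \<and>
      (\<forall>u\<in>carrier M. \<forall>v\<in>carrier M. \<phi> (u \<oplus>\<^bsub>M\<^esub> v) = \<phi> u \<oplus>\<^bsub>N\<^esub> \<phi> v) \<and>
      (\<forall>p\<in>carrier R. \<forall>v\<in>carrier M. \<phi> (p \<odot>\<^bsub>M\<^esub> v) = p \<odot>\<^bsub>N\<^esub> \<phi> v) \<and>
      (\<forall>d. \<phi> ` M_deg d = N_deg d))"

section \<open>The linearized Alexander invariant\<close>

definition free_module :: "nat \<Rightarrow> nat \<Rightarrow> (ipoly, nat \<Rightarrow> ipoly) module" where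
  "free_module n k =
    \<lparr>carrier = {v. (\<forall>i<k. v i \<in> carrier (S_ring n)) \<and> (\<forall>i\<ge>k. v i = 0)},
     monoid.mult = undefined, one = undefined,
     ring.zero = (\<lambda>i. 0), ring.add = (\<lambda>u v i. u i + v i),
     smult = (\<lambda>p v i. p * v i)\<rparr>"

definition linearized_map ::
  "nat \<Rightarrow> nat \<Rightarrow> (nat \<Rightarrow> word) \<Rightarrow> (nat \<Rightarrow> ipoly) \<Rightarrow> (nat \<Rightarrow> ipoly)" where
  "linearized_map n m r v =
    (\<lambda>j. if j < n then \<Sum>k<m. v k * linearized_matrix n m r k j else 0)"

definition linearized_alexander_module ::
  "nat \<Rightarrow> nat \<Rightarrow> (nat \<Rightarrow> word) \<Rightarrow> (ipoly, (nat \<Rightarrow> ipoly) set) module" where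
  "linearized_alexander_module n m r =
    quotient_module (free_module n n) (linearized_map n m r ` carrier (free_module n m))"

definition koszul_d1 :: "nat \<Rightarrow> (nat \<Rightarrow> ipoly) \<Rightarrow> ipoly" where
  "koszul_d1 n v = (\<Sum>i<n. v i * var i)"

text \<open>
  The kernel of the map induced by \<open>koszul_d1\<close> on the linearized Alexander module. The value of
  the induced map on a coset \<open>C\<close> is the only element of \<open>koszul_d1 n ` C\<close>.
\<close>

definition linearized_alexander_invariant ::
  "nat \<Rightarrow> nat \<Rightarrow> (nat \<Rightarrow> word) \<Rightarrow> (ipoly, (nat \<Rightarrow> ipoly) set) module" where
  "linearized_alexander_invariant n m r =
    (linearized_alexander_module n m r)
      \<lparr>carrier := {C \<in> carrier (linearized_alexander_module n m r). koszul_d1 n ` C = {0}}\<rparr>"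

text \<open>The basis elements \<open>e\<^sub>i\<close> of the free module have degree 1.\<close>

definition free_module_deg :: "nat \<Rightarrow> nat \<Rightarrow> (nat \<Rightarrow> ipoly) set" where
  "free_module_deg n d =
    {v \<in> carrier (free_module n n). \<forall>i. \<forall>e\<in>Poly_Mapping.keys (v i). monom_deg e + 1 = d}"

definition linearized_alexander_invariant_deg ::
  "nat \<Rightarrow> nat \<Rightarrow> (nat \<Rightarrow> word) \<Rightarrow> nat \<Rightarrow> (nat \<Rightarrow> ipoly) set set" where
  "linearized_alexander_invariant_deg n m r d =
    {C \<in> carrier (linearized_alexander_invariant n m r). C \<inter> free_module_deg n d \<noteq> {}}"

section \<open>Second homology and cohomology of a group\<close>

text \<open>
  Everything is computed from the (inhomogeneous, unnormalized) bar complex with trivial integer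
  coefficients. Values of cochains outside the carrier are irrelevant.
\<close>

definition bar_boundary2 :: "('g, 'b) monoid_scheme \<Rightarrow> ('g \<times> 'g \<Rightarrow>\<^sub>0 int) \<Rightarrow> ('g \<Rightarrow>\<^sub>0 int)" where
  "bar_boundary2 G =
    frag_extend (\<lambda>(g, h). frag_of h - frag_of (g \<otimes>\<^bsub>G\<^esub> h) + frag_of g)"

definition bar_boundary3 ::
  "('g, 'b) monoid_scheme \<Rightarrow> ('g \<times> 'g \<times> 'g \<Rightarrow>\<^sub>0 int) \<Rightarrow> ('g \<times> 'g \<Rightarrow>\<^sub>0 int)" where
  "bar_boundary3 G =
    frag_extend (\<lambda>(g, h, k). frag_of (h, k) - frag_of (g \<otimes>\<^bsub>G\<^esub> h, k)
      + frag_of (g, h \<otimes>\<^bsub>G\<^esub> k) - frag_of (g, h))"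

definition cycles2 :: "('g, 'b) monoid_scheme \<Rightarrow> ('g \<times> 'g \<Rightarrow>\<^sub>0 int) set" where
  "cycles2 G = {z. Poly_Mapping.keys z \<subseteq> carrier G \<times> carrier G \<and> bar_boundary2 G z = 0}"

definition homology_class2 ::
  "('g, 'b) monoid_scheme \<Rightarrow> ('g \<times> 'g \<Rightarrow>\<^sub>0 int) \<Rightarrow> ('g \<times> 'g \<Rightarrow>\<^sub>0 int) set" where
  "homology_class2 G z =
    {z + bar_boundary3 G b | b. Poly_Mapping.keys b \<subseteq> carrier G \<times> carrier G \<times> carrier G}"

definition homology2 :: "('g, 'b) monoid_scheme \<Rightarrow> ('g \<times> 'g \<Rightarrow>\<^sub>0 int) set set" where
  "homology2 G = homology_class2 G ` cycles2 G"

definition cocycles2 :: "('g, 'b) monoid_scheme \<Rightarrow> ('g \<times> 'g \<Rightarrow> int) set" where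
  "cocycles2 G =
    {f. \<forall>g\<in>carrier G. \<forall>h\<in>carrier G. \<forall>k\<in>carrier G.
       f (h, k) - f (g \<otimes>\<^bsub>G\<^esub> h, k) + f (g, h \<otimes>\<^bsub>G\<^esub> k) - f (g, h) = 0}"

definition cohomology_class2 ::
  "('g, 'b) monoid_scheme \<Rightarrow> ('g \<times> 'g \<Rightarrow> int) \<Rightarrow> ('g \<times> 'g \<Rightarrow> int) set" where
  "cohomology_class2 G f =
    {f' \<in> cocycles2 G. \<exists>c. \<forall>g\<in>carrier G. \<forall>h\<in>carrier G.
       f' (g, h) = f (g, h) + (c h - c (g \<otimes>\<^bsub>G\<^esub> h) + c g)}"

text \<open>The pairing does not depend on the choice of the representatives.\<close>

definition kronecker :: "('g \<times> 'g \<Rightarrow>\<^sub>0 int) set \<Rightarrow> ('g \<times> 'g \<Rightarrow> int) set \<Rightarrow> int" where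
  "kronecker c u =
    (let z = (SOME z. z \<in> c); f = (SOME f. f \<in> u)
     in \<Sum>x\<in>Poly_Mapping.keys z. Poly_Mapping.lookup z x * f x)"

text \<open>
  Degree-one cohomology is the group of homomorphisms to the integers; \<open>dual_class G n x i\<close> is the
  element of the basis dual to the classes of \<open>x 0, ..., x (n - 1)\<close>.
\<close>

definition dual_class :: "('g, 'b) monoid_scheme \<Rightarrow> nat \<Rightarrow> (nat \<Rightarrow> 'g) \<Rightarrow> nat \<Rightarrow> 'g \<Rightarrow> int" where
  "dual_class G n x i g = ab_coord G n x (ab_proj G g) i"

definition cup :: "('g, 'b) monoid_scheme \<Rightarrow> ('g \<Rightarrow> int) \<Rightarrow> ('g \<Rightarrow> int) \<Rightarrow> ('g \<times> 'g \<Rightarrow> int) set" where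
  "cup G a b = cohomology_class2 G (\<lambda>(g, h). a g * b h)"

section \<open>Lie algebras over the integers\<close>

text \<open>
  A (not necessarily associative or unital) algebra over the integers is a ring record whose
  component \<open>one\<close> is irrelevant. For Lie algebras \<open>mult\<close> is the bracket, and the quotient by an
  ideal is \<open>L Quot I\<close>.
\<close>

definition algebra_ideal :: "('a, 'b) ring_scheme \<Rightarrow> 'a set \<Rightarrow> bool" where
  "algebra_ideal L I \<longleftrightarrow>
    additive_subgroup I L \<and>
    (\<forall>a\<in>I. \<forall>u\<in>carrier L. a \<otimes>\<^bsub>L\<^esub> u \<in> I \<and> u \<otimes>\<^bsub>L\<^esub> a \<in> I)"

definition ideal_generated :: "('a, 'b) ring_scheme \<Rightarrow> 'a set \<Rightarrow> 'a set" where
  "ideal_generated L A = \<Inter>{I. algebra_ideal L I \<and> A \<subseteq> I}"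

text \<open>The additive subgroup generated by all brackets of elements of \<open>U\<close>.\<close>

definition bracket_span :: "('a, 'b) ring_scheme \<Rightarrow> 'a set \<Rightarrow> 'a set" where
  "bracket_span L U = generate (add_monoid L) {u \<otimes>\<^bsub>L\<^esub> v | u v. u \<in> U \<and> v \<in> U}"

definition derived_subalgebra :: "('a, 'b) ring_scheme \<Rightarrow> 'a set" where
  "derived_subalgebra L = bracket_span L (carrier L)"

definition second_derived_subalgebra :: "('a, 'b) ring_scheme \<Rightarrow> 'a set" where
  "second_derived_subalgebra L = bracket_span L (derived_subalgebra L)"

subsection \<open>Free Lie algebras\<close>

datatype lie_term = Gen nat | Br lie_term lie_term

fun term_gens :: "lie_term \<Rightarrow> nat set" where
  "term_gens (Gen i) = {i}"
| "term_gens (Br s t) = term_gens s \<union> term_gens t"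

fun term_deg :: "lie_term \<Rightarrow> nat" where
  "term_deg (Gen i) = 1"
| "term_deg (Br s t) = term_deg s + term_deg t"

definition free_nonassoc_algebra :: "nat \<Rightarrow> (lie_term \<Rightarrow>\<^sub>0 int) ring" where
  "free_nonassoc_algebra n =
    \<lparr>carrier = {p. \<forall>t\<in>Poly_Mapping.keys p. term_gens t \<subseteq> {..<n}},
     monoid.mult = (\<lambda>p q. frag_extend (\<lambda>s. frag_extend (\<lambda>t. frag_of (Br s t)) q) p),
     one = 0, ring.zero = 0, ring.add = (+)\<rparr>"

definition lie_relations :: "('a, 'b) ring_scheme \<Rightarrow> 'a set" where
  "lie_relations A =
    {p \<otimes>\<^bsub>A\<^esub> p | p. p \<in> carrier A} \<union>
    {p \<otimes>\<^bsub>A\<^esub> (q \<otimes>\<^bsub>A\<^esub> w) \<oplus>\<^bsub>A\<^esub> q \<otimes>\<^bsub>A\<^esub> (w \<otimes>\<^bsub>A\<^esub> p) \<oplus>\<^bsub>A\<^esub> w \<otimes>\<^bsub>A\<^esub> (p \<otimes>\<^bsub>A\<^esub> q)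
       | p q w. p \<in> carrier A \<and> q \<in> carrier A \<and> w \<in> carrier A}"

definition free_lie_ideal :: "nat \<Rightarrow> (lie_term \<Rightarrow>\<^sub>0 int) set" where
  "free_lie_ideal n = ideal_generated (free_nonassoc_algebra n) (lie_relations (free_nonassoc_algebra n))"

definition free_lie_algebra :: "nat \<Rightarrow> (lie_term \<Rightarrow>\<^sub>0 int) set ring" where
  "free_lie_algebra n = free_nonassoc_algebra n Quot free_lie_ideal n"

definition free_lie_gen :: "nat \<Rightarrow> nat \<Rightarrow> (lie_term \<Rightarrow>\<^sub>0 int) set" where
  "free_lie_gen n i = free_lie_ideal n +>\<^bsub>free_nonassoc_algebra n\<^esub> frag_of (Gen i)"

definition free_lie_deg :: "nat \<Rightarrow> nat \<Rightarrow> (lie_term \<Rightarrow>\<^sub>0 int) set set" where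
  "free_lie_deg n d =
    {free_lie_ideal n +>\<^bsub>free_nonassoc_algebra n\<^esub> p
       | p. p \<in> carrier (free_nonassoc_algebra n) \<and> (\<forall>t\<in>Poly_Mapping.keys p. term_deg t = d)}"

section \<open>The holonomy Lie algebra\<close>

text \<open>
  In the following, \<open>x 0, ..., x (n - 1)\<close> are elements of \<open>G\<close> whose classes \<open>y\<^sub>0, ..., y\<^sub>n\<^sub>-\<^sub>1\<close> form
  a basis of the abelianization; the free Lie algebra on the abelianization is the one on these
  classes, and its degree 2 part is the second exterior power, \<open>y\<^sub>i \<and> y\<^sub>j\<close> being the bracket
  \<open>[y\<^sub>i, y\<^sub>j]\<close>. The dual of the cup product takes a function \<open>\<xi>\<close> on the second cohomology to the
  element of the exterior square with coefficients \<open>\<xi> (y\<^sub>i\<^sup>* \<union> y\<^sub>j\<^sup>*)\<close>, where \<open>i < j\<close>.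
\<close>

definition dual_cup ::
  "('g, 'b) monoid_scheme \<Rightarrow> nat \<Rightarrow> (nat \<Rightarrow> 'g) \<Rightarrow> (('g \<times> 'g \<Rightarrow> int) set \<Rightarrow> int) \<Rightarrow>
   (lie_term \<Rightarrow>\<^sub>0 int) set" where
  "dual_cup G n x \<xi> =
    (\<Oplus>\<^bsub>free_lie_algebra n\<^esub>ij\<in>{(i, j). i < j \<and> j < n}.
       [\<xi> (cup G (dual_class G n x (fst ij)) (dual_class G n x (snd ij)))] \<cdot>\<^bsub>free_lie_algebra n\<^esub>
         (free_lie_gen n (fst ij) \<otimes>\<^bsub>free_lie_algebra n\<^esub> free_lie_gen n (snd ij)))"

definition holonomy_boundary ::
  "('g, 'b) monoid_scheme \<Rightarrow> nat \<Rightarrow> (nat \<Rightarrow> 'g) \<Rightarrow> ('g \<times> 'g \<Rightarrow>\<^sub>0 int) set \<Rightarrow> (lie_term \<Rightarrow>\<^sub>0 int) set"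
  where
  "holonomy_boundary G n x c = dual_cup G n x (kronecker c)"

definition holonomy_ideal ::
  "('g, 'b) monoid_scheme \<Rightarrow> nat \<Rightarrow> (nat \<Rightarrow> 'g) \<Rightarrow> (lie_term \<Rightarrow>\<^sub>0 int) set set" where
  "holonomy_ideal G n x =
    ideal_generated (free_lie_algebra n) (holonomy_boundary G n x ` homology2 G)"

definition holonomy_lie_algebra ::
  "('g, 'b) monoid_scheme \<Rightarrow> nat \<Rightarrow> (nat \<Rightarrow> 'g) \<Rightarrow> (lie_term \<Rightarrow>\<^sub>0 int) set set ring" where
  "holonomy_lie_algebra G n x = free_lie_algebra n Quot holonomy_ideal G n x"

definition holonomy_gen ::
  "('g, 'b) monoid_scheme \<Rightarrow> nat \<Rightarrow> (nat \<Rightarrow> 'g) \<Rightarrow> nat \<Rightarrow> (lie_term \<Rightarrow>\<^sub>0 int) set set" where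
  "holonomy_gen G n x i = holonomy_ideal G n x +>\<^bsub>free_lie_algebra n\<^esub> free_lie_gen n i"

definition holonomy_deg ::
  "('g, 'b) monoid_scheme \<Rightarrow> nat \<Rightarrow> (nat \<Rightarrow> 'g) \<Rightarrow> nat \<Rightarrow> (lie_term \<Rightarrow>\<^sub>0 int) set set set" where
  "holonomy_deg G n x d =
    {holonomy_ideal G n x +>\<^bsub>free_lie_algebra n\<^esub> p | p. p \<in> free_lie_deg n d}"

section \<open>The infinitesimal Alexander invariant\<close>

text \<open>
  For a Lie algebra \<open>H\<close> with elements \<open>y 0, ..., y (n - 1)\<close>, the quotient of the derived subalgebra
  by the second derived subalgebra is formed inside the maximal metabelian quotient of \<open>H\<close>. There
  the operators \<open>ad (y i)\<close> commute, so the order of composition in \<open>ad_monom\<close> is immaterial.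
\<close>

definition metabelian_quotient :: "('a, 'b) ring_scheme \<Rightarrow> 'a set ring" where
  "metabelian_quotient H = H Quot second_derived_subalgebra H"

definition ad_gen :: "('a, 'b) ring_scheme \<Rightarrow> 'a \<Rightarrow> 'a set \<Rightarrow> 'a set" where
  "ad_gen H y c =
    (second_derived_subalgebra H +>\<^bsub>H\<^esub> y) \<otimes>\<^bsub>metabelian_quotient H\<^esub> c"

definition ad_monom ::
  "('a, 'b) ring_scheme \<Rightarrow> nat \<Rightarrow> (nat \<Rightarrow> 'a) \<Rightarrow> monom \<Rightarrow> 'a set \<Rightarrow> 'a set" where
  "ad_monom H n y e c =
    foldr (\<lambda>i. ad_gen H (y i) ^^ Poly_Mapping.lookup e i) [0..<n] c"

definition lie_alexander_invariant ::
  "('a, 'b) ring_scheme \<Rightarrow> nat \<Rightarrow> (nat \<Rightarrow> 'a) \<Rightarrow> (ipoly, 'a set) module" where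
  "lie_alexander_invariant H n y =
    \<lparr>carrier = {second_derived_subalgebra H +>\<^bsub>H\<^esub> u | u. u \<in> derived_subalgebra H},
     monoid.mult = undefined, one = undefined,
     ring.zero = \<zero>\<^bsub>metabelian_quotient H\<^esub>, ring.add = ring.add (metabelian_quotient H),
     smult = (\<lambda>p c. \<Oplus>\<^bsub>metabelian_quotient H\<^esub>e\<in>Poly_Mapping.keys p.
       [Poly_Mapping.lookup p e] \<cdot>\<^bsub>metabelian_quotient H\<^esub> ad_monom H n y e c)\<rparr>"

definition lie_alexander_invariant_deg ::
  "('a, 'b) ring_scheme \<Rightarrow> (nat \<Rightarrow> 'a set) \<Rightarrow> nat \<Rightarrow> 'a set set" where
  "lie_alexander_invariant_deg H H_deg d =
    {second_derived_subalgebra H +>\<^bsub>H\<^esub> u | u. u \<in> derived_subalgebra H \<inter> H_deg d}"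

definition infinitesimal_alexander_invariant ::
  "('g, 'b) monoid_scheme \<Rightarrow> nat \<Rightarrow> (nat \<Rightarrow> 'g) \<Rightarrow> (ipoly, (lie_term \<Rightarrow>\<^sub>0 int) set set set) module"
  where
  "infinitesimal_alexander_invariant G n x =
    lie_alexander_invariant (holonomy_lie_algebra G n x) n (holonomy_gen G n x)"

definition infinitesimal_alexander_invariant_deg ::
  "('g, 'b) monoid_scheme \<Rightarrow> nat \<Rightarrow> (nat \<Rightarrow> 'g) \<Rightarrow> nat \<Rightarrow> (lie_term \<Rightarrow>\<^sub>0 int) set set set set"
  where
  "infinitesimal_alexander_invariant_deg G n x d =
    lie_alexander_invariant_deg (holonomy_lie_algebra G n x) (holonomy_deg G n x) d"

end

theory Submission
  imports Defs
begin

text \<open>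
  Both invariants are quotients of the kernel of \<open>d\<^sub>1\<close> by the same submodule. The free \<open>S\<close>-module
  with the bracket \<open>[u, v] = d\<^sub>1(u) v - d\<^sub>1(v) u\<close> is a Lie ring in which \<open>ker d\<^sub>1\<close> is abelian and
  \<open>[e\<^sub>i, v] = s\<^sub>i v\<close> for \<open>v \<in> ker d\<^sub>1\<close>. Sending \<open>y\<^sub>i\<close> to \<open>e\<^sub>i\<close> therefore gives an \<open>S\<close>-linear map
  \<open>L'/L'' \<rightarrow> ker d\<^sub>1\<close> for the free Lie ring \<open>L\<close>. Rewriting with the Jacobi identity shows that \<open>L'/L''\<close>
  is spanned by the elements \<open>s\<^sup>e [y\<^sub>b, y\<^sub>a]\<close> with \<open>b < a\<close> and \<open>b \<le> min e\<close>, whose images have distinct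
  leading terms; this yields an explicit inverse, and with it exactness of the Koszul complex at \<open>d\<^sub>1\<close>.

  For a word \<open>w\<close> let \<open>c\<^sub>i\<^sub>j(w)\<close> be the augmentation of \<open>\<partial>\<^sub>i \<partial>\<^sub>j w\<close>. Since the relators are commutators, the
  matrices \<open>c(r\<^sub>k)\<close> are alternating and the linearized Alexander matrix sends the \<open>k\<close>-th basis element to
  \<open>\<Sum>\<^sub>i\<^sub><\<^sub>j c\<^sub>i\<^sub>j(r\<^sub>k) [e\<^sub>i, e\<^sub>j]\<close>. On the other hand \<open>c\<^sub>i\<^sub>j(u v) = c\<^sub>i\<^sub>j(u) + c\<^sub>i\<^sub>j(v) + a\<^sub>i(u) a\<^sub>j(v)\<close> with \<open>a\<^sub>i\<close> the
  exponent sums, so that \<open>c\<^sub>i\<^sub>j\<close> trivializes the cup product \<open>y\<^sub>i\<^sup>* \<union> y\<^sub>j\<^sup>*\<close> over the free group, and as in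
  Hopf's formula the cup products take on the second homology exactly the values \<open>c\<^sub>i\<^sub>j\<close> on the
  relation subgroup. These are the integer combinations of the \<open>c(r\<^sub>k)\<close>.
\<close>

text \<open>The free Lie ring, the holonomy Lie algebra and its maximal metabelian quotient are
  iterated sets of cosets over the integers, with no basis at hand. The proof therefore computes
  with representatives in the free nonassociative algebra. The Koszul model and the metabelian
  quotient are both targets of homomorphisms from it that kill products of two brackets, so an
  identity obtained by rewriting representatives holds in both at once. The map from ker d_1 to the
  second invariant is the section followed by the projection, and no map out of a Lie quotient is
  built. The two inclusions between the relation modules have different sources: an ideal of
  representatives pushed down the tower of quotients shows that only linearized relations die, while
  explicit bar cycles, one per relator, show that all of them die. Integrality needs care: the cup
  product values must fill the lattice spanned by the matrices c(r_k) exactly, not up to finite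
  index, and c_ii(r_k) = 0 comes from 2 c_ii = a_i^2 - a_i. The degrees match because [e_i, e_j] =
  s_i e_j - s_j e_i has degree two when each e_i has degree one.\<close>

abbreviation keys :: "('a \<Rightarrow>\<^sub>0 'b::zero) \<Rightarrow> 'a set" where
  "keys \<equiv> Poly_Mapping.keys"

abbreviation lookup :: "('a \<Rightarrow>\<^sub>0 'b::zero) \<Rightarrow> 'a \<Rightarrow> 'b" where
  "lookup \<equiv> Poly_Mapping.lookup"

section \<open>Free groups\<close>

lemma letter_inv_letter_inv [simp]: "letter_inv (letter_inv a) = a"
  by (simp add: letter_inv_def)

lemma snd_letter_inv [simp]: "snd (letter_inv a) = snd a"
  by (simp add: letter_inv_def)

lemma letter_inv_neq [simp]: "a \<noteq> letter_inv a"
  by (auto simp: letter_inv_def prod_eq_iff)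

lemma reduced_Nil [simp]: "reduced []"
  by (simp add: reduced_def)

lemma reduced_single [simp]: "reduced [a]"
  by (simp add: reduced_def)

lemma reduced_Cons_Cons [simp]:
  "reduced (a # b # w) \<longleftrightarrow> b \<noteq> letter_inv a \<and> reduced (b # w)"
  by (simp add: reduced_def)

lemma reduced_ConsD: "reduced (a # w) \<Longrightarrow> reduced w"
  by (cases w) auto

lemma reduced_cons_reduce: "reduced w \<Longrightarrow> reduced (cons_reduce a w)"
  by (cases w) (auto dest: reduced_ConsD)

lemma reduced_foldr_cons_reduce: "reduced v \<Longrightarrow> reduced (foldr cons_reduce u v)"
  by (induction u) (auto intro: reduced_cons_reduce)

lemma cons_reduce_reduced: "reduced (a # w) \<Longrightarrow> cons_reduce a w = a # w"
  by (cases w) auto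

lemma foldr_cons_reduce_Nil: "reduced u \<Longrightarrow> foldr cons_reduce u [] = u"
proof (induction u)
  case (Cons a u)
  then show ?case
    using reduced_ConsD[OF Cons.prems] by (simp add: cons_reduce_reduced del: split_paired_All)
qed simp

lemma cons_reduce_cancel:
  "reduced w \<Longrightarrow> cons_reduce a (cons_reduce (letter_inv a) w) = w"
  by (cases w) (auto simp: cons_reduce_reduced)

text \<open>The step behind associativity. If \<open>a\<close> cancels against the head of
  \<open>v\<close>, the right side prepends the inverse of \<open>a\<close> and then
  \<open>a\<close>, which \<open>cons_reduce_cancel\<close> undoes; otherwise both sides unfold
  alike.\<close>

lemma foldr_cons_reduce_cons_reduce:
  assumes "reduced v" "reduced w"
  shows "foldr cons_reduce (cons_reduce a v) w = cons_reduce a (foldr cons_reduce v w)"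
proof (cases v)
  case (Cons b v')
  show ?thesis
  proof (cases "b = letter_inv a")
    case True
    have "reduced (foldr cons_reduce v' w)"
      by (rule reduced_foldr_cons_reduce[OF assms(2)])
    then show ?thesis
      using Cons True by (simp add: cons_reduce_cancel)
  qed (simp add: Cons)
qed simp

lemma foldr_cons_reduce_assoc:
  assumes "reduced v" "reduced w"
  shows "foldr cons_reduce (foldr cons_reduce u v) w = foldr cons_reduce u (foldr cons_reduce v w)"
  using assms
  by (induction u) (auto simp: foldr_cons_reduce_cons_reduce reduced_foldr_cons_reduce)

lemma set_cons_reduce: "set (cons_reduce a w) \<subseteq> insert a (set w)"
  by (cases w) auto

lemma set_foldr_cons_reduce: "set (foldr cons_reduce u v) \<subseteq> set u \<union> set v"
  by (induction u) (use set_cons_reduce in fastforce)+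

lemma foldr_cons_reduce_inverse:
  "foldr cons_reduce (rev (map letter_inv u)) (foldr cons_reduce u []) = []"
proof -
  have "foldr cons_reduce (rev (map letter_inv u)) (foldr cons_reduce u w) = w"
    if "reduced w" for w
    using that
  proof (induction u arbitrary: w)
    case (Cons a u)
    have "reduced (foldr cons_reduce u w)"
      by (rule reduced_foldr_cons_reduce[OF Cons.prems])
    then have "cons_reduce (letter_inv a) (cons_reduce a (foldr cons_reduce u w))
        = foldr cons_reduce u w"
      using cons_reduce_cancel[of _ "letter_inv a"] by simp
    then show ?case
      using Cons by simp
  qed simp
  then show ?thesis by simp
qed

lemma free_group_carrier:
  "w \<in> carrier (free_group n) \<longleftrightarrow> reduced w \<and> snd ` set w \<subseteq> {..<n}"
  by (simp add: free_group_def)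

lemma free_group_mult: "u \<otimes>\<^bsub>free_group n\<^esub> v = foldr cons_reduce u v"
  by (simp add: free_group_def)

lemma free_group_one: "\<one>\<^bsub>free_group n\<^esub> = []"
  by (simp add: free_group_def)

lemma letter_in_free_group [simp]: "[a] \<in> carrier (free_group n) \<longleftrightarrow> snd a < n"
  by (simp add: free_group_carrier)

lemma free_group_closed:
  assumes "u \<in> carrier (free_group n)" "v \<in> carrier (free_group n)"
  shows "foldr cons_reduce u v \<in> carrier (free_group n)"
proof -
  have "snd ` set (foldr cons_reduce u v) \<subseteq> snd ` set u \<union> snd ` set v"
    using image_mono[OF set_foldr_cons_reduce] by (simp add: image_Un)
  also have "\<dots> \<subseteq> {..<n}"
    using assms by (simp add: free_group_carrier)
  finally show ?thesis
    using assms by (simp add: free_group_carrier reduced_foldr_cons_reduce)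
qed

lemma group_free_group: "group (free_group n)"
proof (rule groupI)
  fix u assume u: "u \<in> carrier (free_group n)"
  \<comment> \<open>The formal inverse is passed through the reduction, so that its membership in
    the carrier follows without showing that it is already reduced.\<close>
  define v where "v = foldr cons_reduce (rev (map letter_inv u)) []"
  have "snd ` set v \<subseteq> snd ` (letter_inv ` set u)"
    using image_mono[OF set_foldr_cons_reduce[of "rev (map letter_inv u)" "[]"], of snd]
    by (simp add: v_def)
  then have v: "v \<in> carrier (free_group n)"
    using u by (auto simp: free_group_carrier v_def reduced_foldr_cons_reduce image_image)
  have "foldr cons_reduce v u = foldr cons_reduce (rev (map letter_inv u)) (foldr cons_reduce [] u)"
    unfolding v_def using u by (intro foldr_cons_reduce_assoc) (auto simp: free_group_carrier)
  also have "\<dots> = []"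
    using foldr_cons_reduce_inverse[of u] u by (simp add: foldr_cons_reduce_Nil free_group_carrier)
  finally show "\<exists>v\<in>carrier (free_group n). v \<otimes>\<^bsub>free_group n\<^esub> u = \<one>\<^bsub>free_group n\<^esub>"
    using v by (auto simp: free_group_mult free_group_one)
next
  fix u v w
  assume "v \<in> carrier (free_group n)" "w \<in> carrier (free_group n)"
  then show "u \<otimes>\<^bsub>free_group n\<^esub> v \<otimes>\<^bsub>free_group n\<^esub> w = u \<otimes>\<^bsub>free_group n\<^esub> (v \<otimes>\<^bsub>free_group n\<^esub> w)"
    by (simp add: free_group_mult free_group_carrier foldr_cons_reduce_assoc)
qed (simp_all add: free_group_mult free_group_closed, simp_all add: free_group_one free_group_carrier)

section \<open>Exponent sums and quadratic Magnus coefficients of words\<close>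

definition letter_exp :: "nat \<Rightarrow> letter \<Rightarrow> int" where
  "letter_exp i a = (if snd a = i then if fst a then 1 else - 1 else 0)"

definition word_exp :: "nat \<Rightarrow> word \<Rightarrow> int" where
  "word_exp i w = (\<Sum>a\<leftarrow>w. letter_exp i a)"

text \<open>\<open>mcoeff i j w\<close> is the augmentation of \<open>\<partial>\<^sub>i \<partial>\<^sub>j w\<close>, that is, the coefficient of \<open>X\<^sub>i X\<^sub>j\<close> in the noncommutative Magnus expansion of \<open>w\<close>.\<close>

fun mcoeff :: "nat \<Rightarrow> nat \<Rightarrow> word \<Rightarrow> int" where
  "mcoeff i j [] = 0"
| "mcoeff i j (a # w) =
    (if i = j \<and> a = (False, i) then 1 else 0) + mcoeff i j w + letter_exp i a * word_exp j w"

lemma word_exp_Nil [simp]: "word_exp i [] = 0"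
  by (simp add: word_exp_def)

lemma word_exp_Cons [simp]: "word_exp i (a # w) = letter_exp i a + word_exp i w"
  by (simp add: word_exp_def)

lemma letter_exp_letter_inv [simp]: "letter_exp i (letter_inv a) = - letter_exp i a"
  by (simp add: letter_exp_def letter_inv_def)

lemma word_exp_cons_reduce: "word_exp i (cons_reduce a w) = letter_exp i a + word_exp i w"
  by (cases w) auto

text \<open>The summand for \<open>(False, i)\<close> is the coefficient of X_i^2 in (1 + X_i)^-1.
  In a cancelling pair with index i = j it offsets the product -1 of the two exponents, so
  \<open>mcoeff\<close> is invariant under free reduction.\<close>

lemma mcoeff_cons_reduce: "mcoeff i j (cons_reduce a w) = mcoeff i j (a # w)"
proof (cases w)
  case (Cons b w')
  then show ?thesis
    by (cases a) (auto simp: letter_exp_def letter_inv_def)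
qed simp

lemma word_exp_mult:
  "word_exp i (u \<otimes>\<^bsub>free_group n\<^esub> v) = word_exp i u + word_exp i v"
  by (induction u) (auto simp: free_group_mult word_exp_cons_reduce)

text \<open>The coefficient of X_i X_j in a product of two noncommutative power series with constant
  term 1.\<close>

lemma mcoeff_mult:
  "mcoeff i j (u \<otimes>\<^bsub>free_group n\<^esub> v) = mcoeff i j u + mcoeff i j v + word_exp i u * word_exp j v"
proof (induction u)
  case (Cons a u)
  have "mcoeff i j (a # foldr cons_reduce u v) =
    (if i = j \<and> a = (False, i) then 1 else 0) + mcoeff i j (foldr cons_reduce u v)
      + letter_exp i a * (word_exp j u + word_exp j v)"
    using word_exp_mult[of j _ u v] by (simp add: free_group_mult)
  then show ?case
    using Cons by (simp add: free_group_mult mcoeff_cons_reduce algebra_simps)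
qed (simp add: free_group_mult)

text \<open>The quadratic shuffle relation. When the exponent sums vanish, it makes the matrix of
  coefficients antisymmetric off the diagonal.\<close>

lemma mcoeff_shuffle:
  "i \<noteq> j \<Longrightarrow> mcoeff i j w + mcoeff j i w = word_exp i w * word_exp j w"
  by (induction w) (auto simp: algebra_simps letter_exp_def)

text \<open>Setting all variables except X_i to zero leaves (1 + X_i)^a with a the exponent sum,
  whose quadratic coefficient is a (a - 1) / 2; doubling avoids the division.\<close>

lemma mcoeff_diag: "2 * mcoeff i i w = word_exp i w * word_exp i w - word_exp i w"
proof (induction w)
  case (Cons a w)
  then show ?case
    by (cases a) (auto simp: algebra_simps letter_exp_def)
qed simp

lemma word_exp_inv:
  assumes "w \<in> carrier (free_group n)"
  shows "word_exp i (inv\<^bsub>free_group n\<^esub> w) = - word_exp i w"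
proof -
  interpret group "free_group n" by (rule group_free_group)
  have "word_exp i (inv\<^bsub>free_group n\<^esub> w \<otimes>\<^bsub>free_group n\<^esub> w) = 0"
    using assms by (simp add: free_group_one)
  then show ?thesis by (simp add: word_exp_mult)
qed

lemma mcoeff_inv:
  assumes "w \<in> carrier (free_group n)"
  shows "mcoeff i j (inv\<^bsub>free_group n\<^esub> w) = - mcoeff i j w + word_exp i w * word_exp j w"
proof -
  interpret group "free_group n" by (rule group_free_group)
  have "mcoeff i j (inv\<^bsub>free_group n\<^esub> w \<otimes>\<^bsub>free_group n\<^esub> w) = 0"
    using assms by (simp add: free_group_one)
  then show ?thesis using assms by (simp only: mcoeff_mult word_exp_inv[OF assms])
qed

lemma word_exp_derived:
  assumes "w \<in> derived (free_group n) (carrier (free_group n))"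
  shows "word_exp i w = 0"
proof -
  interpret group "free_group n" by (rule group_free_group)
  let ?K = "{w \<in> carrier (free_group n). word_exp i w = 0}"
  have "subgroup ?K (free_group n)"
    by (rule subgroupI) (auto simp: word_exp_inv word_exp_mult intro!: exI[of _ "\<one>\<^bsub>free_group n\<^esub>"]
        simp: free_group_one[of n])
  moreover have "derived_set (free_group n) (carrier (free_group n)) \<subseteq> ?K"
    by (auto simp: word_exp_inv word_exp_mult)
  ultimately have "derived (free_group n) (carrier (free_group n)) \<subseteq> ?K"
    unfolding derived_def by (rule generate_subgroup_incl[rotated])
  then show ?thesis using assms by auto
qed

section \<open>Commutator-relators groups\<close>

locale commutator_presentation =
  fixes n m :: nat and r :: "nat \<Rightarrow> word"
  assumes relators: "commutator_relators n m r"
begin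

abbreviation "F \<equiv> free_group n"
abbreviation "R \<equiv> relation_subgroup n m r"
abbreviation "G \<equiv> presented_group n m r"
abbreviation "gen \<equiv> presented_gen n m r"
abbreviation "\<phi> \<equiv> presented_proj n m r"
abbreviation "Gab \<equiv> abelianization G"
abbreviation "\<alpha> \<equiv> ab_proj G"

sublocale F: group F
  by (rule group_free_group)

lemma relator_derived: "k < m \<Longrightarrow> r k \<in> derived F (carrier F)"
  using relators by (simp add: commutator_relators_def)

lemma relator_closed: "k < m \<Longrightarrow> r k \<in> carrier F"
  using relator_derived F.derived_in_carrier by blast

lemma word_exp_relator: "k < m \<Longrightarrow> word_exp i (r k) = 0"
  using relator_derived word_exp_derived by blast

lemma relation_subgroup_normal: "R \<lhd> F"
proof -
  let ?\<N> = "{N. N \<lhd> F \<and> r ` {..<m} \<subseteq> N}"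
  have ne: "?\<N> \<noteq> {}"
    using normal.intro F.normal_self relator_closed by blast
  have sub: "subgroup (\<Inter>?\<N>) F"
    using ne by (intro F.subgroups_Inter) (auto intro: normal_imp_subgroup)
  have "u \<otimes>\<^bsub>F\<^esub> h \<otimes>\<^bsub>F\<^esub> inv\<^bsub>F\<^esub> u \<in> \<Inter>?\<N>" if "u \<in> carrier F" "h \<in> \<Inter>?\<N>" for u h
    using that by (auto intro: normal.inv_op_closed2)
  then show ?thesis
    using sub unfolding relation_subgroup_def normal_closure_def by (auto simp: F.normal_inv_iff)
qed

sublocale R: normal R F
  by (rule relation_subgroup_normal)

lemma relation_subgroup_least: "N \<lhd> F \<Longrightarrow> r ` {..<m} \<subseteq> N \<Longrightarrow> R \<subseteq> N"
  unfolding relation_subgroup_def normal_closure_def by blast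

lemma relator_in_relation_subgroup: "k < m \<Longrightarrow> r k \<in> R"
  unfolding relation_subgroup_def normal_closure_def by auto

text \<open>On words with vanishing exponent sums \<open>mcoeff i j\<close> is an additive, conjugation invariant
  function, so its values on \<open>R\<close> are determined by those on the relators.\<close>

lemma relation_subgroup_coeffs:
  assumes "w \<in> R"
  shows "word_exp i w = 0"
    and "\<exists>t. \<forall>i j. mcoeff i j w = (\<Sum>k<m. t k * mcoeff i j (r k))"
proof -
  define P where "P t w \<longleftrightarrow> (\<forall>i j. mcoeff i j w = (\<Sum>k<m. t k * mcoeff i j (r k)))" for t w
  define N where "N = {w \<in> carrier F. (\<forall>i. word_exp i w = 0) \<and> (\<exists>t. P t w)}"
  have sub: "subgroup N F"
  proof (rule F.subgroupI)
    have "P (\<lambda>_. 0) []"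
      by (simp add: P_def)
    moreover have "[] \<in> carrier F" "\<forall>i. word_exp i [] = 0"
      using F.one_closed by (simp_all add: free_group_one)
    ultimately show "N \<noteq> {}"
      unfolding N_def by blast
    show "inv\<^bsub>F\<^esub> w \<in> N" if h: "w \<in> N" for w
    proof -
      obtain t where w: "w \<in> carrier F" "\<forall>i. word_exp i w = 0" "P t w"
        using h unfolding N_def by blast
      then have "P (\<lambda>k. - t k) (inv\<^bsub>F\<^esub> w)"
        by (simp add: P_def mcoeff_inv sum_negf)
      moreover have "inv\<^bsub>F\<^esub> w \<in> carrier F" "\<forall>i. word_exp i (inv\<^bsub>F\<^esub> w) = 0"
        using w by (simp_all add: word_exp_inv)
      ultimately show ?thesis
        unfolding N_def by blast
    qed
    show "v \<otimes>\<^bsub>F\<^esub> w \<in> N" if h: "v \<in> N" "w \<in> N" for v w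
    proof -
      obtain s where v: "v \<in> carrier F" "\<forall>i. word_exp i v = 0" "P s v"
        using h unfolding N_def by blast
      obtain t where w: "w \<in> carrier F" "\<forall>i. word_exp i w = 0" "P t w"
        using h unfolding N_def by blast
      have "P (\<lambda>k. s k + t k) (v \<otimes>\<^bsub>F\<^esub> w)"
        using v w by (simp add: P_def mcoeff_mult sum.distrib algebra_simps)
      moreover have "v \<otimes>\<^bsub>F\<^esub> w \<in> carrier F" "\<forall>i. word_exp i (v \<otimes>\<^bsub>F\<^esub> w) = 0"
        using v w by (simp_all add: word_exp_mult)
      ultimately show ?thesis
        unfolding N_def by blast
    qed
  qed (simp add: N_def)
  have "u \<otimes>\<^bsub>F\<^esub> w \<otimes>\<^bsub>F\<^esub> inv\<^bsub>F\<^esub> u \<in> N" if h: "u \<in> carrier F" "w \<in> N" for u w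
  proof -
    obtain t where w: "w \<in> carrier F" "\<forall>i. word_exp i w = 0" "P t w"
      using h unfolding N_def by blast
    \<comment> \<open>The exponent sums of \<open>w\<close> are zero, so its cross terms vanish. The
      product a_i(u) a_j(u) contributed by the inverse of \<open>u\<close> cancels against the cross
      term of \<open>u\<close> with its inverse.\<close>
    have "mcoeff i j (u \<otimes>\<^bsub>F\<^esub> w \<otimes>\<^bsub>F\<^esub> inv\<^bsub>F\<^esub> u) = mcoeff i j w" for i j
      using h(1) w(1,2) by (simp add: word_exp_mult word_exp_inv mcoeff_mult mcoeff_inv)
    then have "P t (u \<otimes>\<^bsub>F\<^esub> w \<otimes>\<^bsub>F\<^esub> inv\<^bsub>F\<^esub> u)"
      using w(3) unfolding P_def by metis
    moreover have "u \<otimes>\<^bsub>F\<^esub> w \<otimes>\<^bsub>F\<^esub> inv\<^bsub>F\<^esub> u \<in> carrier F"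
      using h w by simp
    moreover have "\<forall>i. word_exp i (u \<otimes>\<^bsub>F\<^esub> w \<otimes>\<^bsub>F\<^esub> inv\<^bsub>F\<^esub> u) = 0"
      using h w by (simp add: word_exp_mult word_exp_inv)
    ultimately show ?thesis
      unfolding N_def by blast
  qed
  then have "N \<lhd> F"
    using sub F.normal_inv_iff by blast
  moreover have "r k \<in> N" if "k < m" for k
  proof -
    have "(\<Sum>l<m. (if l = k then 1 else 0) * mcoeff i j (r l)) = mcoeff i j (r k)" for i j
      using that by (subst sum.remove[of _ k]) auto
    then have "P (\<lambda>l. if l = k then 1 else 0) (r k)"
      unfolding P_def by metis
    then show ?thesis
      using that relator_closed word_exp_relator unfolding N_def by blast
  qed
  ultimately have "R \<subseteq> N"
    by (intro relation_subgroup_least) blast+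
  then show "word_exp i w = 0" "\<exists>t. \<forall>i j. mcoeff i j w = (\<Sum>k<m. t k * mcoeff i j (r k))"
    using assms unfolding N_def P_def by blast+
qed

section \<open>The presented group, its abelianization and the coordinates there\<close>

sublocale G: group G
  unfolding presented_group_def by (rule R.factorgroup_is_group)

lemma proj_hom: "\<phi> \<in> hom F G"
  using R.r_coset_hom_Mod by (simp add: presented_proj_def[abs_def] presented_group_def)

sublocale \<phi>: group_hom F G \<phi>
  by unfold_locales (rule proj_hom)

lemma carrier_presented_group: "carrier G = \<phi> ` carrier F"
  by (auto simp: presented_group_def FactGroup_def RCOSETS_def presented_proj_def)

lemma proj_eqD:
  assumes "u \<in> carrier F" "v \<in> carrier F" "\<phi> u = \<phi> v"
  obtains \<rho> where "\<rho> \<in> R" "u = \<rho> \<otimes>\<^bsub>F\<^esub> v"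
proof -
  have "u \<in> R #>\<^bsub>F\<^esub> v"
    using F.rcos_self[OF assms(1) R.subgroup_axioms] assms(3) by (simp add: presented_proj_def)
  then show thesis
    using that by (auto simp: r_coset_def)
qed

lemma proj_relation_subgroup: "\<rho> \<in> R \<Longrightarrow> \<phi> \<rho> = \<one>\<^bsub>G\<^esub>"
  by (simp add: presented_proj_def presented_group_def R.rcos_const)

lemma word_exp_proj_eq:
  assumes "u \<in> carrier F" "v \<in> carrier F" "\<phi> u = \<phi> v"
  shows "word_exp i u = word_exp i v"
  using proj_eqD[OF assms] relation_subgroup_coeffs(1) by (metis word_exp_mult add_0)

text \<open>A surjective homomorphism maps the commutator subgroup onto the commutator subgroup, so
  \<open>g\<close> lifts to a product of commutators of words.\<close>

lemma derived_presented_group: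
  assumes "g \<in> derived G (carrier G)"
  obtains u where "u \<in> carrier F" "g = \<phi> u" "\<And>i. word_exp i u = 0"
proof -
  have "derived G (\<phi> ` carrier F) = \<phi> ` derived F (carrier F)"
    by (rule \<phi>.derived_img) simp
  then obtain u where "u \<in> derived F (carrier F)" "g = \<phi> u"
    using assms by (auto simp: carrier_presented_group)
  then show thesis
    using that word_exp_derived F.derived_in_carrier by blast
qed

sublocale Gab: comm_group Gab
  unfolding abelianization_def by (rule G.derived_quot_is_comm_group)

lemma ab_proj_hom: "\<alpha> \<in> hom G Gab"
  using normal.r_coset_hom_Mod[OF G.derived_self_is_normal]
  by (simp add: ab_proj_def[abs_def] abelianization_def)

sublocale \<alpha>: group_hom G Gab \<alpha>
  by unfold_locales (rule ab_proj_hom)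

text \<open>Linear independence of the generator classes in the abelianization: neither the
  relators, which are commutators, nor elements of the commutator subgroup change an exponent sum.
  Spanning is \<open>ab_proj_word\<close>.\<close>

lemma word_exp_ab_proj_eq:
  assumes u: "u \<in> carrier F" and v: "v \<in> carrier F" and eq: "\<alpha> (\<phi> u) = \<alpha> (\<phi> v)"
  shows "word_exp i u = word_exp i v"
proof -
  have "\<phi> u \<in> derived G (carrier G) #>\<^bsub>G\<^esub> \<phi> v"
    using G.rcos_self[of "\<phi> u" "derived G (carrier G)"] u eq
      G.derived_is_subgroup[of "carrier G"] by (simp add: ab_proj_def)
  then obtain d where d: "d \<in> derived G (carrier G)" "\<phi> u = d \<otimes>\<^bsub>G\<^esub> \<phi> v"
    by (auto simp: r_coset_def)
  obtain w where w: "w \<in> carrier F" "d = \<phi> w" "word_exp i w = 0"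
    using d(1) by (rule derived_presented_group) blast
  then have "\<phi> u = \<phi> (w \<otimes>\<^bsub>F\<^esub> v)"
    using d v by simp
  then have "word_exp i u = word_exp i (w \<otimes>\<^bsub>F\<^esub> v)"
    using u v w by (intro word_exp_proj_eq) auto
  then show ?thesis
    using w by (simp add: word_exp_mult)
qed

lemma gen_closed: "i < n \<Longrightarrow> gen i \<in> carrier G"
  by (simp add: presented_gen_def)

lemma proj_letter:
  assumes "i < n"
  shows "\<phi> [(s, i)] = (if s then gen i else inv\<^bsub>G\<^esub> gen i)"
proof -
  have "[(False, i)] \<otimes>\<^bsub>F\<^esub> [(True, i)] = \<one>\<^bsub>F\<^esub>"
    by (simp add: free_group_mult free_group_one letter_inv_def)
  then have "inv\<^bsub>F\<^esub> [(True, i)] = [(False, i)]"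
    using assms by (intro F.inv_equality) auto
  then show ?thesis
    using assms \<phi>.hom_inv[of "[(True, i)]"] by (simp add: presented_gen_def)
qed

lemma ab_proj_word:
  assumes "w \<in> carrier F"
  shows "\<alpha> (\<phi> w) = (\<Otimes>\<^bsub>Gab\<^esub>i\<in>{..<n}. \<alpha> (gen i) [^]\<^bsub>Gab\<^esub> word_exp i w)"
  using assms
proof (induction w)
  case Nil
  have "\<phi> [] = \<one>\<^bsub>G\<^esub>"
    using \<phi>.hom_one by (simp add: free_group_one)
  then show ?case
    by (simp add: Gab.finprod_one_eqI)
next
  case (Cons a w)
  obtain s k where a: "a = (s, k)" by (cases a)
  have k: "k < n" and w: "w \<in> carrier F"
    using Cons.prems a by (auto simp: free_group_carrier dest: reduced_ConsD)
  have "a # w = [a] \<otimes>\<^bsub>F\<^esub> w"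
    using Cons.prems by (simp add: free_group_mult cons_reduce_reduced free_group_carrier)
  then have "\<alpha> (\<phi> (a # w)) = \<alpha> (\<phi> [a]) \<otimes>\<^bsub>Gab\<^esub> \<alpha> (\<phi> w)"
    using k w a by simp
  also have "\<alpha> (\<phi> [a]) = \<alpha> (gen k) [^]\<^bsub>Gab\<^esub> letter_exp k a"
    using k a by (auto simp: proj_letter letter_exp_def gen_closed Gab.int_pow_neg)
  also have "\<dots> = (\<Otimes>\<^bsub>Gab\<^esub>i\<in>{..<n}. if k = i then \<alpha> (gen i) [^]\<^bsub>Gab\<^esub> letter_exp i a else \<one>\<^bsub>Gab\<^esub>)"
    using k by (subst Gab.finprod_singleton) (auto simp: gen_closed)
  also have "\<dots> = (\<Otimes>\<^bsub>Gab\<^esub>i\<in>{..<n}. \<alpha> (gen i) [^]\<^bsub>Gab\<^esub> letter_exp i a)"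
    by (rule Gab.finprod_cong') (auto simp: gen_closed letter_exp_def a)
  also have "\<dots> \<otimes>\<^bsub>Gab\<^esub> \<alpha> (\<phi> w)
      = (\<Otimes>\<^bsub>Gab\<^esub>i\<in>{..<n}. \<alpha> (gen i) [^]\<^bsub>Gab\<^esub> letter_exp i a \<otimes>\<^bsub>Gab\<^esub> \<alpha> (gen i) [^]\<^bsub>Gab\<^esub> word_exp i w)"
    using Cons.IH[OF w] by (simp add: Gab.finprod_multf gen_closed Pi_def)
  also have "\<dots> = (\<Otimes>\<^bsub>Gab\<^esub>i\<in>{..<n}. \<alpha> (gen i) [^]\<^bsub>Gab\<^esub> word_exp i (a # w))"
    by (rule Gab.finprod_cong') (auto simp: gen_closed Gab.int_pow_mult)
  finally show ?case .
qed

lemma word_exp_hom: "word_exp i \<in> hom F integer_group"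
  by (rule homI) (auto simp: word_exp_mult)

text \<open>Serves the uniqueness half of \<open>ab_coord_word\<close>: competing coordinates are
  realized by a word, to which \<open>word_exp_ab_proj_eq\<close> applies.\<close>

lemma exists_word_with_exponents:
  "\<exists>w\<in>carrier F. (\<forall>i<n. word_exp i w = a i)"
proof -
  have "\<exists>w\<in>carrier F. (\<forall>i. word_exp i w = (if i < k then a i else 0))" if "k \<le> n" for k
    using that
  proof (induction k)
    case 0
    have "[] \<in> carrier F" using F.one_closed by (simp add: free_group_one)
    then show ?case by (intro bexI[of _ "[]"]) auto
  next
    case (Suc k)
    then obtain w where w: "w \<in> carrier F" "\<forall>i. word_exp i w = (if i < k then a i else 0)"
      by auto
    interpret e: group_hom F integer_group "word_exp i" for i
      by (intro group_hom.intro group_hom_axioms.intro word_exp_hom group_free_group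
          group_integer_group)
    let ?v = "[(True, k)] [^]\<^bsub>F\<^esub> a k"
    have v: "?v \<in> carrier F" using Suc.prems by (intro F.int_pow_closed) simp
    have "word_exp i ?v = a k * letter_exp i (True, k)" for i
      using Suc.prems e.hom_int_pow[of "[(True, k)]" i "a k"] by simp
    then have "\<forall>i. word_exp i (w \<otimes>\<^bsub>F\<^esub> ?v) = (if i < Suc k then a i else 0)"
      using w by (auto simp: word_exp_mult letter_exp_def less_Suc_eq)
    then show ?case using w v by blast
  qed
  from this[of n] obtain w where "w \<in> carrier F" "\<forall>i. word_exp i w = (if i < n then a i else 0)"
    by blast
  then show ?thesis by (intro bexI[of _ w]) simp_all
qed

lemma ab_coord_word:
  assumes w: "w \<in> carrier F"
  shows "ab_coord G n gen (\<alpha> (\<phi> w)) = (\<lambda>i. if i < n then word_exp i w else 0)"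
  unfolding ab_coord_def
proof (rule the_equality)
  show "(\<forall>i\<ge>n. (if i < n then word_exp i w else 0) = 0) \<and>
    \<alpha> (\<phi> w) = (\<Otimes>\<^bsub>Gab\<^esub>i\<in>{..<n}. \<alpha> (gen i) [^]\<^bsub>Gab\<^esub> (if i < n then word_exp i w else 0))"
  proof (intro conjI)
    show "\<alpha> (\<phi> w) = (\<Otimes>\<^bsub>Gab\<^esub>i\<in>{..<n}. \<alpha> (gen i) [^]\<^bsub>Gab\<^esub> (if i < n then word_exp i w else 0))"
      unfolding ab_proj_word[OF w] by (rule Gab.finprod_cong') (auto simp: gen_closed)
  qed auto
next
  fix a :: "nat \<Rightarrow> int"
  assume a: "(\<forall>i\<ge>n. a i = 0) \<and> \<alpha> (\<phi> w) = (\<Otimes>\<^bsub>Gab\<^esub>i\<in>{..<n}. \<alpha> (gen i) [^]\<^bsub>Gab\<^esub> a i)"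
  obtain v where v: "v \<in> carrier F" "\<forall>i<n. word_exp i v = a i"
    using exists_word_with_exponents by blast
  have "\<alpha> (\<phi> v) = (\<Otimes>\<^bsub>Gab\<^esub>i\<in>{..<n}. \<alpha> (gen i) [^]\<^bsub>Gab\<^esub> a i)"
    unfolding ab_proj_word[OF v(1)] using v(2) by (intro Gab.finprod_cong') (auto simp: gen_closed)
  then have "word_exp i v = word_exp i w" for i
    using a v(1) w by (intro word_exp_ab_proj_eq) auto
  then show "a = (\<lambda>i. if i < n then word_exp i w else 0)"
    using a v(2) by (auto simp: fun_eq_iff)
qed

lemma dual_class_word:
  assumes "w \<in> carrier F" "i < n"
  shows "dual_class G n gen i (\<phi> w) = word_exp i w"
  using assms by (simp add: dual_class_def ab_coord_word)

end

section \<open>Linear functionals on free abelian groups\<close>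

text \<open>Evaluation of a functional on a free abelian group. Augmentations, coefficients of the
  Magnus embedding and values of cochains on chains all take this form.\<close>

definition frag_pair :: "('a \<Rightarrow> int) \<Rightarrow> ('a \<Rightarrow>\<^sub>0 int) \<Rightarrow> int" where
  "frag_pair f p = (\<Sum>x\<in>keys p. lookup p x * f x)"

lemma frag_pair_superset:
  assumes "finite U" "keys p \<subseteq> U"
  shows "frag_pair f p = (\<Sum>x\<in>U. lookup p x * f x)"
  unfolding frag_pair_def using assms
  by (intro sum.mono_neutral_left) (auto simp: in_keys_iff)

lemma frag_pair_zero [simp]: "frag_pair f 0 = 0"
  by (simp add: frag_pair_def)

lemma frag_pair_frag_of [simp]: "frag_pair f (frag_of a) = f a"
  by (simp add: frag_pair_def)

lemma frag_pair_add: "frag_pair f (p + q) = frag_pair f p + frag_pair f q"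
proof -
  let ?U = "keys p \<union> keys q"
  have "frag_pair f (p + q) = (\<Sum>x\<in>?U. lookup (p + q) x * f x)"
    by (rule frag_pair_superset) (auto dest: Poly_Mapping.keys_add[THEN subsetD])
  also have "\<dots> = (\<Sum>x\<in>?U. lookup p x * f x) + (\<Sum>x\<in>?U. lookup q x * f x)"
    by (simp add: lookup_add distrib_right sum.distrib)
  also have "\<dots> = frag_pair f p + frag_pair f q"
    by (simp add: frag_pair_superset[symmetric])
  finally show ?thesis .
qed

lemma frag_pair_minus: "frag_pair f (- p) = - frag_pair f p"
  using frag_pair_add[of f p "- p"] by simp

lemma frag_pair_diff: "frag_pair f (p - q) = frag_pair f p - frag_pair f q"
  using frag_pair_add[of f p "- q"] by (simp add: frag_pair_minus)

lemma frag_pair_frag_extend: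
  "frag_pair f (frag_extend b p) = frag_pair (\<lambda>x. frag_pair f (b x)) p"
  by (induction p rule: frag_induction[OF subset_UNIV]) (simp_all add: frag_pair_diff frag_extend_diff)

lemma frag_pair_cong:
  "(\<And>x. x \<in> keys p \<Longrightarrow> f x = g x) \<Longrightarrow> frag_pair f p = frag_pair g p"
  by (simp add: frag_pair_def)

lemma frag_pair_fun_add: "frag_pair (\<lambda>x. f x + g x) p = frag_pair f p + frag_pair g p"
  by (simp add: frag_pair_def distrib_left sum.distrib)

lemma frag_pair_fun_diff: "frag_pair (\<lambda>x. f x - g x) p = frag_pair f p - frag_pair g p"
  by (simp add: frag_pair_def right_diff_distrib sum_subtractf)

section \<open>Power series modulo the square of the maximal ideal\<close>

definition mvar :: "nat \<Rightarrow> monom" where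
  "mvar i = Poly_Mapping.single i 1"

lemma lookup_mvar: "lookup (mvar i) k = (if i = k then 1 else 0)"
  by (simp add: mvar_def lookup_single when_def)

lemma mvar_neq_0 [simp]: "mvar i \<noteq> 0" "0 \<noteq> mvar i"
  by (metis lookup_mvar lookup_zero zero_neq_one)+

lemma mvar_inject [simp]: "mvar i = mvar j \<longleftrightarrow> i = j"
  by (metis lookup_mvar zero_neq_one)

lemma keys_mvar [simp]: "keys (mvar i) = {i}"
  by (simp add: mvar_def)

lemma var_eq: "var i = frag_of (mvar i)"
  by (simp add: var_def mvar_def)

lemma monom_eqI:
  "(\<And>k. lookup a k = lookup b k) \<Longrightarrow> a = (b :: monom)"
  by (rule poly_mapping_eqI)

abbreviation msplits :: "monom \<Rightarrow> (monom \<times> monom) set" where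
  "msplits e \<equiv> {(a, b). a + b = e}"

text \<open>Series have unrestricted support, so the coefficients of a product are finite sums only
  because a monomial has finitely many factorizations.\<close>

lemma finite_msplits: "finite (msplits (e :: monom))"
proof -
  let ?D = "{a. \<forall>i. lookup a i \<le> lookup e i}"
  let ?K = "keys e"
  \<comment> \<open>The inserted 0 keeps \<open>Max\<close> meaningful for the trivial monomial,
    whose set of exponents is empty.\<close>
  let ?B = "{..Max (insert 0 (lookup e ` ?K))}"
  have "(i \<in> ?K \<longrightarrow> lookup a i \<in> ?B) \<and> (i \<notin> ?K \<longrightarrow> lookup a i = 0)"
    if "a \<in> ?D" for a i
  proof -
    have a: "lookup a i \<le> lookup e i"
      using that by simp
    have "lookup e i \<in> insert 0 (lookup e ` ?K)"
      by (cases "i \<in> ?K") (auto simp: in_keys_iff)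
    then have "lookup e i \<le> Max (insert 0 (lookup e ` ?K))"
      by (intro Max_ge) simp_all
    then show ?thesis
      using a by (auto simp only: atMost_iff in_keys_iff)
  qed
  then have "lookup ` ?D \<subseteq>
      {f. \<forall>i. (i \<in> ?K \<longrightarrow> f i \<in> ?B) \<and> (i \<notin> ?K \<longrightarrow> f i = 0)}"
    by (intro image_subsetI CollectI allI)
  then have "finite (lookup ` ?D)"
    by (rule finite_subset) (intro finite_set_of_finite_funs; simp)
  then have "finite ?D"
    by (rule finite_imageD) (simp add: inj_on_def lookup_inject)
  moreover have "msplits e \<subseteq> ?D \<times> ?D"
    by (auto simp: lookup_add)
  ultimately show ?thesis
    by (meson finite_SigmaI finite_subset)
qed

lemma carrier_power_series:
  "f \<in> carrier (power_series_ring n) \<longleftrightarrow> (\<forall>e. f e \<noteq> 0 \<longrightarrow> keys e \<subseteq> {..<n})"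
  by (simp add: power_series_ring_def)

lemma mult_power_series:
  "(f \<otimes>\<^bsub>power_series_ring n\<^esub> g) e = (\<Sum>(a, b)\<in>msplits e. f a * g b)"
  by (simp add: power_series_ring_def)

lemma keys_add_monom:
  "keys (a + b :: monom) = keys a \<union> keys b"
  by (auto simp: in_keys_iff lookup_add)

lemma add_eq_zero_monom: "a + b = (0 :: monom) \<longleftrightarrow> a = 0 \<and> b = 0"
  by (auto simp: poly_mapping_eq_iff fun_eq_iff lookup_add)

lemma one_power_series: "\<one>\<^bsub>power_series_ring n\<^esub> e = (if e = 0 then 1 else 0)"
  by (simp add: power_series_ring_def lookup_one)

lemma one_closed_power_series: "\<one>\<^bsub>power_series_ring n\<^esub> \<in> carrier (power_series_ring n)"
  by (simp add: carrier_power_series one_power_series)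

lemma mult_closed_power_series:
  assumes "f \<in> carrier (power_series_ring n)" "g \<in> carrier (power_series_ring n)"
  shows "f \<otimes>\<^bsub>power_series_ring n\<^esub> g \<in> carrier (power_series_ring n)"
  unfolding carrier_power_series
proof (intro allI impI)
  fix e assume "(f \<otimes>\<^bsub>power_series_ring n\<^esub> g) e \<noteq> 0"
  then obtain a b where "a + b = e" "f a * g b \<noteq> 0"
    unfolding mult_power_series by (auto elim!: sum.not_neutral_contains_not_neutral)
  moreover from this have "f a \<noteq> 0" "g b \<noteq> 0"
    by auto
  ultimately show "keys e \<subseteq> {..<n}"
    using assms unfolding carrier_power_series by (metis keys_add_monom Un_least)
qed

lemma comm_monoid_power_series: "comm_monoid (power_series_ring n)"
proof (rule comm_monoidI)
  fix f g h
  let ?P = "power_series_ring n"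
  show "f \<otimes>\<^bsub>?P\<^esub> g \<otimes>\<^bsub>?P\<^esub> h = f \<otimes>\<^bsub>?P\<^esub> (g \<otimes>\<^bsub>?P\<^esub> h)"
  proof (rule ext)
    fix e
    have "(f \<otimes>\<^bsub>?P\<^esub> g \<otimes>\<^bsub>?P\<^esub> h) e =
        (\<Sum>x\<in>msplits e. \<Sum>y\<in>msplits (fst x). f (fst y) * g (snd y) * h (snd x))"
      by (simp add: mult_power_series case_prod_unfold sum_distrib_right)
    also have "\<dots> = (\<Sum>(x, y)\<in>Sigma (msplits e) (\<lambda>x. msplits (fst x)).
        f (fst y) * g (snd y) * h (snd x))"
      by (rule sum.Sigma) (auto simp: finite_msplits)
    also have "\<dots> = (\<Sum>(x, y)\<in>Sigma (msplits e) (\<lambda>x. msplits (snd x)).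
        f (fst x) * (g (fst y) * h (snd y)))"
      by (rule sum.reindex_bij_witness[
            where i = "\<lambda>(x, y). ((fst x + fst y, snd y), (fst x, fst y))"
              and j = "\<lambda>(x, y). ((fst y, snd y + snd x), (snd y, snd x))"])
        (auto simp: add.assoc mult.assoc)
    also have "\<dots> = (\<Sum>x\<in>msplits e. \<Sum>y\<in>msplits (snd x). f (fst x) * (g (fst y) * h (snd y)))"
      by (rule sum.Sigma[symmetric]) (auto simp: finite_msplits)
    also have "\<dots> = (f \<otimes>\<^bsub>?P\<^esub> (g \<otimes>\<^bsub>?P\<^esub> h)) e"
      by (simp add: mult_power_series case_prod_unfold sum_distrib_left)
    finally show "(f \<otimes>\<^bsub>?P\<^esub> g \<otimes>\<^bsub>?P\<^esub> h) e = (f \<otimes>\<^bsub>?P\<^esub> (g \<otimes>\<^bsub>?P\<^esub> h)) e" .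
  qed
  show "f \<otimes>\<^bsub>?P\<^esub> g = g \<otimes>\<^bsub>?P\<^esub> f"
  proof (rule ext)
    fix e
    show "(f \<otimes>\<^bsub>?P\<^esub> g) e = (g \<otimes>\<^bsub>?P\<^esub> f) e"
      unfolding mult_power_series
      by (rule sum.reindex_bij_witness[where i = prod.swap and j = prod.swap])
        (auto simp: add.commute mult.commute)
  qed
  show "\<one>\<^bsub>?P\<^esub> \<otimes>\<^bsub>?P\<^esub> f = f"
  proof (rule ext)
    fix e
    have "(\<one>\<^bsub>?P\<^esub> \<otimes>\<^bsub>?P\<^esub> f) e = (\<Sum>x\<in>{(0, e)}. \<one>\<^bsub>?P\<^esub> (fst x) * f (snd x))"
      unfolding mult_power_series case_prod_unfold
      using finite_msplits[of e]
      by (intro sum.mono_neutral_right) (auto simp: one_power_series case_prod_unfold)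
    then show "(\<one>\<^bsub>?P\<^esub> \<otimes>\<^bsub>?P\<^esub> f) e = f e"
      by (simp add: one_power_series)
  qed
qed (auto intro: one_closed_power_series mult_closed_power_series)

lemma mult_power_series_coeff0: "(f \<otimes>\<^bsub>power_series_ring n\<^esub> g) 0 = f 0 * g 0"
proof -
  have "msplits 0 = {(0, 0)}"
    by (auto simp: add_eq_zero_monom)
  then show ?thesis
    by (simp add: mult_power_series)
qed

lemma add_eq_single_monom:
  "a + b = mvar i \<longleftrightarrow>
    a = 0 \<and> b = mvar i \<or> a = mvar i \<and> b = 0"
proof
  assume eq: "a + b = mvar i"
  have *: "lookup a k + lookup b k = (if i = k then 1 else 0)" for k
    using arg_cong[OF eq, of "\<lambda>p. lookup p k"] by (simp add: lookup_add lookup_mvar)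
  have "lookup a i = 0 \<and> lookup b i = 1 \<or>
      lookup a i = 1 \<and> lookup b i = 0"
    using *[of i] by auto
  then consider "lookup a i = 0" "lookup b i = 1"
    | "lookup a i = 1" "lookup b i = 0"
    by metis
  then show "a = 0 \<and> b = mvar i \<or> a = mvar i \<and> b = 0"
  proof cases
    case 1
    have "lookup a k = 0 \<and> lookup b k = (if i = k then 1 else 0)" for k
      using *[of k] 1 by (cases "k = i") auto
    then show ?thesis
      by (simp add: poly_mapping_eq_iff fun_eq_iff lookup_mvar)
  next
    case 2
    have "lookup b k = 0 \<and> lookup a k = (if i = k then 1 else 0)" for k
      using *[of k] 2 by (cases "k = i") auto
    then show ?thesis
      by (auto simp: poly_mapping_eq_iff fun_eq_iff lookup_mvar)
  qed
qed auto

lemma mult_power_series_coeff1: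
  "(f \<otimes>\<^bsub>power_series_ring n\<^esub> g) (mvar i) =
    f 0 * g (mvar i) + f (mvar i) * g 0"
proof -
  have "msplits (mvar i) =
    {(0, mvar i), (mvar i, 0)}"
    using add_eq_single_monom by auto
  then show ?thesis
    by (simp add: mult_power_series)
qed

lemma one_plus_var_closed:
  "i < n \<Longrightarrow> lookup (1 + var i) \<in> carrier (power_series_ring n)"
  by (auto simp: carrier_power_series var_eq lookup_add lookup_one lookup_mvar
      split: if_splits)

lemma one_plus_var_Unit:
  assumes "i < n"
  shows "lookup (1 + var i) \<in> Units (power_series_ring n)"
proof -
  let ?P = "power_series_ring n" and ?s = "mvar i"
  interpret P: comm_monoid ?P by (rule comm_monoid_power_series)
  \<comment> \<open>The geometric series with terms (-s_i)^k, the inverse of 1 + s_i.\<close>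
  define g :: "monom \<Rightarrow> int" where
    "g e = (if keys e \<subseteq> {i} then (- 1) ^ lookup e i else 0)" for e
  have g: "g \<in> carrier ?P"
    using assms by (auto simp: carrier_power_series g_def)
  have coeff: "lookup (1 + var i) e = (if e = 0 then 1 else 0) + (if e = ?s then 1 else 0)"
    for e
    by (simp add: var_eq lookup_add lookup_one)
  have "(lookup (1 + var i) \<otimes>\<^bsub>?P\<^esub> g) e = \<one>\<^bsub>?P\<^esub> e" for e
  proof -
    have "(lookup (1 + var i) \<otimes>\<^bsub>?P\<^esub> g) e =
      (\<Sum>x\<in>msplits e. if fst x = 0 then g (snd x) else 0) +
      (\<Sum>x\<in>msplits e. if fst x = ?s then g (snd x) else 0)"
      unfolding mult_power_series case_prod_unfold coeff sum.distrib[symmetric]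
      by (rule sum.cong) (auto simp: distrib_right)
    also have "(\<Sum>x\<in>msplits e. if fst x = 0 then g (snd x) else 0) = (\<Sum>x\<in>{(0 :: monom, e)}. g (snd x))"
      by (rule sum.mono_neutral_cong_right) (use finite_msplits in auto)
    also have "(\<Sum>x\<in>msplits e. if fst x = ?s then g (snd x) else 0) =
      (\<Sum>x\<in>{x \<in> msplits e. fst x = ?s}. g (snd x))"
      by (rule sum.inter_filter[symmetric]) (rule finite_msplits)
    also have "(\<Sum>x\<in>{(0 :: monom, e)}. g (snd x)) + \<dots> = \<one>\<^bsub>?P\<^esub> e"
    proof (cases "lookup e i = 0")
      case True
      have "x \<notin> msplits e" if "fst x = ?s" for x
      proof
        assume "x \<in> msplits e"
        then have "?s + snd x = e"
          using that by auto
        then show False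
          using True using lookup_add[of ?s "snd x" i] by (simp add: lookup_mvar)
      qed
      then have none: "{x \<in> msplits e. fst x = ?s} = {}"
        by blast
      have "e = 0" if "keys e \<subseteq> {i}"
        using True that by (metis (no_types, lifting) in_keys_iff keys_eq_empty singletonD subset_eq ex_in_conv)
      then show ?thesis
        using True unfolding none by (auto simp: g_def one_power_series)
    next
      case False
      define b where "b = e - ?s"
      have b: "?s + b = e"
        using False by (auto simp: b_def poly_mapping_eq_iff fun_eq_iff lookup_add lookup_minus lookup_mvar)
      then have "{x \<in> msplits e. fst x = ?s} = {(?s, b)}"
        by auto
      moreover have "keys e = insert i (keys b)"
        "lookup e i = Suc (lookup b i)"
        using b by (auto simp: keys_add_monom lookup_add lookup_mvar)
      ultimately show ?thesis
        using False by (auto simp: g_def one_power_series)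
    qed
    finally show ?thesis .
  qed
  then have "lookup (1 + var i) \<otimes>\<^bsub>?P\<^esub> g = \<one>\<^bsub>?P\<^esub>" by blast
  then show ?thesis
    unfolding Units_def using g one_plus_var_closed[OF assms] P.m_comm by auto
qed

lemma nat_pow_power_series:
  assumes "f 0 = 1"
  shows "(f [^]\<^bsub>power_series_ring n\<^esub> (k::nat)) 0 = 1"
    and "(f [^]\<^bsub>power_series_ring n\<^esub> k) (mvar i) = int k * f (mvar i)"
proof -
  have *: "(f [^]\<^bsub>power_series_ring n\<^esub> k) 0 = 1 \<and>
    (f [^]\<^bsub>power_series_ring n\<^esub> k) (mvar i) = int k * f (mvar i)"
  proof (induction k)
    case (Suc k)
    then show ?case
      using assms by (simp add: nat_pow_def mult_power_series_coeff0 mult_power_series_coeff1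
          mult_power_series_coeff1[simplified] algebra_simps)
  qed (simp add: one_power_series nat_pow_def)
  show "(f [^]\<^bsub>power_series_ring n\<^esub> k) 0 = 1"
    "(f [^]\<^bsub>power_series_ring n\<^esub> k) (mvar i) = int k * f (mvar i)"
    using * by auto
qed

text \<open>Modulo the square of the maximal ideal (1 + x)^k = 1 + k x for negative k too: the low
  coefficients of an inverse are forced by comparing its product with \<open>h\<close> to 1 in
  degrees 0 and 1.\<close>

lemma int_pow_power_series:
  assumes f: "f \<in> Units (power_series_ring n)" and f0: "f 0 = 1"
  shows "f [^]\<^bsub>power_series_ring n\<^esub> (k::int) \<in> carrier (power_series_ring n)"
    and "(f [^]\<^bsub>power_series_ring n\<^esub> k) 0 = 1"
    and "(f [^]\<^bsub>power_series_ring n\<^esub> k) (mvar j) = k * f (mvar j)"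
proof -
  let ?P = "power_series_ring n"
  interpret P: comm_monoid ?P by (rule comm_monoid_power_series)
  have "f [^]\<^bsub>?P\<^esub> k \<in> carrier ?P \<and> (f [^]\<^bsub>?P\<^esub> k) 0 = 1 \<and>
    (f [^]\<^bsub>?P\<^esub> k) (mvar j) = k * f (mvar j)"
  proof (cases "k < 0")
    case False
    then have "f [^]\<^bsub>?P\<^esub> k = f [^]\<^bsub>?P\<^esub> nat k"
      by (simp add: int_pow_def nat_pow_def)
    then show ?thesis
      using False f f0 nat_pow_power_series[of f n "nat k"] P.nat_pow_closed[of f "nat k"] by auto
  next
    case True
    define h where "h = f [^]\<^bsub>?P\<^esub> nat (- k)"
    have h: "h \<in> Units ?P" "h 0 = 1" "h (mvar j) = - k * f (mvar j)"
      using f f0 True nat_pow_power_series[of f n "nat (- k)"] P.Units_pow_closed[of f "nat (- k)"]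
      unfolding h_def by simp_all
    have k: "f [^]\<^bsub>?P\<^esub> k = inv\<^bsub>?P\<^esub> h"
      using True by (simp add: int_pow_def nat_pow_def h_def)
    have hh: "h \<otimes>\<^bsub>?P\<^esub> inv\<^bsub>?P\<^esub> h = \<one>\<^bsub>?P\<^esub>"
      using h by simp
    have "(inv\<^bsub>?P\<^esub> h) 0 = 1"
      using mult_power_series_coeff0[of n h "inv\<^bsub>?P\<^esub> h"] h(2) unfolding hh one_power_series by simp
    moreover from this have "(inv\<^bsub>?P\<^esub> h) (mvar j) = k * f (mvar j)"
      using mult_power_series_coeff1[of n h "inv\<^bsub>?P\<^esub> h" j] h(2,3)
      unfolding hh one_power_series by simp
    ultimately show ?thesis
      using h(1) unfolding k by simp
  qed
  then show "f [^]\<^bsub>?P\<^esub> k \<in> carrier ?P" "(f [^]\<^bsub>?P\<^esub> k) 0 = 1"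
    "(f [^]\<^bsub>?P\<^esub> k) (mvar j) = k * f (mvar j)"
    by blast+
qed

lemma int_pow_one_plus_var:
  assumes "i < n"
  shows "lookup (1 + var i) [^]\<^bsub>power_series_ring n\<^esub> (k::int) \<in> carrier (power_series_ring n)"
    and "(lookup (1 + var i) [^]\<^bsub>power_series_ring n\<^esub> k) 0 = 1"
    and "(lookup (1 + var i) [^]\<^bsub>power_series_ring n\<^esub> k) (mvar j) =
      (if i = j then k else 0)"
proof -
  let ?f = "lookup (1 + var i)"
  have "?f 0 = 1" and "?f (mvar j) = (if i = j then 1 else 0)"
    by (auto simp: var_eq lookup_add lookup_one)
  then show "?f [^]\<^bsub>power_series_ring n\<^esub> k \<in> carrier (power_series_ring n)"
    "(?f [^]\<^bsub>power_series_ring n\<^esub> k) 0 = 1"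
    "(?f [^]\<^bsub>power_series_ring n\<^esub> k) (mvar j) = (if i = j then k else 0)"
    using int_pow_power_series[OF one_plus_var_Unit[OF assms], of k]
    by (auto split: if_splits)
qed

lemma magnus_group_coeffs:
  shows "magnus_group G n x h 0 = 1"
    and "i < n \<Longrightarrow> magnus_group G n x h (mvar i) = ab_coord G n x h i"
proof -
  let ?P = "power_series_ring n"
  interpret P: comm_monoid ?P by (rule comm_monoid_power_series)
  let ?c = "ab_coord G n x h"
  let ?f = "\<lambda>i. lookup (1 + var i) [^]\<^bsub>?P\<^esub> ?c i"
  \<comment> \<open>The factors are multiplied one at a time; all have constant term 1, so their
    linear coefficients add up.\<close>
  have *: "(\<Otimes>\<^bsub>?P\<^esub>i\<in>{..<k}. ?f i) \<in> carrier ?P \<and> (\<Otimes>\<^bsub>?P\<^esub>i\<in>{..<k}. ?f i) 0 = 1 \<and>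
    (\<Otimes>\<^bsub>?P\<^esub>i\<in>{..<k}. ?f i) (mvar j) = (if j < k then ?c j else 0)"
    if "k \<le> n" for j k
    using that
  proof (induction k)
    case 0
    show ?case by (simp add: one_closed_power_series) (simp add: one_power_series)
  next
    case (Suc k)
    have "(\<Otimes>\<^bsub>?P\<^esub>i\<in>{..<Suc k}. ?f i) = ?f k \<otimes>\<^bsub>?P\<^esub> (\<Otimes>\<^bsub>?P\<^esub>i\<in>{..<k}. ?f i)"
      unfolding lessThan_Suc using Suc.prems
      by (intro P.finprod_insert) (auto intro!: int_pow_one_plus_var(1))
    then show ?case
      using Suc int_pow_one_plus_var[of k n "?c k"]
      by (auto simp only: mult_power_series_coeff0 mult_power_series_coeff1 mult_closed_power_series
          less_Suc_eq split: if_splits)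
  qed
  show "magnus_group G n x h 0 = 1"
    using *[of n] by (simp add: magnus_group_def)
  show "i < n \<Longrightarrow> magnus_group G n x h (mvar i) = ab_coord G n x h i"
    using *[of n i] by (simp add: magnus_group_def)
qed

lemma monom_deg_le_1:
  "{e. keys e \<subseteq> {..<n} \<and> monom_deg e \<le> 1} =
    insert 0 (mvar ` {..<n})"
proof (intro subset_antisym subsetI)
  fix e assume "e \<in> {e. keys e \<subseteq> {..<n} \<and> monom_deg e \<le> 1}"
  then have e: "keys e \<subseteq> {..<n}" "monom_deg e \<le> 1" by auto
  show "e \<in> insert 0 (mvar ` {..<n})"
  proof (cases "e = 0")
    case False
    then obtain i where i: "i \<in> keys e"
      by (metis all_not_in_conv keys_eq_empty)
    have deg: "lookup e i + (\<Sum>k\<in>keys e - {i}. lookup e k) \<le> 1"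
      using e(2) i by (simp add: monom_deg_def sum.remove[of _ i])
    moreover have "lookup e i \<noteq> 0"
      using i by (simp add: in_keys_iff)
    ultimately have "lookup e i = 1"
      "(\<Sum>k\<in>keys e - {i}. lookup e k) = 0"
      by linarith+
    then have "\<forall>k. lookup e k = (if k = i then 1 else 0)"
      by (auto simp: in_keys_iff)
    then have "e = mvar i"
      by (auto simp: poly_mapping_eq_iff fun_eq_iff lookup_mvar)
    then show ?thesis using e i by blast
  qed simp
qed (auto simp: monom_deg_def lookup_mvar split: if_splits)

section \<open>Fox derivatives and the linearized Alexander matrix\<close>

context commutator_presentation
begin

lemma fox_closed:
  "w \<in> carrier F \<Longrightarrow> keys (fox n j w) \<subseteq> carrier F"
proof (induction w)
  case (Cons a w)
  then have a: "[a] \<in> carrier F" and w: "w \<in> carrier F"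
    by (auto simp: free_group_carrier dest: reduced_ConsD)
  have "keys (fox_letter j a) \<subseteq> carrier F"
    using a F.one_closed by (cases a; cases "fst a") (auto simp: free_group_one)
  moreover have "keys (frag_extend (\<lambda>v. frag_of ([a] \<otimes>\<^bsub>F\<^esub> v)) (fox n j w)) \<subseteq> carrier F"
    using Cons.IH[OF w] a by (auto dest!: keys_frag_extend[THEN subsetD])
  ultimately show ?case
    using Poly_Mapping.keys_add[of "fox_letter j a"] by auto
qed simp

text \<open>Translation by a letter shifts \<open>word_exp i\<close> by a constant and so adds that
  constant times the augmentation. The recursion for the second equation therefore needs the first,
  and it becomes the one that defines \<open>mcoeff\<close>.\<close>

lemma frag_pair_fox:
  shows "frag_pair (\<lambda>_. 1) (fox n j w) = word_exp j w"
    and "frag_pair (word_exp i) (fox n j w) = mcoeff i j w"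
proof -
  show 1: "frag_pair (\<lambda>_. 1) (fox n j w) = word_exp j w" for w
  proof (induction w)
    case (Cons a w)
    have "frag_pair (\<lambda>_. 1) (fox_letter j a) = letter_exp j a"
      by (cases a; cases "fst a") (auto simp: letter_exp_def frag_pair_minus)
    then show ?case
      using Cons by (simp add: frag_pair_add frag_pair_frag_extend)
  qed simp
  show "frag_pair (word_exp i) (fox n j w) = mcoeff i j w"
  proof (induction w)
    case (Cons a w)
    have "frag_pair (word_exp i) (fox_letter j a) = (if i = j \<and> a = (False, i) then 1 else 0)"
      by (cases a; cases "fst a") (auto simp: letter_exp_def frag_pair_minus)
    moreover have "frag_pair (\<lambda>v. word_exp i ([a] \<otimes>\<^bsub>F\<^esub> v)) (fox n j w) =
      letter_exp i a * word_exp j w + mcoeff i j w"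
    proof -
      have "frag_pair (\<lambda>v. letter_exp i a) p = letter_exp i a * frag_pair (\<lambda>v. 1) p" for p :: "word \<Rightarrow>\<^sub>0 int"
        by (simp add: frag_pair_def sum_distrib_left mult.commute)
      then show ?thesis
        using Cons 1 by (simp add: word_exp_mult frag_pair_fun_add)
    qed
    ultimately show ?case
      by (simp add: frag_pair_add frag_pair_frag_extend)
  qed simp
qed

text \<open>The constant term of the Magnus image is the augmentation, an exponent sum of the
  relator and hence 0. The coefficient of s_i pairs the Fox derivative with exponent sums, which
  gives \<open>mcoeff i j\<close>.\<close>

lemma linearized_matrix_eq:
  assumes k: "k < m"
  shows "linearized_matrix n m r k j = (\<Sum>i<n. frag_cmul (mcoeff i j (r k)) (var i))"
proof -
  let ?M = "magnus G n gen (alexander_matrix n m r k j)"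
  have M: "?M e = frag_pair (\<lambda>w. magnus_group G n gen (\<alpha> (\<phi> w)) e) (fox n j (r k))" for e
  proof -
    have "?M e = frag_pair (\<lambda>h. magnus_group G n gen h e) (alexander_matrix n m r k j)"
      by (simp add: magnus_def frag_pair_def)
    then show ?thesis
      by (simp add: alexander_matrix_def frag_pair_frag_extend)
  qed
  have M0: "?M 0 = 0"
    using word_exp_relator[OF k] by (simp add: M magnus_group_coeffs(1) frag_pair_fox)
  have M1: "?M (mvar i) = mcoeff i j (r k)" if "i < n" for i
  proof -
    have "?M (mvar i) = frag_pair (word_exp i) (fox n j (r k))"
      unfolding M
    proof (rule frag_pair_cong)
      fix w assume "w \<in> keys (fox n j (r k))"
      then have "w \<in> carrier F" using fox_closed[OF relator_closed[OF k]] by blast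
      then show "magnus_group G n gen (\<alpha> (\<phi> w)) (mvar i) = word_exp i w"
        using that magnus_group_coeffs(2)[OF that, of G gen] by (simp add: ab_coord_word)
    qed
    then show ?thesis by (simp add: frag_pair_fox)
  qed
  have inj: "inj_on mvar {..<n}"
    by (simp add: inj_on_def)
  have "linearized_matrix n m r k j =
    (\<Sum>e\<in>insert 0 (mvar ` {..<n}). Poly_Mapping.single e (?M e))"
    unfolding linearized_matrix_def trunc1_def monom_deg_le_1 ..
  also have "\<dots> = Poly_Mapping.single 0 (?M 0) +
    (\<Sum>e\<in>mvar ` {..<n}. Poly_Mapping.single e (?M e))"
    by (rule sum.insert) (auto dest!: arg_cong[of _ _ "keys"])
  also have "\<dots> = (\<Sum>i<n. Poly_Mapping.single (mvar i) (?M (mvar i)))"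
    using inj by (simp add: M0 sum.reindex)
  also have "\<dots> = (\<Sum>i<n. frag_cmul (mcoeff i j (r k)) (var i))"
  proof (rule sum.cong)
    fix i assume "i \<in> {..<n}"
    then show "Poly_Mapping.single (mvar i) (?M (mvar i)) =
      frag_cmul (mcoeff i j (r k)) (var i)"
      by (intro poly_mapping_eqI) (simp add: M1 var_eq lookup_single when_def)
  qed simp
  finally show ?thesis .
qed

end

section \<open>Cup products on the second homology\<close>

lemma frag_pair_const_mult: "frag_pair (\<lambda>x. c * f x) p = c * frag_pair f p"
  by (simp add: frag_pair_def sum_distrib_left mult.left_commute)

lemma frag_pair_fun_sum:
  "frag_pair (\<lambda>x. \<Sum>k\<in>K. f k x) p = (\<Sum>k\<in>K. frag_pair (f k) p)"
  unfolding frag_pair_def sum_distrib_left by (rule sum.swap)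

lemma frag_pair_bar_boundary2:
  "frag_pair c (bar_boundary2 G z) = frag_pair (\<lambda>(g, h). c h - c (g \<otimes>\<^bsub>G\<^esub> h) + c g) z"
  unfolding bar_boundary2_def frag_pair_frag_extend
  by (rule frag_pair_cong) (auto simp: frag_pair_add frag_pair_diff)

lemma frag_pair_bar_boundary3:
  "frag_pair f (bar_boundary3 G b) =
    frag_pair (\<lambda>(g, h, k). f (h, k) - f (g \<otimes>\<^bsub>G\<^esub> h, k) + f (g, h \<otimes>\<^bsub>G\<^esub> k) - f (g, h)) b"
  unfolding bar_boundary3_def frag_pair_frag_extend
  by (rule frag_pair_cong) (auto simp: frag_pair_add frag_pair_diff)

text \<open>\<open>kronecker\<close> picks its representatives by choice. The chosen cycle differs
  from \<open>z\<close> by a boundary, which cocycles kill, and the chosen cocycle differs from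
  \<open>f\<close> by a coboundary, which cycles kill.\<close>

lemma kronecker_homology_class2:
  assumes z: "z \<in> cycles2 G" and f: "f \<in> cocycles2 G"
  shows "kronecker (homology_class2 G z) (cohomology_class2 G f) = frag_pair f z"
proof -
  define z' where "z' = (SOME z'. z' \<in> homology_class2 G z)"
  define f' where "f' = (SOME f'. f' \<in> cohomology_class2 G f)"
  have "z + bar_boundary3 G 0 \<in> homology_class2 G z"
    unfolding homology_class2_def by force
  then have "z' \<in> homology_class2 G z"
    unfolding z'_def by (rule someI)
  then obtain b where b: "keys b \<subseteq> carrier G \<times> carrier G \<times> carrier G"
      "z' = z + bar_boundary3 G b"
    unfolding homology_class2_def by blast
  have "f \<in> cohomology_class2 G f"
    unfolding cohomology_class2_def using f by (auto intro: exI[of _ "\<lambda>_. 0"])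
  then have "f' \<in> cohomology_class2 G f"
    unfolding f'_def by (rule someI[of "\<lambda>f'. f' \<in> cohomology_class2 G f"])
  then obtain c where f': "f' \<in> cocycles2 G"
      and c: "\<And>g h. g \<in> carrier G \<Longrightarrow> h \<in> carrier G \<Longrightarrow>
        f' (g, h) = f (g, h) + (c h - c (g \<otimes>\<^bsub>G\<^esub> h) + c g)"
    unfolding cohomology_class2_def by blast
  have "frag_pair f' (bar_boundary3 G b) = frag_pair (\<lambda>_. 0) b"
    unfolding frag_pair_bar_boundary3
    by (rule frag_pair_cong) (use b(1) f' in \<open>auto simp: cocycles2_def\<close>)
  then have "frag_pair f' z' = frag_pair f' z"
    by (simp add: b(2) frag_pair_add) (simp add: frag_pair_def)
  also have "\<dots> = frag_pair (\<lambda>(g, h). f (g, h) + (c h - c (g \<otimes>\<^bsub>G\<^esub> h) + c g)) z"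
    by (rule frag_pair_cong) (use z c in \<open>auto simp: cycles2_def\<close>)
  also have "\<dots> = frag_pair f z + frag_pair c (bar_boundary2 G z)"
    by (simp add: frag_pair_bar_boundary2 frag_pair_fun_add[symmetric] case_prod_unfold)
  also have "\<dots> = frag_pair f z"
    using z by (simp add: cycles2_def)
  finally show ?thesis
    by (simp add: kronecker_def Let_def z'_def f'_def frag_pair_def)
qed

context commutator_presentation
begin

abbreviation ecls :: "nat \<Rightarrow> word set \<Rightarrow> int" where
  "ecls i \<equiv> dual_class G n gen i"

abbreviation cup_pair :: "nat \<Rightarrow> nat \<Rightarrow> (word set \<times> word set \<Rightarrow>\<^sub>0 int) \<Rightarrow> int" where
  "cup_pair i j \<equiv> frag_pair (\<lambda>(g, h). ecls i g * ecls j h)"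

lemma dual_class_mult:
  assumes "i < n" "g \<in> carrier G" "h \<in> carrier G"
  shows "ecls i (g \<otimes>\<^bsub>G\<^esub> h) = ecls i g + ecls i h"
proof -
  obtain u v where "u \<in> carrier F" "g = \<phi> u" "v \<in> carrier F" "h = \<phi> v"
    using assms(2,3) unfolding carrier_presented_group by blast
  moreover from this have "g \<otimes>\<^bsub>G\<^esub> h = \<phi> (u \<otimes>\<^bsub>F\<^esub> v)"
    by simp
  ultimately show ?thesis
    using assms(1) by (simp only: dual_class_word F.m_closed word_exp_mult)
qed

lemma kronecker_cup:
  assumes "z \<in> cycles2 G" "i < n" "j < n"
  shows "kronecker (homology_class2 G z) (cup G (ecls i) (ecls j)) = cup_pair i j z"
  unfolding cup_def using assms
  by (intro kronecker_homology_class2) (auto simp: cocycles2_def dual_class_mult algebra_simps)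

text \<open>The cocycle \<open>x\<^sub>i\<^sup>* \<union> x\<^sub>j\<^sup>*\<close> becomes the coboundary of \<open>- mcoeff i j\<close> on the free group.
  Lifting the entries of a cycle to the free group, its value on the cycle is the value of
  \<open>mcoeff i j\<close> on a product of the relations \<open>\<sigma> g \<sigma> h (\<sigma> (g h))\<^sup>-\<^sup>1\<close>.\<close>

lemma cup_pair_cycle:
  assumes z: "z \<in> cycles2 G"
  shows "\<exists>t. \<forall>i<n. \<forall>j<n. cup_pair i j z = (\<Sum>k<m. t k * mcoeff i j (r k))"
proof -
  have "\<forall>g\<in>carrier G. \<exists>u. u \<in> carrier F \<and> \<phi> u = g"
    unfolding carrier_presented_group by blast
  then obtain \<sigma> where \<sigma>: "\<And>g. g \<in> carrier G \<Longrightarrow> \<sigma> g \<in> carrier F \<and> \<phi> (\<sigma> g) = g"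
    by (auto dest!: bchoice)
  have "\<exists>\<rho>\<in>R. \<sigma> g \<otimes>\<^bsub>F\<^esub> \<sigma> h = \<rho> \<otimes>\<^bsub>F\<^esub> \<sigma> (g \<otimes>\<^bsub>G\<^esub> h)" if "g \<in> carrier G" "h \<in> carrier G" for g h
  proof -
    have "\<sigma> g \<otimes>\<^bsub>F\<^esub> \<sigma> h \<in> carrier F" "\<sigma> (g \<otimes>\<^bsub>G\<^esub> h) \<in> carrier F"
      "\<phi> (\<sigma> g \<otimes>\<^bsub>F\<^esub> \<sigma> h) = \<phi> (\<sigma> (g \<otimes>\<^bsub>G\<^esub> h))"
      using that \<sigma> by simp_all
    then show ?thesis by (metis proj_eqD)
  qed
  then obtain \<rho> where \<rho>: "\<And>g h. g \<in> carrier G \<Longrightarrow> h \<in> carrier G \<Longrightarrow>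
      \<rho> g h \<in> R \<and> \<sigma> g \<otimes>\<^bsub>F\<^esub> \<sigma> h = \<rho> g h \<otimes>\<^bsub>F\<^esub> \<sigma> (g \<otimes>\<^bsub>G\<^esub> h)"
    by metis
  \<comment> \<open>The coefficients depend on \<open>g\<close> and \<open>h\<close> but not on i,
    j. This uniformity makes the whole matrix of cup values one integer combination of the matrices
    of the relators.\<close>
  have "\<exists>t. \<forall>i j. mcoeff i j (\<rho> g h) = (\<Sum>k<m. t k * mcoeff i j (r k))"
    if "g \<in> carrier G" "h \<in> carrier G" for g h
    using \<rho>[OF that] relation_subgroup_coeffs(2) by blast
  then obtain t where t: "\<And>g h i j. g \<in> carrier G \<Longrightarrow> h \<in> carrier G \<Longrightarrow>
      mcoeff i j (\<rho> g h) = (\<Sum>k<m. t g h k * mcoeff i j (r k))"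
    by metis
  have "cup_pair i j z = (\<Sum>k<m. frag_pair (\<lambda>(g, h). t g h k) z * mcoeff i j (r k))"
    if ij: "i < n" "j < n" for i j
  proof -
    let ?c = "\<lambda>g. mcoeff i j (\<sigma> g)"
    \<comment> \<open>Pointwise the cup product is the relation term minus the coboundary of
      \<open>mcoeff i j\<close> along the lift, and a cycle pairs to 0 with a coboundary.\<close>
    have "cup_pair i j z = frag_pair (\<lambda>(g, h). (\<Sum>k<m. t g h k * mcoeff i j (r k))
        - (?c h - ?c (g \<otimes>\<^bsub>G\<^esub> h) + ?c g)) z"
    proof (rule frag_pair_cong, clarify)
      fix g h assume "(g, h) \<in> keys z"
      then have gh: "g \<in> carrier G" "h \<in> carrier G"
        using z by (auto simp: cycles2_def)
      have "ecls i g * ecls j h = word_exp i (\<sigma> g) * word_exp j (\<sigma> h)"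
        using \<sigma> gh ij by (metis dual_class_word)
      also have "\<dots> = mcoeff i j (\<rho> g h \<otimes>\<^bsub>F\<^esub> \<sigma> (g \<otimes>\<^bsub>G\<^esub> h)) - ?c g - ?c h"
        using mcoeff_mult[of i j n "\<sigma> g" "\<sigma> h"] \<rho>[OF gh] by simp
      also have "\<dots> = mcoeff i j (\<rho> g h) + ?c (g \<otimes>\<^bsub>G\<^esub> h) - ?c g - ?c h"
        using \<rho>[OF gh] relation_subgroup_coeffs(1)[of "\<rho> g h"] by (simp add: mcoeff_mult)
      finally show "ecls i g * ecls j h = (\<Sum>k<m. t g h k * mcoeff i j (r k))
          - (?c h - ?c (g \<otimes>\<^bsub>G\<^esub> h) + ?c g)"
        using t[OF gh] by simp
    qed
    also have "\<dots> = frag_pair (\<lambda>(g, h). \<Sum>k<m. t g h k * mcoeff i j (r k)) z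
        - frag_pair ?c (bar_boundary2 G z)"
      by (simp add: frag_pair_bar_boundary2 case_prod_unfold frag_pair_fun_diff frag_pair_fun_add)
    also have "\<dots> = (\<Sum>k<m. frag_pair (\<lambda>(g, h). t g h k) z * mcoeff i j (r k))"
      using z frag_pair_const_mult[where p = z]
      by (simp add: cycles2_def case_prod_unfold frag_pair_fun_sum mult.commute)
    finally show ?thesis .
  qed
  then show ?thesis
    by (intro exI[of _ "\<lambda>k. frag_pair (\<lambda>(g, h). t g h k) z"]) blast
qed

section \<open>Cycles of the bar complex attached to relators\<close>

lemma dual_class_gen: "i < n \<Longrightarrow> k < n \<Longrightarrow> ecls i (gen k) = (if i = k then 1 else 0)"
  using dual_class_word[of "[(True, k)]" i] by (simp add: presented_gen_def letter_exp_def)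

lemma dual_class_one: "i < n \<Longrightarrow> ecls i \<one>\<^bsub>G\<^esub> = 0"
  using dual_class_mult[of i "\<one>\<^bsub>G\<^esub>" "\<one>\<^bsub>G\<^esub>"] by simp

lemma dual_class_inv:
  assumes "i < n" "g \<in> carrier G"
  shows "ecls i (inv\<^bsub>G\<^esub> g) = - ecls i g"
  using dual_class_mult[of i g "inv\<^bsub>G\<^esub> g"] assms by (simp add: dual_class_one)

text \<open>A 2-chain that decomposes [w] into generators up to a boundary, with prescribed cup
  values. For a relator its boundary is just -[1]. Only indices i different from j enter the
  exterior square.\<close>

definition word_chain_spec :: "word \<Rightarrow> (word set \<times> word set \<Rightarrow>\<^sub>0 int) \<Rightarrow> bool" where
  "word_chain_spec w z \<longleftrightarrow> keys z \<subseteq> carrier G \<times> carrier G \<and>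
    bar_boundary2 G z = (\<Sum>k<n. frag_cmul (word_exp k w) (frag_of (gen k))) - frag_of (\<phi> w) \<and>
    (\<forall>i<n. \<forall>j<n. i \<noteq> j \<longrightarrow> cup_pair i j z = mcoeff i j w)"

lemma bar_boundary2_add: "bar_boundary2 G' (y + z) = bar_boundary2 G' y + bar_boundary2 G' z"
  by (simp add: bar_boundary2_def frag_extend_add)

lemma bar_boundary2_minus: "bar_boundary2 G' (- z) = - bar_boundary2 G' z"
  by (simp add: bar_boundary2_def frag_extend_minus)

lemma bar_boundary2_diff: "bar_boundary2 G' (y - z) = bar_boundary2 G' y - bar_boundary2 G' z"
  by (simp add: bar_boundary2_def frag_extend_diff)

lemma bar_boundary2_frag_of:
  "bar_boundary2 G' (frag_of (g, h)) = frag_of h - frag_of (g \<otimes>\<^bsub>G'\<^esub> h) + frag_of g"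
  by (simp add: bar_boundary2_def)

lemma sum_letter_exp:
  "k < n \<Longrightarrow> (\<Sum>i<n. frag_cmul (letter_exp i (s, k)) (f i)) = (if s then f k else - f k)"
  by (subst sum.remove[of _ k]) (auto simp: letter_exp_def intro!: sum.neutral)

lemma word_chain_letter:
  assumes k: "k < n"
  shows "\<exists>z. word_chain_spec [(s, k)] z"
proof (cases s)
  case True
  have "word_chain_spec [(s, k)] 0"
    using True k sum_letter_exp[of k s "\<lambda>i. frag_of (gen i)"]
    by (auto simp: word_chain_spec_def bar_boundary2_def proj_letter letter_exp_def)
  then show ?thesis ..
next
  case False
  let ?g = "gen k"
  \<comment> \<open>The boundary of (g, inv g) is [inv g] - [1] + [g] and that of (1, 1) is [1]; the
    second simplex removes the unit.\<close>
  let ?z = "- frag_of (?g, inv\<^bsub>G\<^esub> ?g) - frag_of (\<one>\<^bsub>G\<^esub>, \<one>\<^bsub>G\<^esub>)"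
  have "keys ?z \<subseteq> {(?g, inv\<^bsub>G\<^esub> ?g), (\<one>\<^bsub>G\<^esub>, \<one>\<^bsub>G\<^esub>)}"
    using keys_diff[of "- frag_of (?g, inv\<^bsub>G\<^esub> ?g)" "frag_of (\<one>\<^bsub>G\<^esub>, \<one>\<^bsub>G\<^esub>)"]
    by (simp add: insert_commute)
  then have "keys ?z \<subseteq> carrier G \<times> carrier G"
    using k gen_closed by auto
  moreover have "bar_boundary2 G ?z = - frag_of ?g - frag_of (inv\<^bsub>G\<^esub> ?g)"
    using k by (simp add: bar_boundary2_diff bar_boundary2_minus bar_boundary2_frag_of gen_closed)
  moreover have "cup_pair i j ?z = 0" if "i < n" "j < n" "i \<noteq> j" for i j
    using that k by (simp add: frag_pair_diff frag_pair_minus dual_class_one dual_class_gen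
        dual_class_inv gen_closed)
  moreover have "mcoeff i j [(s, k)] = 0" if "i \<noteq> j" for i j
    using that by simp
  ultimately have "word_chain_spec [(s, k)] ?z"
    using False k sum_letter_exp[of k s "\<lambda>i. frag_of (gen i)"]
    unfolding word_chain_spec_def by (simp add: proj_letter)
  then show ?thesis ..
qed

lemma word_chain:
  assumes "w \<in> carrier F"
  shows "\<exists>z. word_chain_spec w z"
  using assms
proof (induction w)
  case Nil
  have "\<phi> [] = \<one>\<^bsub>G\<^esub>"
    using \<phi>.hom_one by (simp add: free_group_one)
  then have "word_chain_spec [] (- frag_of (\<one>\<^bsub>G\<^esub>, \<one>\<^bsub>G\<^esub>))"
    by (simp add: word_chain_spec_def bar_boundary2_minus bar_boundary2_frag_of frag_pair_minus
        dual_class_one)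
  then show ?case ..
next
  case (Cons a w)
  obtain s k where a: "a = (s, k)" by (cases a)
  have k: "k < n" and w: "w \<in> carrier F"
    using Cons.prems a by (auto simp: free_group_carrier dest: reduced_ConsD)
  have aw: "a # w = [a] \<otimes>\<^bsub>F\<^esub> w"
    using Cons.prems by (simp add: free_group_mult cons_reduce_reduced free_group_carrier)
  obtain y where y: "word_chain_spec [a] y"
    using word_chain_letter[OF k] a by blast
  obtain z where z: "word_chain_spec w z"
    using Cons.IH[OF w] by blast
  \<comment> \<open>The new simplex replaces -[a] - [w] by -[a w] in the boundary, and its cup value
    is the cross term of \<open>mcoeff_mult\<close>.\<close>
  let ?u = "y + (z + frag_of (\<phi> [a], \<phi> w))"
  have "keys ?u \<subseteq>
      keys y \<union> (keys z \<union> {(\<phi> [a], \<phi> w)})"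
    using Poly_Mapping.keys_add[of y] Poly_Mapping.keys_add[of z "frag_of (\<phi> [a], \<phi> w)"] by fastforce
  then have "keys ?u \<subseteq> carrier G \<times> carrier G"
    using y z k w a by (auto simp: word_chain_spec_def)
  moreover have "bar_boundary2 G ?u =
      (\<Sum>k<n. frag_cmul (word_exp k (a # w)) (frag_of (gen k))) - frag_of (\<phi> (a # w))"
    using y z k w a unfolding aw word_exp_mult
    by (simp add: word_chain_spec_def bar_boundary2_add bar_boundary2_frag_of frag_cmul_distrib
        sum.distrib)
  moreover have "cup_pair i j ?u = mcoeff i j (a # w)" if ij: "i < n" "j < n" "i \<noteq> j" for i j
    using y z k w a ij unfolding aw mcoeff_mult
    by (simp add: word_chain_spec_def frag_pair_add dual_class_word)
  ultimately have "word_chain_spec (a # w) ?u"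
    unfolding word_chain_spec_def by blast
  then show ?case ..
qed

lemma relator_cycle:
  assumes k: "k < m"
  obtains z where "z \<in> cycles2 G" "\<And>i j. i < n \<Longrightarrow> j < n \<Longrightarrow> i \<noteq> j \<Longrightarrow> cup_pair i j z = mcoeff i j (r k)"
proof -
  obtain z where z: "word_chain_spec (r k) z"
    using word_chain[OF relator_closed[OF k]] by blast
  have "\<phi> (r k) = \<one>\<^bsub>G\<^esub>"
    using k by (intro proj_relation_subgroup relator_in_relation_subgroup)
  \<comment> \<open>The relator has zero exponent sums and maps to 1, so the boundary of
    \<open>z\<close> is -[1], which the simplex (1, 1) cancels.\<close>
  then have "z + frag_of (\<one>\<^bsub>G\<^esub>, \<one>\<^bsub>G\<^esub>) \<in> cycles2 G"
    using z k Poly_Mapping.keys_add[of z "frag_of (\<one>\<^bsub>G\<^esub>, \<one>\<^bsub>G\<^esub>)"]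
    by (auto simp: cycles2_def word_chain_spec_def bar_boundary2_add bar_boundary2_frag_of
        word_exp_relator)
  moreover have "cup_pair i j (z + frag_of (\<one>\<^bsub>G\<^esub>, \<one>\<^bsub>G\<^esub>)) = mcoeff i j (r k)"
    if "i < n" "j < n" "i \<noteq> j" for i j
    using z that by (simp add: word_chain_spec_def frag_pair_add dual_class_one)
  ultimately show thesis
    using that by blast
qed

end

section \<open>Lie rings and their quotients\<close>

text \<open>Bilinearity alone: what the free nonassociative algebra, the Lie rings built from it and
  the Koszul model have in common.\<close>

locale nonassoc_ring = abelian_group L for L (structure) +
  assumes mult_closed [simp, intro]: "x \<in> carrier L \<Longrightarrow> y \<in> carrier L \<Longrightarrow> x \<otimes> y \<in> carrier L"
    and l_distr: "x \<in> carrier L \<Longrightarrow> y \<in> carrier L \<Longrightarrow> z \<in> carrier L \<Longrightarrow>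
      (x \<oplus> y) \<otimes> z = x \<otimes> z \<oplus> y \<otimes> z"
    and r_distr: "x \<in> carrier L \<Longrightarrow> y \<in> carrier L \<Longrightarrow> z \<in> carrier L \<Longrightarrow>
      z \<otimes> (x \<oplus> y) = z \<otimes> x \<oplus> z \<otimes> y"
begin

lemma r_null [simp]: "x \<in> carrier L \<Longrightarrow> x \<otimes> \<zero> = \<zero>"
  using r_distr[of \<zero> \<zero> x] by (simp add: add.r_cancel_one')

lemma r_minus:
  assumes "x \<in> carrier L" "y \<in> carrier L"
  shows "x \<otimes> (\<ominus> y) = \<ominus> (x \<otimes> y)"
proof -
  have "x \<otimes> (\<ominus> y) \<oplus> x \<otimes> y = \<zero>"
    using assms by (simp add: r_distr[symmetric] l_neg)
  then show ?thesis
    using assms by (simp add: minus_equality)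
qed

lemma generate_additive_subgroup:
  "U \<subseteq> carrier L \<Longrightarrow> additive_subgroup (generate (add_monoid L) U) L"
  by (intro additive_subgroupI add.generate_is_subgroup) simp

end

locale lie_ring = nonassoc_ring +
  assumes bracket_self: "x \<in> carrier L \<Longrightarrow> x \<otimes> x = \<zero>"
    and jacobi: "x \<in> carrier L \<Longrightarrow> y \<in> carrier L \<Longrightarrow> z \<in> carrier L \<Longrightarrow>
      x \<otimes> (y \<otimes> z) \<oplus> y \<otimes> (z \<otimes> x) \<oplus> z \<otimes> (x \<otimes> y) = \<zero>"
begin

lemma bracket_antisym:
  assumes "x \<in> carrier L" "y \<in> carrier L"
  shows "x \<otimes> y = \<ominus> (y \<otimes> x)"
proof -
  have "x \<otimes> y \<oplus> y \<otimes> x = (x \<otimes> x \<oplus> x \<otimes> y) \<oplus> (y \<otimes> x \<oplus> y \<otimes> y)"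
    using assms by (simp only: bracket_self l_zero r_zero mult_closed)
  also have "\<dots> = (x \<oplus> y) \<otimes> (x \<oplus> y)"
    using assms by (simp only: l_distr r_distr a_closed mult_closed a_ac)
  also have "\<dots> = \<zero>"
    using assms by (simp add: bracket_self)
  finally have "x \<otimes> y \<oplus> y \<otimes> x = \<zero>" .
  then show ?thesis
    using assms by (simp add: minus_equality)
qed

lemma jacobi':
  assumes "x \<in> carrier L" "y \<in> carrier L" "z \<in> carrier L"
  shows "x \<otimes> (y \<otimes> z) = \<ominus> (y \<otimes> (z \<otimes> x)) \<oplus> \<ominus> (z \<otimes> (x \<otimes> y))"
proof -
  have "x \<otimes> (y \<otimes> z) \<oplus> (y \<otimes> (z \<otimes> x) \<oplus> z \<otimes> (x \<otimes> y)) = \<zero>"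
    using jacobi[OF assms] assms by (simp add: a_assoc)
  then have "x \<otimes> (y \<otimes> z) = \<ominus> (y \<otimes> (z \<otimes> x) \<oplus> z \<otimes> (x \<otimes> y))"
    using assms by (simp add: minus_equality)
  then show ?thesis
    using assms by (simp add: minus_add)
qed

end

text \<open>A surjection that respects the operations transports the equational axioms, so for a
  quotient only the compatibility of the coset map with the operations has to be checked.\<close>

lemma surj_nonassoc_ring:
  assumes "nonassoc_ring L"
    and surj: "\<pi> ` carrier L = carrier M"
    and add: "\<And>x y. x \<in> carrier L \<Longrightarrow> y \<in> carrier L \<Longrightarrow> \<pi> (x \<oplus>\<^bsub>L\<^esub> y) = \<pi> x \<oplus>\<^bsub>M\<^esub> \<pi> y"
    and mult: "\<And>x y. x \<in> carrier L \<Longrightarrow> y \<in> carrier L \<Longrightarrow> \<pi> (x \<otimes>\<^bsub>L\<^esub> y) = \<pi> x \<otimes>\<^bsub>M\<^esub> \<pi> y"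
    and zero: "\<pi> \<zero>\<^bsub>L\<^esub> = \<zero>\<^bsub>M\<^esub>"
  shows "nonassoc_ring M"
proof -
  interpret L: nonassoc_ring L by fact
  have cl: "\<pi> x \<in> carrier M" if "x \<in> carrier L" for x
    using that surj by blast
  have ex: "\<exists>a\<in>carrier L. x = \<pi> a" if "x \<in> carrier M" for x
    using that surj by blast
  have "abelian_group M"
  proof (rule abelian_groupI)
    fix x y z
    assume "x \<in> carrier M" "y \<in> carrier M" "z \<in> carrier M"
    then obtain a b c where abc: "a \<in> carrier L" "b \<in> carrier L" "c \<in> carrier L"
      "x = \<pi> a" "y = \<pi> b" "z = \<pi> c"
      using ex by meson
    show "x \<oplus>\<^bsub>M\<^esub> y \<oplus>\<^bsub>M\<^esub> z = x \<oplus>\<^bsub>M\<^esub> (y \<oplus>\<^bsub>M\<^esub> z)"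
      using abc by (simp add: add[symmetric] L.a_assoc)
  next
    fix x y
    assume "x \<in> carrier M" "y \<in> carrier M"
    then obtain a b where ab: "a \<in> carrier L" "b \<in> carrier L" "x = \<pi> a" "y = \<pi> b"
      using ex by meson
    show "x \<oplus>\<^bsub>M\<^esub> y \<in> carrier M"
      using ab by (simp add: add[symmetric] cl)
    show "x \<oplus>\<^bsub>M\<^esub> y = y \<oplus>\<^bsub>M\<^esub> x"
      using ab by (simp add: add[symmetric] L.a_comm)
  next
    fix x
    assume "x \<in> carrier M"
    then obtain a where a: "a \<in> carrier L" "x = \<pi> a"
      using ex by meson
    show "\<zero>\<^bsub>M\<^esub> \<oplus>\<^bsub>M\<^esub> x = x"
      using a by (simp add: zero[symmetric] add[symmetric])
    show "\<exists>y\<in>carrier M. y \<oplus>\<^bsub>M\<^esub> x = \<zero>\<^bsub>M\<^esub>"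
      using a by (intro bexI[of _ "\<pi> (\<ominus>\<^bsub>L\<^esub> a)"]) (simp_all add: zero[symmetric] add[symmetric] L.l_neg cl)
  qed (metis zero cl L.zero_closed)
  then show ?thesis
  proof (intro nonassoc_ring.intro nonassoc_ring_axioms.intro)
    fix x y
    assume "x \<in> carrier M" "y \<in> carrier M"
    then obtain a b where ab: "a \<in> carrier L" "b \<in> carrier L" "x = \<pi> a" "y = \<pi> b"
      using ex by meson
    show "x \<otimes>\<^bsub>M\<^esub> y \<in> carrier M"
      using ab by (simp add: mult[symmetric] cl)
  next
    fix x y z
    assume "x \<in> carrier M" "y \<in> carrier M" "z \<in> carrier M"
    then obtain a b c where abc: "a \<in> carrier L" "b \<in> carrier L" "c \<in> carrier L"
      "x = \<pi> a" "y = \<pi> b" "z = \<pi> c"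
      using ex by meson
    show "(x \<oplus>\<^bsub>M\<^esub> y) \<otimes>\<^bsub>M\<^esub> z = x \<otimes>\<^bsub>M\<^esub> z \<oplus>\<^bsub>M\<^esub> y \<otimes>\<^bsub>M\<^esub> z"
      using abc by (simp add: add[symmetric] mult[symmetric] L.l_distr)
    show "z \<otimes>\<^bsub>M\<^esub> (x \<oplus>\<^bsub>M\<^esub> y) = z \<otimes>\<^bsub>M\<^esub> x \<oplus>\<^bsub>M\<^esub> z \<otimes>\<^bsub>M\<^esub> y"
      using abc by (simp add: add[symmetric] mult[symmetric] L.r_distr)
  qed
qed

locale nonassoc_ideal = nonassoc_ring +
  fixes I
  assumes ideal: "algebra_ideal L I"
begin

sublocale additive_subgroup I L
  using ideal by (simp add: algebra_ideal_def)

sublocale abelian_subgroup I L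
  by (rule abelian_subgroupI3) unfold_locales

lemma ideal_mult:
  "a \<in> I \<Longrightarrow> u \<in> carrier L \<Longrightarrow> a \<otimes> u \<in> I"
  "a \<in> I \<Longrightarrow> u \<in> carrier L \<Longrightarrow> u \<otimes> a \<in> I"
  using ideal by (auto simp: algebra_ideal_def)

lemma coset_eq_iff:
  assumes "x \<in> carrier L" "y \<in> carrier L"
  shows "I +> x = I +> y \<longleftrightarrow> x \<ominus> y \<in> I"
proof -
  have "x \<ominus> y \<in> I \<longleftrightarrow> x \<in> I +> y"
    using a_rcos_module[OF assms(2,1)] by (simp add: minus_eq)
  then show ?thesis
    using a_repr_independence'[of x y] a_rcos_self[of x] assms by auto
qed

lemma coset_zero: "I +> \<zero> = I"
  by (simp add: a_rcos_const)

lemma coset_eq_zero_iff: "x \<in> carrier L \<Longrightarrow> I +> x = I \<longleftrightarrow> x \<in> I"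
  using a_rcos_self[of x] a_rcos_const[of x] by auto

lemma coset_add:
  "x \<in> carrier L \<Longrightarrow> y \<in> carrier L \<Longrightarrow> I +> (x \<oplus> y) = (I +> x) \<oplus>\<^bsub>L Quot I\<^esub> (I +> y)"
  by (simp add: FactRing_def a_rcos_sum)

lemma coset_mult:
  assumes x: "x \<in> carrier L" and y: "y \<in> carrier L"
  shows "I +> (x \<otimes> y) = (I +> x) \<otimes>\<^bsub>L Quot I\<^esub> (I +> y)"
proof -
  \<comment> \<open>The quotient product is a union over all pairs of representatives; it is a
    single coset only because all these pairs give the same one.\<close>
  have eq: "I +> (a \<otimes> b) = I +> (x \<otimes> y)" if a: "a \<in> I +> x" and b: "b \<in> I +> y" for a b
  proof -
    obtain h k where h: "h \<in> I" "a = h \<oplus> x" and k: "k \<in> I" "b = k \<oplus> y"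
      using a b by (auto simp: a_r_coset_def')
    have hk: "h \<in> carrier L" "k \<in> carrier L"
      using h k by auto
    have "a \<otimes> b = (h \<otimes> (k \<oplus> y) \<oplus> x \<otimes> k) \<oplus> x \<otimes> y"
      using h k hk x y by (simp add: l_distr r_distr a_ac)
    moreover have "h \<otimes> (k \<oplus> y) \<oplus> x \<otimes> k \<in> I"
      using h k hk x y by (intro a_closed ideal_mult) auto
    ultimately have "a \<otimes> b \<in> I +> (x \<otimes> y)"
      by (auto simp: a_r_coset_def')
    then show ?thesis
      using x y a_repr_independence' by simp
  qed
  have "x \<in> I +> x" "y \<in> I +> y"
    using x y by (auto intro: a_rcos_self)
  then have "(\<Union>a\<in>I +> x. \<Union>b\<in>I +> y. I +> (a \<otimes> b)) = I +> (x \<otimes> y)"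
    using eq by blast
  then show ?thesis
    by (simp add: FactRing_def rcoset_mult_def)
qed

lemma carrier_Quot: "carrier (L Quot I) = (\<lambda>x. I +> x) ` carrier L"
  by (auto simp: FactRing_def A_RCOSETS_def')

lemma zero_Quot: "\<zero>\<^bsub>L Quot I\<^esub> = I"
  by (simp add: FactRing_def)

lemma nonassoc_ring_Quot: "nonassoc_ring (L Quot I)"
  by (rule surj_nonassoc_ring[OF nonassoc_ring_axioms carrier_Quot[symmetric]])
    (simp_all add: coset_add coset_mult coset_zero zero_Quot)

end

lemma lie_ring_Quot:
  assumes "lie_ring L" "algebra_ideal L I"
  shows "lie_ring (L Quot I)"
proof -
  interpret L: lie_ring L by fact
  interpret nonassoc_ideal L I by unfold_locales fact
  interpret Q: nonassoc_ring "L Quot I" by (rule nonassoc_ring_Quot)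
  show ?thesis
  proof unfold_locales
    fix x assume "x \<in> carrier (L Quot I)"
    then show "x \<otimes>\<^bsub>L Quot I\<^esub> x = \<zero>\<^bsub>L Quot I\<^esub>"
      by (auto simp: carrier_Quot coset_mult[symmetric] L.bracket_self coset_zero zero_Quot)
  next
    fix x y z assume "x \<in> carrier (L Quot I)" "y \<in> carrier (L Quot I)" "z \<in> carrier (L Quot I)"
    then show "x \<otimes>\<^bsub>L Quot I\<^esub> (y \<otimes>\<^bsub>L Quot I\<^esub> z) \<oplus>\<^bsub>L Quot I\<^esub> y \<otimes>\<^bsub>L Quot I\<^esub> (z \<otimes>\<^bsub>L Quot I\<^esub> x)
      \<oplus>\<^bsub>L Quot I\<^esub> z \<otimes>\<^bsub>L Quot I\<^esub> (x \<otimes>\<^bsub>L Quot I\<^esub> y) = \<zero>\<^bsub>L Quot I\<^esub>"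
      by (auto simp: carrier_Quot coset_mult[symmetric] coset_add[symmetric] L.jacobi coset_zero zero_Quot)
  qed
qed

lemma (in nonassoc_ring) algebra_ideal_ideal_generated:
  assumes "U \<subseteq> carrier L"
  shows "algebra_ideal L (ideal_generated L U)"
proof -
  let ?\<I> = "{I. algebra_ideal L I \<and> U \<subseteq> I}"
  have "additive_subgroup (carrier L) L"
    by (intro additive_subgroupI add.subgroup_self)
  then have ne: "carrier L \<in> ?\<I>"
    using assms by (auto simp: algebra_ideal_def)
  have "subgroup (\<Inter>?\<I>) (add_monoid L)"
    using ne by (intro add.subgroups_Inter) (auto simp: algebra_ideal_def additive_subgroup_def)
  then show ?thesis
    unfolding algebra_ideal_def ideal_generated_def by (auto intro: additive_subgroupI)
qed

lemma ideal_generated_least: "algebra_ideal L I \<Longrightarrow> U \<subseteq> I \<Longrightarrow> ideal_generated L U \<subseteq> I"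
  unfolding ideal_generated_def by blast

lemma ideal_generated_superset: "U \<subseteq> ideal_generated L U"
  unfolding ideal_generated_def by blast

context nonassoc_ring
begin

lemma bracket_span_closed:
  "U \<subseteq> carrier L \<Longrightarrow> bracket_span L U \<subseteq> carrier L"
  unfolding bracket_span_def by (intro add.generate_incl) auto

lemma bracket_span_mem:
  "u \<in> U \<Longrightarrow> v \<in> U \<Longrightarrow> u \<otimes> v \<in> bracket_span L U"
  unfolding bracket_span_def by (rule generate.incl) blast

lemma bracket_span_subgroup:
  "U \<subseteq> carrier L \<Longrightarrow> additive_subgroup (bracket_span L U) L"
  unfolding bracket_span_def by (rule generate_additive_subgroup) auto

lemma bracket_span_least:
  assumes "additive_subgroup V L" "\<And>u v. u \<in> U \<Longrightarrow> v \<in> U \<Longrightarrow> u \<otimes> v \<in> V"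
  shows "bracket_span L U \<subseteq> V"
  unfolding bracket_span_def
  by (rule add.generate_subgroup_incl) (use assms in \<open>auto simp: additive_subgroup_def\<close>)

lemma derived_subalgebra_closed: "derived_subalgebra L \<subseteq> carrier L"
  unfolding derived_subalgebra_def by (rule bracket_span_closed) simp

end

text \<open>By the Jacobi identity bracketing with \<open>x\<close> is a derivation, and it maps
  into the derived subalgebra. It therefore sends a bracket of two derived elements to a sum of such
  brackets, which suffices since these generate.\<close>

lemma (in lie_ring) algebra_ideal_second_derived: "algebra_ideal L (second_derived_subalgebra L)"
proof -
  let ?D = "derived_subalgebra L" and ?E = "second_derived_subalgebra L"
  interpret E: additive_subgroup ?E L
    unfolding second_derived_subalgebra_def by (rule bracket_span_subgroup[OF derived_subalgebra_closed])
  have D: "u \<otimes> v \<in> ?D" if "u \<in> carrier L" "v \<in> carrier L" for u v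
    using that unfolding derived_subalgebra_def by (rule bracket_span_mem)
  have DD: "u \<otimes> v \<in> ?E" if "u \<in> ?D" "v \<in> ?D" for u v
    using that unfolding second_derived_subalgebra_def by (rule bracket_span_mem)
  have left: "x \<otimes> a \<in> ?E" if x: "x \<in> carrier L" and a: "a \<in> ?E" for x a
  proof -
    let ?V = "{a \<in> carrier L. x \<otimes> a \<in> ?E}"
    have "additive_subgroup ?V L"
    proof (intro additive_subgroupI add.subgroupI)
      show "?V \<noteq> {}"
        using x by (auto intro!: exI[of _ \<zero>])
      show "\<ominus> a \<in> ?V" if "a \<in> ?V" for a
        using that x by (simp add: r_minus)
    qed (use x in \<open>auto simp: r_distr\<close>)
    moreover have "u \<otimes> v \<in> ?V" if "u \<in> ?D" "v \<in> ?D" for u v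
    proof -
      have uv: "u \<in> carrier L" "v \<in> carrier L"
        using that derived_subalgebra_closed by auto
      have "x \<otimes> (u \<otimes> v) = \<ominus> (u \<otimes> (v \<otimes> x)) \<oplus> \<ominus> (v \<otimes> (x \<otimes> u))"
        using x uv by (rule jacobi')
      then show ?thesis
        using x uv that D DD by simp
    qed
    ultimately have "?E \<subseteq> ?V"
      unfolding second_derived_subalgebra_def by (rule bracket_span_least)
    then show ?thesis using a by blast
  qed
  moreover have "a \<otimes> x \<in> ?E" if "x \<in> carrier L" and "a \<in> ?E" for x a
    using left[OF that] that bracket_antisym[of a x] by simp
  ultimately show ?thesis
    using E.additive_subgroup_axioms by (auto simp: algebra_ideal_def)
qed

section \<open>Metabelian quotients of the free nonassociative algebra\<close>

abbreviation fna :: "nat \<Rightarrow> (lie_term \<Rightarrow>\<^sub>0 int) ring" where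
  "fna \<equiv> free_nonassoc_algebra"

abbreviation terms :: "nat \<Rightarrow> lie_term set" where
  "terms n \<equiv> {t. term_gens t \<subseteq> {..<n}}"

abbreviation monoms :: "nat \<Rightarrow> monom set" where
  "monoms n \<equiv> {e. keys e \<subseteq> {..<n}}"

lemma fna_simps:
  "p \<oplus>\<^bsub>fna n\<^esub> q = p + q" "\<zero>\<^bsub>fna n\<^esub> = 0"
  "p \<otimes>\<^bsub>fna n\<^esub> q = frag_extend (\<lambda>s. frag_extend (\<lambda>t. frag_of (Br s t)) q) p"
  "p \<in> carrier (fna n) \<longleftrightarrow> keys p \<subseteq> terms n"
  by (auto simp: free_nonassoc_algebra_def)

lemma frag_extend_fun_add:
  "frag_extend (\<lambda>x. f x + g x) p = frag_extend f p + frag_extend g p"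
  by (simp add: frag_extend_def frag_cmul_distrib2 sum.distrib)

lemma frag_extend_fun_diff:
  "frag_extend (\<lambda>x. f x - g x) p = frag_extend f p - frag_extend g p"
  by (induction p rule: frag_induction[OF subset_UNIV]) (simp_all add: frag_extend_diff)

lemma frag_extend_fun_0 [simp]: "frag_extend (\<lambda>x. 0) p = 0"
  by (rule frag_extend_eq_0) simp

lemma fna_mult_add:
  "(p + q) \<otimes>\<^bsub>fna n\<^esub> u = p \<otimes>\<^bsub>fna n\<^esub> u + q \<otimes>\<^bsub>fna n\<^esub> u"
  "u \<otimes>\<^bsub>fna n\<^esub> (p + q) = u \<otimes>\<^bsub>fna n\<^esub> p + u \<otimes>\<^bsub>fna n\<^esub> q"
  by (simp_all add: fna_simps frag_extend_add frag_extend_fun_add)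

lemma fna_mult_diff:
  "(p - q) \<otimes>\<^bsub>fna n\<^esub> u = p \<otimes>\<^bsub>fna n\<^esub> u - q \<otimes>\<^bsub>fna n\<^esub> u"
  "u \<otimes>\<^bsub>fna n\<^esub> (p - q) = u \<otimes>\<^bsub>fna n\<^esub> p - u \<otimes>\<^bsub>fna n\<^esub> q"
  by (simp_all add: fna_simps frag_extend_diff frag_extend_fun_diff)

lemma fna_mult_0: "0 \<otimes>\<^bsub>fna n\<^esub> u = 0" "u \<otimes>\<^bsub>fna n\<^esub> 0 = 0"
  by (simp_all add: fna_simps)

lemma fna_mult_frag_of: "frag_of s \<otimes>\<^bsub>fna n\<^esub> frag_of t = frag_of (Br s t)"
  by (simp add: fna_simps)

lemma keys_add_subset:
  "keys p \<subseteq> S \<Longrightarrow> keys q \<subseteq> S \<Longrightarrow> keys (p + q) \<subseteq> S"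
  using Poly_Mapping.keys_add[of p q] by blast

lemma keys_diff_subset:
  fixes p q :: "'a \<Rightarrow>\<^sub>0 int"
  shows "keys p \<subseteq> S \<Longrightarrow> keys q \<subseteq> S \<Longrightarrow> keys (p - q) \<subseteq> S"
  using keys_diff[of p q] by blast

lemma keys_frag_extend_subset:
  assumes "keys p \<subseteq> S" "\<And>x. x \<in> S \<Longrightarrow> keys (f x) \<subseteq> T"
  shows "keys (frag_extend f p) \<subseteq> T"
  using keys_frag_extend[of f p] assms by blast

abbreviation bracket_terms :: "nat \<Rightarrow> lie_term set" where
  "bracket_terms n \<equiv> {Br s t | s t. term_gens (Br s t) \<subseteq> {..<n}}"

text \<open>Representatives for derived subalgebras, recognizable term by term;
  \<open>derived_HL\<close> shows that they project onto the derived subalgebra of the holonomy Lie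
  algebra.\<close>

definition fna_brackets :: "nat \<Rightarrow> (lie_term \<Rightarrow>\<^sub>0 int) set" where
  "fna_brackets n = {p. keys p \<subseteq> bracket_terms n}"

lemma fna_brackets_closed: "p \<in> fna_brackets n \<Longrightarrow> p \<in> carrier (fna n)"
  by (fastforce simp: fna_brackets_def fna_simps)

lemma fna_mult_brackets:
  assumes "p \<in> carrier (fna n)" "q \<in> carrier (fna n)"
  shows "p \<otimes>\<^bsub>fna n\<^esub> q \<in> fna_brackets n"
  unfolding fna_brackets_def mem_Collect_eq fna_simps(3)
  using assms[unfolded fna_simps]
  by (intro keys_frag_extend_subset) auto

lemma fna_brackets_add: "p \<in> fna_brackets n \<Longrightarrow> q \<in> fna_brackets n \<Longrightarrow> p + q \<in> fna_brackets n"
  unfolding fna_brackets_def mem_Collect_eq by (rule keys_add_subset)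

lemma fna_brackets_diff: "p \<in> fna_brackets n \<Longrightarrow> q \<in> fna_brackets n \<Longrightarrow> p - q \<in> fna_brackets n"
  unfolding fna_brackets_def mem_Collect_eq by (rule keys_diff_subset)

lemma fna_brackets_0 [simp]: "0 \<in> fna_brackets n"
  by (simp add: fna_brackets_def)

lemma fna_brackets_frag_of [simp]:
  "frag_of t \<in> fna_brackets n \<longleftrightarrow> (\<exists>s u. t = Br s u) \<and> term_gens t \<subseteq> {..<n}"
  by (auto simp: fna_brackets_def)

lemma nonassoc_ring_fna: "nonassoc_ring (fna n)"
proof (intro nonassoc_ring.intro nonassoc_ring_axioms.intro abelian_groupI)
  fix p assume "p \<in> carrier (fna n)"
  then show "\<exists>q\<in>carrier (fna n). q \<oplus>\<^bsub>fna n\<^esub> p = \<zero>\<^bsub>fna n\<^esub>"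
    by (intro bexI[of _ "- p"]) (auto simp: fna_simps)
next
  fix p q assume "p \<in> carrier (fna n)" "q \<in> carrier (fna n)"
  then show "p \<oplus>\<^bsub>fna n\<^esub> q \<in> carrier (fna n)"
    unfolding fna_simps by (rule keys_add_subset)
next
  fix p q assume "p \<in> carrier (fna n)" "q \<in> carrier (fna n)"
  then show "p \<otimes>\<^bsub>fna n\<^esub> q \<in> carrier (fna n)"
    by (rule fna_brackets_closed[OF fna_mult_brackets])
qed (simp_all add: fna_mult_add fna_simps(1,2,4) algebra_simps)

lemma fna_cmul_closed: "p \<in> carrier (fna n) \<Longrightarrow> frag_cmul k p \<in> carrier (fna n)"
  using keys_cmul[of k p] by (auto simp: fna_simps)

locale fna_hom = nonassoc_ring M for n :: nat and M (structure) +
  fixes \<pi> :: "(lie_term \<Rightarrow>\<^sub>0 int) \<Rightarrow> 'a"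
  assumes hom_closed [simp, intro]: "p \<in> carrier (fna n) \<Longrightarrow> \<pi> p \<in> carrier M"
    and hom_add: "p \<in> carrier (fna n) \<Longrightarrow> q \<in> carrier (fna n) \<Longrightarrow> \<pi> (p + q) = \<pi> p \<oplus> \<pi> q"
    and hom_mult: "p \<in> carrier (fna n) \<Longrightarrow> q \<in> carrier (fna n) \<Longrightarrow>
      \<pi> (p \<otimes>\<^bsub>fna n\<^esub> q) = \<pi> p \<otimes> \<pi> q"
begin

lemma hom_zero [simp]: "\<pi> 0 = \<zero>"
  using hom_add[of 0 0] by (simp add: fna_simps add.r_cancel_one')

lemma hom_minus: "p \<in> carrier (fna n) \<Longrightarrow> \<pi> (- p) = \<ominus> \<pi> p"
  using hom_add[of "- p" p] by (intro minus_equality[symmetric]) (auto simp: fna_simps)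

lemma hom_diff:
  assumes "p \<in> carrier (fna n)" "q \<in> carrier (fna n)"
  shows "\<pi> (p - q) = \<pi> p \<ominus> \<pi> q"
  using hom_add[of p "- q"] hom_minus[of q] assms by (simp add: fna_simps a_minus_def)

lemma hom_cmul:
  assumes p: "p \<in> carrier (fna n)"
  shows "\<pi> (frag_cmul k p) = [k] \<cdot> \<pi> p"
proof -
  note cl = fna_cmul_closed[OF p]
  have nat: "\<pi> (frag_cmul (int l) p) = [l] \<cdot> \<pi> p" for l :: nat
  proof (induction l)
    case (Suc l)
    have "frag_cmul (int (Suc l)) p = frag_cmul (int l) p + p"
      by (simp add: frag_cmul_distrib)
    then show ?case
      using Suc p hom_add[OF cl[of "int l"] p] by (simp add: add.nat_pow_Suc)
  qed (simp add: add.nat_pow_0)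
  show ?thesis
  proof (cases "0 \<le> k")
    case True
    then show ?thesis using nat[of "nat k"] by (simp add: add_pow_int_ge)
  next
    case False
    then have "frag_cmul k p = - frag_cmul (int (nat (- k))) p"
      by simp
    then have "\<pi> (frag_cmul k p) = \<ominus> ([nat (- k)] \<cdot> \<pi> p)"
      by (simp only: hom_minus[OF cl] nat)
    then show ?thesis
      using False by (simp add: add_pow_int_lt)
  qed
qed

lemma hom_finsum:
  assumes "finite K" "\<And>k. k \<in> K \<Longrightarrow> p k \<in> carrier (fna n)"
  shows "(\<Sum>k\<in>K. p k) \<in> carrier (fna n) \<and> \<pi> (\<Sum>k\<in>K. p k) = (\<Oplus>k\<in>K. \<pi> (p k))"
  using assms
proof (induction K rule: finite_induct)
  case (insert k K)
  then have "(\<Sum>k\<in>K. p k) \<in> carrier (fna n)" "p k \<in> carrier (fna n)"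
    by auto
  then have "p k + (\<Sum>k\<in>K. p k) \<in> carrier (fna n)"
    unfolding fna_simps by (intro keys_add_subset)
  then show ?case
    using insert by (simp add: hom_add finsum_insert Pi_def)
qed (simp add: fna_simps)

end

section \<open>Iterated adjoint operators and the normal form of brackets\<close>

definition ad_term :: "nat \<Rightarrow> monom \<Rightarrow> lie_term \<Rightarrow> lie_term" where
  "ad_term n e t = foldr (\<lambda>i. Br (Gen i) ^^ lookup e i) [0..<n] t"

definition ad_op :: "nat \<Rightarrow> monom \<Rightarrow> (lie_term \<Rightarrow>\<^sub>0 int) \<Rightarrow> (lie_term \<Rightarrow>\<^sub>0 int)" where
  "ad_op n e = frag_extend (\<lambda>t. frag_of (ad_term n e t))"

lemma ad_term_0 [simp]: "ad_term n 0 t = t"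
  unfolding ad_term_def by (induction n) simp_all

lemma foldr_funpow_invariant:
  assumes "P c" "\<And>i c. i \<in> set xs \<Longrightarrow> P c \<Longrightarrow> P (f i c)"
  shows "P (foldr (\<lambda>i. f i ^^ l i) xs c)"
  using assms
proof (induction xs)
  case (Cons x xs)
  have "P ((f x ^^ k) d)" if "P d" for k d
    using that Cons.prems(2) by (induction k) auto
  then show ?case
    using Cons by simp
qed simp

text \<open>Moving the extra \<open>f i\<close> outwards past the other factors uses commutation,
  which is demanded only on elements satisfying \<open>P\<close>. In the application
  \<open>P\<close> is membership in the image of the brackets, where adjoint operators of generators
  commute.\<close>

lemma foldr_funpow_add1:
  assumes "distinct xs" "i \<in> set xs" "P c"
    and closed: "\<And>k c. k \<in> set xs \<Longrightarrow> P c \<Longrightarrow> P (f k c)"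
    and comm: "\<And>k l c. k \<in> set xs \<Longrightarrow> l \<in> set xs \<Longrightarrow> P c \<Longrightarrow> f k (f l c) = f l (f k c)"
  shows "foldr (\<lambda>k. f k ^^ (l k + (if i = k then 1 else 0))) xs c = f i (foldr (\<lambda>k. f k ^^ l k) xs c)"
  using assms
proof (induction xs)
  case (Cons x xs)
  let ?d = "foldr (\<lambda>k. f k ^^ l k) xs c"
  have d: "P ?d"
    by (rule foldr_funpow_invariant) (use Cons.prems in auto)
  show ?case
  proof (cases "i = x")
    case True
    then have "foldr (\<lambda>k. f k ^^ (l k + (if i = k then 1 else 0))) xs c = ?d"
      using Cons.prems(1) by (intro foldr_cong) auto
    then show ?thesis
      using True by simp
  next
    case False
    then have "i \<in> set xs"
      using Cons.prems(2) by simp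
    then have IH: "foldr (\<lambda>k. f k ^^ (l k + (if i = k then 1 else 0))) xs c = f i ?d"
      using Cons by simp
    have "(f x ^^ k) (f i d) = f i ((f x ^^ k) d) \<and> P ((f x ^^ k) d)" if "P d" for k d
    proof (induction k)
      case (Suc k)
      let ?e = "(f x ^^ k) d"
      have x: "x \<in> set (x # xs)"
        by simp
      have "f x (f i ?e) = f i (f x ?e)"
        by (rule Cons.prems(5)[OF x Cons.prems(2)]) (rule Suc[THEN conjunct2])
      moreover have "P (f x ?e)"
        by (rule Cons.prems(4)[OF x]) (rule Suc[THEN conjunct2])
      ultimately show ?case
        using Suc[THEN conjunct1] by simp
    qed (simp add: that)
    then show ?thesis
      using IH d False by simp
  qed
qed simp

lemma term_gens_ad_term:
  "term_gens t \<subseteq> {..<n} \<Longrightarrow> term_gens (ad_term n e t) \<subseteq> {..<n}"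
  unfolding ad_term_def by (rule foldr_funpow_invariant) auto

lemma ad_term_Br: "\<exists>s u. t = Br s u \<Longrightarrow> \<exists>s u. ad_term n e t = Br s u"
  unfolding ad_term_def by (rule foldr_funpow_invariant) auto

lemma ad_op_closed: "p \<in> carrier (fna n) \<Longrightarrow> ad_op n e p \<in> carrier (fna n)"
  unfolding fna_simps ad_op_def
  by (erule keys_frag_extend_subset) (simp add: term_gens_ad_term)

lemma ad_op_brackets: "p \<in> fna_brackets n \<Longrightarrow> ad_op n e p \<in> fna_brackets n"
  unfolding fna_brackets_def ad_op_def mem_Collect_eq
proof (erule keys_frag_extend_subset)
  fix t assume t: "t \<in> bracket_terms n"
  from t have "\<exists>s u. t = Br s u" "term_gens t \<subseteq> {..<n}"
    by auto
  then have "\<exists>s u. ad_term n e t = Br s u" "term_gens (ad_term n e t) \<subseteq> {..<n}"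
    using ad_term_Br term_gens_ad_term by blast+
  then show "keys (frag_of (ad_term n e t)) \<subseteq> bracket_terms n"
    by auto
qed

text \<open>A normal form for brackets of generators, valid in every metabelian Lie ring: an integer
  combination of triples \<open>(e, a, b)\<close>, which stand for \<open>ad\<^bsup>e\<^esup> [x\<^sub>a, x\<^sub>b]\<close>.\<close>

type_synonym ad_comb = "(monom \<times> nat \<times> nat) \<Rightarrow>\<^sub>0 int"

definition ad_shift :: "nat \<Rightarrow> ad_comb \<Rightarrow> ad_comb" where
  "ad_shift i = frag_extend (\<lambda>(e, a, b). frag_of (e + mvar i, a, b))"

definition ad_comb_eval :: "nat \<Rightarrow> ad_comb \<Rightarrow> (lie_term \<Rightarrow>\<^sub>0 int)" where
  "ad_comb_eval n = frag_extend (\<lambda>(e, a, b). frag_of (ad_term n e (Br (Gen a) (Gen b))))"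

lemma ad_comb_eval_diff: "ad_comb_eval n (c - d) = ad_comb_eval n c - ad_comb_eval n d"
  by (simp add: ad_comb_eval_def frag_extend_diff)

fun normal_form :: "lie_term \<Rightarrow> ad_comb" where
  "normal_form (Gen i) = 0"
| "normal_form (Br (Gen i) (Gen j)) = frag_of (0, i, j)"
| "normal_form (Br (Gen i) (Br s t)) = ad_shift i (normal_form (Br s t))"
| "normal_form (Br (Br s t) (Gen i)) = - ad_shift i (normal_form (Br s t))"
| "normal_form (Br (Br s t) (Br u v)) = 0"

abbreviation ad_basis :: "nat \<Rightarrow> (monom \<times> nat \<times> nat) set" where
  "ad_basis n \<equiv> {(e, a, b). keys e \<subseteq> {..<n} \<and> a < n \<and> b < n}"

lemma keys_ad_shift:
  "i < n \<Longrightarrow> keys c \<subseteq> ad_basis n \<Longrightarrow> keys (ad_shift i c) \<subseteq> ad_basis n"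
  unfolding ad_shift_def by (erule keys_frag_extend_subset) (auto simp: keys_add_monom)

lemma keys_normal_form:
  "term_gens t \<subseteq> {..<n} \<Longrightarrow> keys (normal_form t) \<subseteq> ad_basis n"
  by (induction t rule: normal_form.induct) (auto simp del: subset_iff dest!: keys_ad_shift[THEN subsetD, rotated -1])

lemma ad_comb_eval_brackets:
  "keys c \<subseteq> ad_basis n \<Longrightarrow> ad_comb_eval n c \<in> fna_brackets n"
  unfolding ad_comb_eval_def fna_brackets_def mem_Collect_eq
proof (erule keys_frag_extend_subset)
  fix x assume "x \<in> ad_basis n"
  then obtain e a b where x: "x = (e, a, b)" "a < n" "b < n"
    by auto
  then show "keys (case x of (e, a, b) \<Rightarrow> frag_of (ad_term n e (Br (Gen a) (Gen b))))
      \<subseteq> bracket_terms n"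
    using ad_term_Br[of "Br (Gen a) (Gen b)" n e] term_gens_ad_term[of "Br (Gen a) (Gen b)" n e] by auto
qed

text \<open>Both the Koszul model and the metabelian quotient of the holonomy Lie algebra are
  targets of this kind, so identities proved here transfer between them through common
  representatives.\<close>

locale metabelian_hom = fna_hom + lie_ring M +
  assumes metabelian: "p \<in> fna_brackets n \<Longrightarrow> q \<in> fna_brackets n \<Longrightarrow> \<pi> p \<otimes> \<pi> q = \<zero>"
begin

abbreviation y :: "nat \<Rightarrow> 'a" where
  "y i \<equiv> \<pi> (frag_of (Gen i))"

definition adM :: "monom \<Rightarrow> 'a \<Rightarrow> 'a" where
  "adM e c = foldr (\<lambda>i. (\<lambda>c. y i \<otimes> c) ^^ lookup e i) [0..<n] c"

lemma gen_in_fna: "i < n \<Longrightarrow> frag_of (Gen i) \<in> carrier (fna n)"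
  by (simp add: fna_simps)

lemma y_closed [simp, intro]: "i < n \<Longrightarrow> y i \<in> carrier M"
  by (intro hom_closed gen_in_fna)

lemma adM_closed: "c \<in> carrier M \<Longrightarrow> adM e c \<in> carrier M"
  unfolding adM_def by (rule foldr_funpow_invariant) auto

lemma y_image_brackets:
  assumes "i < n" "c \<in> \<pi> ` fna_brackets n"
  shows "y i \<otimes> c \<in> \<pi> ` fna_brackets n"
proof -
  obtain p where p: "p \<in> fna_brackets n" "c = \<pi> p"
    using assms(2) by blast
  then have "y i \<otimes> c = \<pi> (frag_of (Gen i) \<otimes>\<^bsub>fna n\<^esub> p)"
    using hom_mult[OF gen_in_fna[OF assms(1)] fna_brackets_closed[OF p(1)]] by simp
  then show ?thesis
    using fna_mult_brackets[OF gen_in_fna[OF assms(1)] fna_brackets_closed[OF p(1)]] by simp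
qed

lemma image_brackets_closed: "c \<in> \<pi> ` fna_brackets n \<Longrightarrow> c \<in> carrier M"
  using fna_brackets_closed by auto

text \<open>By the Jacobi identity the two sides differ by a bracket of \<open>c\<close> with
  \<open>y i \<otimes> y j\<close>, and both of these are images of brackets.\<close>

lemma y_commute:
  assumes i: "i < n" and j: "j < n" and c: "c \<in> \<pi> ` fna_brackets n"
  shows "y i \<otimes> (y j \<otimes> c) = y j \<otimes> (y i \<otimes> c)"
proof -
  note cl = y_closed[OF i] y_closed[OF j] image_brackets_closed[OF c]
  have "y i \<otimes> y j = \<pi> (frag_of (Br (Gen i) (Gen j)))"
    using hom_mult[OF gen_in_fna[OF i] gen_in_fna[OF j]] by (simp add: fna_mult_frag_of)
  moreover have "frag_of (Br (Gen i) (Gen j)) \<in> fna_brackets n"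
    using i j by simp
  ultimately have "c \<otimes> (y i \<otimes> y j) = \<zero>"
    using c metabelian by auto
  then have "y i \<otimes> (y j \<otimes> c) = \<ominus> (y j \<otimes> (c \<otimes> y i))"
    using jacobi'[of "y i" "y j" c] cl add.inv_one by simp
  also have "c \<otimes> y i = \<ominus> (y i \<otimes> c)"
    using cl by (intro bracket_antisym)
  finally show ?thesis
    using cl by (simp add: r_minus)
qed

lemma adM_image_brackets: "c \<in> \<pi> ` fna_brackets n \<Longrightarrow> adM e c \<in> \<pi> ` fna_brackets n"
  unfolding adM_def by (rule foldr_funpow_invariant) (auto intro: y_image_brackets)

lemma adM_add_mvar:
  assumes "i < n" "c \<in> \<pi> ` fna_brackets n"
  shows "adM (e + mvar i) c = y i \<otimes> adM e c"
  unfolding adM_def lookup_add lookup_mvar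
  by (rule foldr_funpow_add1[where P = "\<lambda>c. c \<in> \<pi> ` fna_brackets n"])
    (use assms in \<open>auto intro: y_image_brackets y_commute\<close>)

lemma adM_0 [simp]: "adM 0 c = c"
  unfolding adM_def by (induction n) simp_all

lemma adM_add:
  assumes "c \<in> carrier M" "d \<in> carrier M"
  shows "adM e (c \<oplus> d) = adM e c \<oplus> adM e d"
proof -
  have "foldr (\<lambda>i. (\<lambda>c. y i \<otimes> c) ^^ l i) xs (c \<oplus> d) =
    foldr (\<lambda>i. (\<lambda>c. y i \<otimes> c) ^^ l i) xs c \<oplus> foldr (\<lambda>i. (\<lambda>c. y i \<otimes> c) ^^ l i) xs d"
    if "set xs \<subseteq> {..<n}" for xs l
    using that
  proof (induction xs)
    case (Cons x xs)
    let ?f = "\<lambda>c. y x \<otimes> c" and ?g = "foldr (\<lambda>i. (\<lambda>c. y i \<otimes> c) ^^ l i) xs"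
    have f: "(?f ^^ k) (u \<oplus> v) = (?f ^^ k) u \<oplus> (?f ^^ k) v \<and> (?f ^^ k) u \<in> carrier M \<and> (?f ^^ k) v \<in> carrier M"
      if "u \<in> carrier M" "v \<in> carrier M" for k u v
      using Cons.prems by (induction k) (simp_all add: that r_distr)
    have "?g u \<in> carrier M" if "u \<in> carrier M" for u
      by (rule foldr_funpow_invariant) (use that Cons.prems in auto)
    then have "(?f ^^ l x) (?g c \<oplus> ?g d) = (?f ^^ l x) (?g c) \<oplus> (?f ^^ l x) (?g d)"
      using f assms by blast
    moreover have "?g (c \<oplus> d) = ?g c \<oplus> ?g d"
      using Cons by simp
    ultimately show ?case
      by simp
  qed simp
  then show ?thesis
    unfolding adM_def by (simp add: subset_iff)
qed

lemma adM_zero [simp]: "adM e \<zero> = \<zero>"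
  using adM_add[of \<zero> \<zero> e] adM_closed[of \<zero> e] by (simp add: add.r_cancel_one')

lemma adM_minus: "c \<in> carrier M \<Longrightarrow> adM e (\<ominus> c) = \<ominus> adM e c"
  using adM_add[of "\<ominus> c" c e] adM_closed[of c e] adM_closed[of "\<ominus> c" e]
  by (intro minus_equality[symmetric]) (auto simp: l_neg)

lemma hom_ad_term:
  assumes "term_gens t \<subseteq> {..<n}"
  shows "\<pi> (frag_of (ad_term n e t)) = adM e (\<pi> (frag_of t))"
proof -
  have step: "\<pi> (frag_of (Br (Gen i) u)) = y i \<otimes> \<pi> (frag_of u)" if "i < n" "term_gens u \<subseteq> {..<n}" for i u
    using hom_mult[OF gen_in_fna[OF that(1)], of "frag_of u"] that
    by (simp add: fna_mult_frag_of) (simp add: fna_simps)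
  have "\<pi> (frag_of (foldr (\<lambda>i. Br (Gen i) ^^ l i) xs t)) =
      foldr (\<lambda>i. (\<lambda>c. y i \<otimes> c) ^^ l i) xs (\<pi> (frag_of t))
      \<and> term_gens (foldr (\<lambda>i. Br (Gen i) ^^ l i) xs t) \<subseteq> {..<n}"
    if "set xs \<subseteq> {..<n}" for xs l
    using that
  proof (induction xs)
    case (Cons x xs)
    have "\<pi> (frag_of ((Br (Gen x) ^^ k) u)) = ((\<lambda>c. y x \<otimes> c) ^^ k) (\<pi> (frag_of u))
        \<and> term_gens ((Br (Gen x) ^^ k) u) \<subseteq> {..<n}"
      if "term_gens u \<subseteq> {..<n}" for k u
      using that Cons.prems by (induction k) (auto simp: step)
    then show ?case
      using Cons by auto
  qed (use assms in simp)
  then show ?thesis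
    by (simp add: ad_term_def adM_def subset_iff)
qed

lemma hom_ad_op:
  assumes "p \<in> carrier (fna n)"
  shows "\<pi> (ad_op n e p) = adM e (\<pi> p)"
proof -
  have "keys p \<subseteq> terms n"
    using assms by (simp add: fna_simps)
  then have "p \<in> carrier (fna n) \<and> \<pi> (ad_op n e p) = adM e (\<pi> p)"
  proof (induction p rule: frag_induction)
    case (one t)
    then show ?case
      by (simp add: ad_op_def hom_ad_term) (simp add: fna_simps)
  next
    case (diff p q)
    then have "p - q \<in> carrier (fna n)"
      using keys_diff_subset unfolding fna_simps by blast
    moreover have "ad_op n e (p - q) = ad_op n e p - ad_op n e q"
      by (simp add: ad_op_def frag_extend_diff)
    ultimately show ?case
      using diff by (simp add: hom_diff ad_op_closed a_minus_def adM_add adM_minus)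
  qed (simp add: ad_op_def fna_simps)
  then show ?thesis ..
qed

lemma hom_ad_shift:
  assumes i: "i < n" and c: "keys c \<subseteq> ad_basis n"
  shows "\<pi> (ad_comb_eval n (ad_shift i c)) = y i \<otimes> \<pi> (ad_comb_eval n c)"
proof -
  have "keys c \<subseteq> ad_basis n \<and> \<pi> (ad_comb_eval n (ad_shift i c)) = y i \<otimes> \<pi> (ad_comb_eval n c)"
    using c
  proof (induction c rule: frag_induction)
    case zero
    then show ?case
      using i by (simp add: ad_comb_eval_def ad_shift_def)
  next
    case (one x)
    then obtain e a b where x: "x = (e, a, b)" "a < n" "b < n"
      by auto
    let ?t = "Br (Gen a) (Gen b)"
    have t: "term_gens ?t \<subseteq> {..<n}" "frag_of ?t \<in> fna_brackets n"
      using x by auto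
    have "\<pi> (ad_comb_eval n (ad_shift i (frag_of x))) = adM (e + mvar i) (\<pi> (frag_of ?t))"
      using x t by (simp add: ad_comb_eval_def ad_shift_def hom_ad_term)
    also have "\<dots> = y i \<otimes> adM e (\<pi> (frag_of ?t))"
      using i t by (intro adM_add_mvar) auto
    finally show ?case
      using x t one by (simp add: ad_comb_eval_def hom_ad_term)
  next
    case (diff c d)
    have shift: "ad_shift i (c - d) = ad_shift i c - ad_shift i d"
      by (simp add: ad_shift_def frag_extend_diff)
    have "ad_comb_eval n u \<in> carrier (fna n)" if "keys u \<subseteq> ad_basis n" for u
      using that ad_comb_eval_brackets fna_brackets_closed by blast
    then show ?case
      using diff i keys_ad_shift[OF i] keys_diff_subset[of c "ad_basis n" d]
      by (simp add: shift ad_comb_eval_diff hom_diff a_minus_def r_distr r_minus)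
  qed
  then show ?thesis ..
qed

text \<open>Each clause of \<open>normal_form\<close> is an identity of metabelian Lie rings:
  antisymmetry turns a generator to the left, the metabelian law kills a bracket of two brackets,
  and since adjoint operators commute their exponents are a sufficient record.\<close>

lemma hom_normal_form:
  assumes "term_gens (Br s t) \<subseteq> {..<n}"
  shows "\<pi> (frag_of (Br s t)) = \<pi> (ad_comb_eval n (normal_form (Br s t)))"
  using assms
proof (induction "Br s t" arbitrary: s t rule: normal_form.induct)
  case (2 i j)
  show ?case
    by (simp add: ad_comb_eval_def)
next
  case (3 i s t)
  have "\<pi> (frag_of (Br (Gen i) (Br s t))) = y i \<otimes> \<pi> (frag_of (Br s t))"
    using hom_mult[of "frag_of (Gen i)" "frag_of (Br s t)"] 3(2)
    by (simp add: fna_mult_frag_of) (simp add: fna_simps)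
  then show ?case
    using 3 hom_ad_shift[of i "normal_form (Br s t)"] keys_normal_form[of "Br s t" n] by simp
next
  case (4 s t i)
  have cl: "frag_of (Gen i) \<in> carrier (fna n)" "frag_of (Br s t) \<in> carrier (fna n)"
    using 4(2) by (simp_all add: fna_simps)
  have keys: "keys (normal_form (Br s t)) \<subseteq> ad_basis n" and i: "i < n"
    using 4(2) keys_normal_form[of "Br s t" n] by auto
  have "\<pi> (frag_of (Br (Br s t) (Gen i))) = \<pi> (frag_of (Br s t)) \<otimes> y i"
    using hom_mult[OF cl(2,1)] by (simp add: fna_mult_frag_of)
  also have "\<dots> = \<ominus> (y i \<otimes> \<pi> (frag_of (Br s t)))"
    using cl by (intro bracket_antisym) auto
  also have "\<dots> = \<ominus> \<pi> (ad_comb_eval n (ad_shift i (normal_form (Br s t))))"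
    using 4 hom_ad_shift[OF i keys] by simp
  also have "\<dots> = \<pi> (ad_comb_eval n (- ad_shift i (normal_form (Br s t))))"
    using ad_comb_eval_brackets[OF keys_ad_shift[OF i keys]] fna_brackets_closed
    by (simp add: ad_comb_eval_def frag_extend_minus hom_minus)
  finally show ?case by simp
next
  case (5 s t u v)
  have "frag_of (Br s t) \<in> fna_brackets n" "frag_of (Br u v) \<in> fna_brackets n"
    using 5 by auto
  then have "\<pi> (frag_of (Br s t) \<otimes>\<^bsub>fna n\<^esub> frag_of (Br u v)) = \<zero>"
    using metabelian fna_brackets_closed by (simp add: hom_mult)
  then show ?case
    by (simp add: fna_mult_frag_of ad_comb_eval_def)
qed

end

section \<open>The Koszul model of the free metabelian Lie ring\<close>

lemma fna_diff_closed:
  "p \<in> carrier (fna n) \<Longrightarrow> q \<in> carrier (fna n) \<Longrightarrow> p - q \<in> carrier (fna n)"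
  unfolding fna_simps by (rule keys_diff_subset)

lemma koszul_d1_add: "koszul_d1 n (\<lambda>i. u i + v i) = koszul_d1 n u + koszul_d1 n v"
  by (simp add: koszul_d1_def distrib_right sum.distrib)

lemma koszul_d1_diff: "koszul_d1 n (\<lambda>i. u i - v i) = koszul_d1 n u - koszul_d1 n v"
  by (simp add: koszul_d1_def left_diff_distrib sum_subtractf)

lemma koszul_d1_mult: "koszul_d1 n (\<lambda>i. p * v i) = p * koszul_d1 n v"
  by (simp add: koszul_d1_def sum_distrib_left mult.assoc)

lemma koszul_d1_0 [simp]: "koszul_d1 n (\<lambda>i. 0) = 0"
  by (simp add: koszul_d1_def)

lemma koszul_d1_unit: "k < n \<Longrightarrow> koszul_d1 n (\<lambda>i. if i = k then p else 0) = p * var k"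
  by (simp add: koszul_d1_def if_distrib[of "\<lambda>q. q * _"] cong: if_cong)

definition koszul_bracket :: "nat \<Rightarrow> (nat \<Rightarrow> ipoly) \<Rightarrow> (nat \<Rightarrow> ipoly) \<Rightarrow> (nat \<Rightarrow> ipoly)" where
  "koszul_bracket n u v = (\<lambda>i. koszul_d1 n u * v i - koszul_d1 n v * u i)"

definition koszul_lie :: "nat \<Rightarrow> (nat \<Rightarrow> ipoly) ring" where
  "koszul_lie n = \<lparr>carrier = UNIV, monoid.mult = koszul_bracket n, one = undefined,
     ring.zero = (\<lambda>i. 0), ring.add = (\<lambda>u v i. u i + v i)\<rparr>"

lemma koszul_lie_simps [simp]:
  "carrier (koszul_lie n) = UNIV" "u \<otimes>\<^bsub>koszul_lie n\<^esub> v = koszul_bracket n u v"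
  "\<zero>\<^bsub>koszul_lie n\<^esub> = (\<lambda>i. 0)" "u \<oplus>\<^bsub>koszul_lie n\<^esub> v = (\<lambda>i. u i + v i)"
  by (simp_all add: koszul_lie_def)

lemma koszul_d1_bracket [simp]: "koszul_d1 n (koszul_bracket n u v) = 0"
  by (simp add: koszul_bracket_def koszul_d1_diff koszul_d1_mult)

lemma lie_ring_koszul_lie: "lie_ring (koszul_lie n)"
proof (intro lie_ring.intro lie_ring_axioms.intro nonassoc_ring.intro nonassoc_ring_axioms.intro
    abelian_groupI)
  fix u
  show "\<exists>v\<in>carrier (koszul_lie n). v \<oplus>\<^bsub>koszul_lie n\<^esub> u = \<zero>\<^bsub>koszul_lie n\<^esub>"
    by (intro bexI[of _ "\<lambda>i. - u i"]) simp_all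
next
  fix u v w
  let ?M = "koszul_lie n"
  \<comment> \<open>The inner bracket is a cycle, so the outer one reduces to multiplication by
    \<open>koszul_d1 n u\<close>, and the cyclic sum cancels in pairs.\<close>
  have *: "u \<otimes>\<^bsub>?M\<^esub> (v \<otimes>\<^bsub>?M\<^esub> w) = (\<lambda>i. koszul_d1 n u * koszul_bracket n v w i)" for u v w
    unfolding koszul_lie_simps koszul_bracket_def[of n u] by simp
  show "u \<otimes>\<^bsub>?M\<^esub> (v \<otimes>\<^bsub>?M\<^esub> w) \<oplus>\<^bsub>?M\<^esub> v \<otimes>\<^bsub>?M\<^esub> (w \<otimes>\<^bsub>?M\<^esub> u) \<oplus>\<^bsub>?M\<^esub> w \<otimes>\<^bsub>?M\<^esub> (u \<otimes>\<^bsub>?M\<^esub> v) = \<zero>\<^bsub>?M\<^esub>"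
    unfolding * by (simp add: koszul_bracket_def algebra_simps)
qed (simp_all add: koszul_bracket_def koszul_d1_add algebra_simps)

fun koszul_term :: "nat \<Rightarrow> lie_term \<Rightarrow> nat \<Rightarrow> ipoly" where
  "koszul_term n (Gen i) = (\<lambda>j. if j = i then 1 else 0)"
| "koszul_term n (Br s t) = koszul_bracket n (koszul_term n s) (koszul_term n t)"

definition koszul_map :: "nat \<Rightarrow> (lie_term \<Rightarrow>\<^sub>0 int) \<Rightarrow> nat \<Rightarrow> ipoly" where
  "koszul_map n p = (\<lambda>j. frag_extend (\<lambda>t. koszul_term n t j) p)"

lemma koszul_map_add: "koszul_map n (p + q) = (\<lambda>j. koszul_map n p j + koszul_map n q j)"
  by (simp add: koszul_map_def frag_extend_add)

lemma koszul_map_diff: "koszul_map n (p - q) = (\<lambda>j. koszul_map n p j - koszul_map n q j)"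
  by (simp add: koszul_map_def frag_extend_diff)

lemma koszul_map_0 [simp]: "koszul_map n 0 = (\<lambda>j. 0)"
  by (simp add: koszul_map_def)

lemma koszul_map_frag_of [simp]: "koszul_map n (frag_of t) = koszul_term n t"
  by (simp add: koszul_map_def)

lemma koszul_d1_koszul_map:
  "koszul_d1 n (koszul_map n p) = frag_extend (\<lambda>t. koszul_d1 n (koszul_term n t)) p"
  by (induction p rule: frag_induction[OF subset_UNIV])
    (simp_all add: koszul_map_diff koszul_d1_diff frag_extend_diff)

lemma koszul_map_mult:
  "koszul_map n (p \<otimes>\<^bsub>fna n\<^esub> q) = koszul_bracket n (koszul_map n p) (koszul_map n q)"
proof -
  have q: "koszul_map n (frag_of s \<otimes>\<^bsub>fna n\<^esub> q) = koszul_bracket n (koszul_term n s) (koszul_map n q)" for s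
    by (induction q rule: frag_induction[OF subset_UNIV])
      (simp_all add: koszul_bracket_def fna_mult_0 fna_mult_frag_of fna_mult_diff koszul_map_diff
        koszul_d1_diff algebra_simps)
  show ?thesis
    by (induction p rule: frag_induction[OF subset_UNIV])
      (simp_all add: q, simp_all add: koszul_bracket_def fna_mult_0 fna_mult_diff koszul_map_diff
        koszul_d1_diff algebra_simps)
qed

lemma koszul_d1_brackets:
  assumes "p \<in> fna_brackets n"
  shows "koszul_d1 n (koszul_map n p) = 0"
  unfolding koszul_d1_koszul_map
  by (rule frag_extend_eq_0) (use assms in \<open>auto simp: fna_brackets_def\<close>)

interpretation koszul: metabelian_hom n "koszul_lie n" "koszul_map n" for n
proof -
  interpret lie_ring "koszul_lie n" by (rule lie_ring_koszul_lie)
  show "metabelian_hom n (koszul_lie n) (koszul_map n)"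
    by unfold_locales (simp_all add: koszul_map_add koszul_map_mult koszul_bracket_def koszul_d1_brackets)
qed

section \<open>Degrees of monomials and Koszul images of iterated brackets\<close>

lemma monom_deg_superset:
  assumes "finite U" "keys e \<subseteq> U"
  shows "monom_deg e = (\<Sum>i\<in>U. lookup e i)"
  unfolding monom_deg_def using assms
  by (intro sum.mono_neutral_left) (auto simp: in_keys_iff)

lemma monom_deg_add: "monom_deg (a + b) = monom_deg a + monom_deg b"
  using monom_deg_superset[of "keys a \<union> keys b"]
  by (simp add: keys_add_monom lookup_add sum.distrib)

lemma monom_deg_mvar [simp]: "monom_deg (mvar i) = 1"
  by (simp add: monom_deg_def lookup_mvar)

lemma monom_deg_0 [simp]: "monom_deg 0 = 0"
  by (simp add: monom_deg_def)

lemma minus_mvar_add: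
  assumes "i \<in> keys e"
  shows "e - mvar i + mvar i = e"
  using assms by (intro monom_eqI) (auto simp: lookup_add lookup_minus lookup_mvar in_keys_iff)

lemma monom_induct [consumes 1, case_names zero add]:
  assumes "keys e \<subseteq> U"
    and "P 0" and step: "\<And>e i. i \<in> U \<Longrightarrow> keys e \<subseteq> U \<Longrightarrow> P e \<Longrightarrow> P (e + mvar i)"
  shows "P e"
  using assms(1)
proof (induction "monom_deg e" arbitrary: e rule: less_induct)
  case less
  show ?case
  proof (cases "e = 0")
    case False
    then obtain i where i: "i \<in> keys e"
      by (metis all_not_in_conv keys_eq_empty)
    have "monom_deg e = monom_deg (e - mvar i) + 1"
      using monom_deg_add[of "e - mvar i" "mvar i"] minus_mvar_add[OF i] by simp
    moreover have "keys (e - mvar i) \<subseteq> U"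
      using less.prems keys_add_monom[of "e - mvar i" "mvar i"] minus_mvar_add[OF i] by simp
    ultimately have "P (e - mvar i + mvar i)"
      using less i by (intro step) auto
    then show ?thesis
      using minus_mvar_add[OF i] by simp
  qed (simp add: assms(2))
qed

text \<open>On cycles the second summand of \<open>koszul_bracket\<close> vanishes and d_1(e_i) =
  s_i, so each adjoint step multiplies by one variable.\<close>

lemma koszul_adM:
  assumes "keys e \<subseteq> {..<n}" "c \<in> koszul_map n ` fna_brackets n"
  shows "koszul.adM n e c = (\<lambda>j. frag_of e * c j)"
  using assms(1)
proof (induction rule: monom_induct)
  case zero
  show ?case by simp
next
  case (add e i)
  have i: "i < n" using add by simp
  have "koszul_d1 n (koszul.adM n e c) = 0"
    using koszul.adM_image_brackets[OF assms(2), of e] by (auto simp: koszul_d1_brackets)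
  then show ?case
    using i add koszul.adM_add_mvar[OF i assms(2)] koszul_d1_unit[OF i, of 1]
    by (simp add: koszul_bracket_def var_eq mult_single add.commute flip: mult.assoc)
qed


lemma koszul_map_ad_op:
  assumes "keys e \<subseteq> {..<n}" "q \<in> fna_brackets n"
  shows "koszul_map n (ad_op n e q) = (\<lambda>j. frag_of e * koszul_map n q j)"
  using assms koszul.hom_ad_op[of q n e] koszul_adM[of e n "koszul_map n q"] fna_brackets_closed
  by auto

lemma koszul_map_ad_term:
  assumes "keys e \<subseteq> {..<n}" "a < n" "b < n"
  shows "koszul_map n (frag_of (ad_term n e (Br (Gen a) (Gen b)))) =
    (\<lambda>j. (if j = b then frag_of (e + mvar a) else 0) - (if j = a then frag_of (e + mvar b) else 0))"
proof -
  have "koszul_map n (frag_of (Br (Gen a) (Gen b))) = (\<lambda>j. (if j = b then var a else 0) - (if j = a then var b else 0))"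
    using koszul_d1_unit[of _ n 1] assms by (auto simp: koszul_bracket_def fun_eq_iff)
  then show ?thesis
    using koszul_map_ad_op[OF assms(1), of "frag_of (Br (Gen a) (Gen b))"] assms
    by (auto simp: ad_op_def var_eq mult_single right_diff_distrib fun_eq_iff)
qed

text \<open>A section of \<open>koszul_map\<close> over the kernel of \<open>koszul_d1\<close>: the products
  \<open>s\<^bsup>f\<^esup> e\<^sub>a\<close> with \<open>min f < a\<close> are the leading terms of the elements
  \<open>s\<^bsup>e\<^esup> (s\<^sub>b e\<^sub>a - s\<^sub>a e\<^sub>b)\<close> with \<open>b < a\<close> and \<open>b \<le> min e\<close>, which form a basis of that kernel.\<close>

definition section_term :: "nat \<Rightarrow> monom \<Rightarrow> nat \<Rightarrow> (lie_term \<Rightarrow>\<^sub>0 int)" where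
  "section_term n f a =
    (if \<exists>b\<in>keys f. b < a
     then frag_of (ad_term n (f - mvar (Min (keys f)))
       (Br (Gen (Min (keys f))) (Gen a)))
     else 0)"

definition koszul_section :: "nat \<Rightarrow> (nat \<Rightarrow> ipoly) \<Rightarrow> (lie_term \<Rightarrow>\<^sub>0 int)" where
  "koszul_section n v = (\<Sum>a<n. frag_extend (\<lambda>f. section_term n f a) (v a))"

lemma section_term_eq:
  assumes "b \<in> keys f" "b < a" "\<And>c. c \<in> keys f \<Longrightarrow> b \<le> c"
  shows "section_term n f a = frag_of (ad_term n (f - mvar b) (Br (Gen b) (Gen a)))"
proof -
  have "Min (keys f) = b"
    using assms by (intro Min_eqI) auto
  then show ?thesis
    using assms by (auto simp: section_term_def)
qed

lemma section_term_eq_0: "(\<And>b. b \<in> keys f \<Longrightarrow> a \<le> b) \<Longrightarrow> section_term n f a = 0"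
  by (force simp: section_term_def)

lemma section_term_cases:
  fixes f :: monom and a :: nat
  obtains "\<And>b. b \<in> keys f \<Longrightarrow> a \<le> b"
  | b where "b \<in> keys f" "b < a" "\<And>c. c \<in> keys f \<Longrightarrow> b \<le> c"
proof (cases "\<exists>b\<in>keys f. b < a")
  case True
  then have "Min (keys f) \<in> keys f" "Min (keys f) < a"
    by (auto intro!: Min_in) (meson Min_le finite_keys le_less_trans)
  then show ?thesis
    using that(2) by (meson Min_le finite_keys)
next
  case False
  then show ?thesis
    using that(1) by (meson not_le)
qed

lemma koszul_section_diff:
  "koszul_section n (\<lambda>j. u j - v j) = koszul_section n u - koszul_section n v"
  by (simp add: koszul_section_def frag_extend_diff sum_subtractf)

lemma koszul_section_add:
  "koszul_section n (\<lambda>j. u j + v j) = koszul_section n u + koszul_section n v"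
  by (simp add: koszul_section_def frag_extend_add sum.distrib)

lemma koszul_section_0 [simp]: "koszul_section n (\<lambda>j. 0) = 0"
  by (simp add: koszul_section_def)

lemma koszul_section_unit:
  "b < n \<Longrightarrow> koszul_section n (\<lambda>j. if j = b then p else 0) = frag_extend (\<lambda>f. section_term n f b) p"
  by (simp add: koszul_section_def if_distrib[of "frag_extend _"] cong: if_cong)

lemma keys_sum_subset:
  "(\<And>k. k \<in> K \<Longrightarrow> keys (p k) \<subseteq> S) \<Longrightarrow> keys (\<Sum>k\<in>K. p k) \<subseteq> S"
  by (induction K rule: infinite_finite_induct) (simp_all add: keys_add_subset)

lemma S_ring_carrier:
  "p \<in> carrier (S_ring n) \<longleftrightarrow> keys p \<subseteq> monoms n"
  by (auto simp: S_ring_def)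

lemma free_module_carrier:
  "v \<in> carrier (free_module n k) \<longleftrightarrow> (\<forall>i<k. v i \<in> carrier (S_ring n)) \<and> (\<forall>i\<ge>k. v i = 0)"
  by (auto simp: free_module_def)

lemma section_term_brackets:
  assumes "keys f \<subseteq> {..<n}" "a < n"
  shows "section_term n f a \<in> fna_brackets n"
proof (cases rule: section_term_cases[of f a])
  case 1
  then show ?thesis by (simp add: section_term_eq_0)
next
  case (2 b)
  have "frag_of (Br (Gen b) (Gen a)) \<in> fna_brackets n"
    using 2 assms by auto
  from ad_op_brackets[OF this, of "f - mvar b"] show ?thesis
    using section_term_eq[OF 2] by (simp add: ad_op_def)
qed

lemma koszul_section_brackets:
  assumes "v \<in> carrier (free_module n n)"
  shows "koszul_section n v \<in> fna_brackets n"
proof -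
  have "frag_extend (\<lambda>f. section_term n f a) (v a) \<in> fna_brackets n" if a: "a < n" for a
  proof -
    have "keys (v a) \<subseteq> monoms n"
      using assms a by (simp add: free_module_carrier S_ring_carrier)
    then show ?thesis
      unfolding fna_brackets_def mem_Collect_eq
      by (rule keys_frag_extend_subset)
        (use section_term_brackets[OF _ a] in \<open>simp add: fna_brackets_def\<close>)
  qed
  then show ?thesis
    unfolding koszul_section_def fna_brackets_def mem_Collect_eq
    by (intro keys_sum_subset) simp
qed

section \<open>Compatibility of the section with metabelian homomorphisms\<close>

context metabelian_hom
begin

lemma adM_y:
  assumes i: "i < n" and c: "c \<in> \<pi> ` fna_brackets n"
  shows "adM e (y i \<otimes> c) = y i \<otimes> adM e c"
proof -
  have "foldr (\<lambda>k. (\<lambda>c. y k \<otimes> c) ^^ l k) xs (y i \<otimes> c) = y i \<otimes> foldr (\<lambda>k. (\<lambda>c. y k \<otimes> c) ^^ l k) xs c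
      \<and> foldr (\<lambda>k. (\<lambda>c. y k \<otimes> c) ^^ l k) xs c \<in> \<pi> ` fna_brackets n"
    if "set xs \<subseteq> {..<n}" for xs l
    using that
  proof (induction xs)
    case (Cons x xs)
    have "((\<lambda>c. y x \<otimes> c) ^^ k) (y i \<otimes> d) = y i \<otimes> ((\<lambda>c. y x \<otimes> c) ^^ k) d
        \<and> ((\<lambda>c. y x \<otimes> c) ^^ k) d \<in> \<pi> ` fna_brackets n" if d: "d \<in> \<pi> ` fna_brackets n" for k d
    proof (induction k)
      case (Suc k)
      have x: "x < n" using Cons.prems by simp
      show ?case
        using Suc y_commute[OF x i] y_image_brackets[OF x] by simp
    qed (simp add: d)
    then show ?case
      using Cons by simp
  qed (use c in simp)
  then show ?thesis
    unfolding adM_def by (simp add: subset_iff)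
qed

text \<open>The section of s^e (s_a e_b - s_b e_a), the Koszul image of the term on the right, is
  the difference on the left. Let b < a. If b is at most every index in e, one section term vanishes
  and the other is the bracket up to sign. Otherwise, with c the least index in e, both inner
  brackets contain \<open>y c\<close>, and the Jacobi identity for a, b, c moves it out. The other
  orders follow by antisymmetry.\<close>

lemma hom_section_term_exchange:
  assumes e: "keys e \<subseteq> {..<n}" and a: "a < n" and b: "b < n"
  shows "\<pi> (section_term n (e + mvar a) b - section_term n (e + mvar b) a) =
    \<pi> (frag_of (ad_term n e (Br (Gen a) (Gen b))))"
proof -
  have br: "\<pi> (frag_of (ad_term n e (Br (Gen a) (Gen b)))) = adM e (y a \<otimes> y b)"
    if "a < n" "b < n" for e a b
    using that hom_ad_term[of "Br (Gen a) (Gen b)" e] hom_mult[of "frag_of (Gen a)" "frag_of (Gen b)"]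
      gen_in_fna by (simp add: fna_mult_frag_of)
  have cl: "section_term n (e + mvar a) b \<in> carrier (fna n)" if "a < n" "b < n" for a b
    using that e by (intro fna_brackets_closed section_term_brackets) (auto simp: keys_add_monom)
  have main: "\<pi> (section_term n (e + mvar a) b - section_term n (e + mvar b) a) = adM e (y a \<otimes> y b)"
    if ba: "b < a" and a: "a < n" for a b
  proof (cases rule: section_term_cases[of e b])
    case 1
    have b: "b < n" using a ba by simp
    have "section_term n (e + mvar a) b = 0"
      using 1 ba by (intro section_term_eq_0) (auto simp: keys_add_monom)
    moreover have "section_term n (e + mvar b) a = frag_of (ad_term n (e + mvar b - mvar b) (Br (Gen b) (Gen a)))"
      using 1 ba by (intro section_term_eq) (auto simp: keys_add_monom)
    moreover have "frag_of (ad_term n e (Br (Gen b) (Gen a))) \<in> carrier (fna n)"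
      using cl[OF b a] calculation by simp
    ultimately have "\<pi> (section_term n (e + mvar a) b - section_term n (e + mvar b) a) = \<ominus> adM e (y b \<otimes> y a)"
      using a b by (simp add: hom_minus br)
    also have "\<dots> = adM e (y a \<otimes> y b)"
      using a b bracket_antisym[of "y a" "y b"] by (simp add: adM_minus)
    finally show ?thesis .
  next
    case (2 c)
    have b: "b < n" and c: "c < n" using a ba 2(2) by simp_all
    define e' where "e' = e - mvar c"
    have e': "e = e' + mvar c"
      using minus_mvar_add[OF 2(1)] by (simp add: e'_def)
    have 3: "section_term n (e + mvar a) b = frag_of (ad_term n (e + mvar a - mvar c) (Br (Gen c) (Gen b)))"
      using 2 ba by (intro section_term_eq) (auto simp: keys_add_monom)
    have 4: "section_term n (e + mvar b) a = frag_of (ad_term n (e + mvar b - mvar c) (Br (Gen c) (Gen a)))"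
      using 2 ba by (intro section_term_eq) (auto simp: keys_add_monom)
    have shift: "e + mvar k - mvar c = e' + mvar k" for k
      unfolding e' by (simp add: add.assoc add.commute[of "mvar c"]) (simp add: add.assoc[symmetric])
    have im: "y i \<otimes> y j \<in> \<pi> ` fna_brackets n" if "i < n" "j < n" for i j
      using that hom_mult[OF gen_in_fna gen_in_fna, of i j]
        fna_mult_brackets[OF gen_in_fna gen_in_fna, of i j] by (metis imageI)
    have "\<pi> (section_term n (e + mvar a) b - section_term n (e + mvar b) a) =
        adM (e' + mvar a) (y c \<otimes> y b) \<ominus> adM (e' + mvar b) (y c \<otimes> y a)"
      using hom_diff[OF cl[OF a b] cl[OF b a]] a b c by (simp only: 3 4 shift br)
    also have "\<dots> = y a \<otimes> adM e' (y c \<otimes> y b) \<ominus> y b \<otimes> adM e' (y c \<otimes> y a)"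
      using a b c im by (simp add: adM_add_mvar)
    also have "y a \<otimes> adM e' (y c \<otimes> y b) = adM e' (y a \<otimes> (y c \<otimes> y b))"
      using a b c im adM_y by simp
    also have "y b \<otimes> adM e' (y c \<otimes> y a) = adM e' (y b \<otimes> (y c \<otimes> y a))"
      using a b c im adM_y by simp
    also have "adM e' (y a \<otimes> (y c \<otimes> y b)) \<ominus> adM e' (y b \<otimes> (y c \<otimes> y a)) =
        adM e' (y a \<otimes> (y c \<otimes> y b) \<oplus> \<ominus> (y b \<otimes> (y c \<otimes> y a)))"
      using a b c by (simp add: adM_add adM_minus a_minus_def)
    also have "y a \<otimes> (y c \<otimes> y b) \<oplus> \<ominus> (y b \<otimes> (y c \<otimes> y a)) = y c \<otimes> (y a \<otimes> y b)"
      using jacobi'[of "y c" "y a" "y b"] bracket_antisym[of "y b" "y c"] a b c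
      by (simp add: r_minus a_comm)
    also have "adM e' (y c \<otimes> (y a \<otimes> y b)) = adM e (y a \<otimes> y b)"
      using a b c im adM_y by (simp add: e' adM_add_mvar)
    finally show ?thesis .
  qed
  consider "b < a" | "a < b" | "a = b" by linarith
  then show ?thesis
  proof cases
    case 1
    then show ?thesis using main a b br by simp
  next
    case 2
    have "\<pi> (section_term n (e + mvar a) b - section_term n (e + mvar b) a) =
      \<pi> (- (section_term n (e + mvar b) a - section_term n (e + mvar a) b))"
      by simp
    also have "\<dots> = \<ominus> adM e (y b \<otimes> y a)"
      using fna_diff_closed[OF cl[OF b a] cl[OF a b]] main[OF 2 b] by (simp only: hom_minus)
    also have "\<dots> = adM e (y a \<otimes> y b)"
      using a b bracket_antisym[of "y a" "y b"] by (simp add: adM_minus)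
    finally show ?thesis using br a b by simp
  next
    case 3
    then show ?thesis
      using a br[OF a a] by (simp add: bracket_self)
  qed
qed

text \<open>Replacing \<open>q\<close> by its normal form changes neither side, because
  \<open>hom_normal_form\<close> holds in the Koszul model as well as in \<open>M\<close>. On normal
  forms the claim is \<open>hom_section_term_exchange\<close>.\<close>

lemma hom_koszul_section:
  assumes "q \<in> fna_brackets n"
  shows "\<pi> (koszul_section n (koszul_map n q)) = \<pi> q"
proof -
  have eval: "\<pi> (koszul_section n (koszul_map n (ad_comb_eval n c))) = \<pi> (ad_comb_eval n c)
      \<and> koszul_section n (koszul_map n (ad_comb_eval n c)) \<in> carrier (fna n)"
    if "keys c \<subseteq> ad_basis n" for c
  proof -
    have "keys c \<subseteq> ad_basis n \<and> koszul_section n (koszul_map n (ad_comb_eval n c)) \<in> carrier (fna n)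
      \<and> \<pi> (koszul_section n (koszul_map n (ad_comb_eval n c))) = \<pi> (ad_comb_eval n c)"
      using that
    proof (induction c rule: frag_induction)
      case zero
      then show ?case by (simp add: ad_comb_eval_def fna_simps)
    next
      case (one x)
      then obtain e a b where x: "x = (e, a, b)" "keys e \<subseteq> {..<n}" "a < n" "b < n"
        by auto
      have s: "koszul_section n (koszul_map n (ad_comb_eval n (frag_of x))) =
          section_term n (e + mvar a) b - section_term n (e + mvar b) a"
        using x koszul_map_ad_term[OF x(2-4)]
        by (simp add: ad_comb_eval_def koszul_section_diff koszul_section_unit)
      have "section_term n (e + mvar a) b - section_term n (e + mvar b) a \<in> fna_brackets n"
        using x by (intro fna_brackets_diff section_term_brackets) (auto simp: keys_add_monom)
      then show ?case
        using one hom_section_term_exchange[OF x(2-4)] fna_brackets_closed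
        by (simp only: s) (simp add: x ad_comb_eval_def)
    next
      case (diff c d)
      have "ad_comb_eval n u \<in> carrier (fna n)" if "keys u \<subseteq> ad_basis n" for u
        using that ad_comb_eval_brackets fna_brackets_closed by blast
      then show ?case
        using diff keys_diff_subset[of c "ad_basis n" d]
        by (simp add: ad_comb_eval_diff hom_diff koszul_map_diff koszul_section_diff fna_diff_closed)
    qed
    then show ?thesis by blast
  qed
  have "keys q \<subseteq> bracket_terms n"
    using assms by (simp add: fna_brackets_def)
  then have "q \<in> carrier (fna n) \<and> koszul_section n (koszul_map n q) \<in> carrier (fna n)
      \<and> \<pi> (koszul_section n (koszul_map n q)) = \<pi> q"
  proof (induction q rule: frag_induction)
    case zero
    then show ?case by (simp add: fna_simps)
  next
    case (one u)
    then obtain s t where u: "u = Br s t" "term_gens (Br s t) \<subseteq> {..<n}"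
      by auto
    have "koszul_map n (frag_of u) = koszul_map n (ad_comb_eval n (normal_form u))"
      "\<pi> (frag_of u) = \<pi> (ad_comb_eval n (normal_form u))"
      using u koszul.hom_normal_form hom_normal_form by blast+
    moreover have "frag_of u \<in> carrier (fna n)"
      using u by (simp add: fna_simps)
    ultimately show ?case
      using eval[OF keys_normal_form[of u n]] u by simp
  next
    case (diff p q)
    then have "p - q \<in> carrier (fna n)"
      "koszul_section n (koszul_map n p) - koszul_section n (koszul_map n q) \<in> carrier (fna n)"
      by (simp_all add: fna_diff_closed)
    then show ?case
      using diff by (simp add: koszul_map_diff koszul_section_diff hom_diff)
  qed
  then show ?thesis by blast
qed

end

section \<open>Exactness of the Koszul complex in degree one\<close>

lemma S_ring_simps:
  "p \<oplus>\<^bsub>S_ring n\<^esub> q = p + q" "p \<otimes>\<^bsub>S_ring n\<^esub> q = p * q" "\<zero>\<^bsub>S_ring n\<^esub> = 0" "\<one>\<^bsub>S_ring n\<^esub> = 1"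
  by (simp_all add: S_ring_def)

lemma S_ring_add: "p \<in> carrier (S_ring n) \<Longrightarrow> q \<in> carrier (S_ring n) \<Longrightarrow> p + q \<in> carrier (S_ring n)"
  unfolding S_ring_carrier by (rule keys_add_subset)

lemma S_ring_diff: "p \<in> carrier (S_ring n) \<Longrightarrow> q \<in> carrier (S_ring n) \<Longrightarrow> p - q \<in> carrier (S_ring n)"
  unfolding S_ring_carrier by (rule keys_diff_subset)

lemma S_ring_uminus: "p \<in> carrier (S_ring n) \<Longrightarrow> - p \<in> carrier (S_ring n)"
  by (simp add: S_ring_carrier)

lemma S_ring_0 [simp]: "0 \<in> carrier (S_ring n)"
  by (simp add: S_ring_carrier)

lemma S_ring_frag_of [simp]: "frag_of e \<in> carrier (S_ring n) \<longleftrightarrow> keys e \<subseteq> {..<n}"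
  by (simp add: S_ring_carrier)

lemma S_ring_1 [simp]: "1 \<in> carrier (S_ring n)"
  using S_ring_frag_of[of 0 n] by simp

lemma S_ring_mult:
  assumes "p \<in> carrier (S_ring n)" "q \<in> carrier (S_ring n)"
  shows "p * q \<in> carrier (S_ring n)"
proof -
  have "keys (p * q) \<subseteq> {a + b |a b. a \<in> keys p \<and> b \<in> keys q}"
    by (rule keys_mult)
  also have "\<dots> \<subseteq> monoms n"
    using assms unfolding S_ring_carrier by (clarsimp simp: keys_add_monom) blast
  finally show ?thesis
    unfolding S_ring_carrier .
qed

lemma S_ring_sum:
  "(\<And>k. k \<in> K \<Longrightarrow> p k \<in> carrier (S_ring n)) \<Longrightarrow> (\<Sum>k\<in>K. p k) \<in> carrier (S_ring n)"
  unfolding S_ring_carrier by (rule keys_sum_subset)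

lemma S_ring_var: "i < n \<Longrightarrow> var i \<in> carrier (S_ring n)"
  by (simp add: var_eq)

lemma cring_S_ring: "cring (S_ring n)"
proof (intro cringI abelian_groupI comm_monoidI)
  fix p assume "p \<in> carrier (S_ring n)"
  then show "\<exists>q\<in>carrier (S_ring n). q \<oplus>\<^bsub>S_ring n\<^esub> p = \<zero>\<^bsub>S_ring n\<^esub>"
    by (intro bexI[of _ "- p"]) (simp_all add: S_ring_simps S_ring_uminus)
qed (simp_all add: S_ring_simps S_ring_add S_ring_mult algebra_simps)

lemma koszul_d1_closed: "v \<in> carrier (free_module n n) \<Longrightarrow> koszul_d1 n v \<in> carrier (S_ring n)"
  unfolding koszul_d1_def free_module_carrier
  by (intro S_ring_sum S_ring_mult S_ring_var) auto

lemma koszul_term_closed: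
  "term_gens t \<subseteq> {..<n} \<Longrightarrow> koszul_term n t \<in> carrier (free_module n n)"
proof (induction t)
  case (Br s t)
  then show ?case
    using koszul_d1_closed[of "koszul_term n s" n] koszul_d1_closed[of "koszul_term n t" n]
    by (auto simp: free_module_carrier koszul_bracket_def intro!: S_ring_diff S_ring_mult)
qed (auto simp: free_module_carrier)

lemma koszul_map_closed:
  assumes "p \<in> carrier (fna n)"
  shows "koszul_map n p \<in> carrier (free_module n n)"
proof -
  have keys: "keys p \<subseteq> terms n"
    using assms by (simp add: fna_simps)
  have "koszul_map n p i \<in> carrier (S_ring n)" if "i < n" for i
    unfolding koszul_map_def S_ring_carrier
    by (rule keys_frag_extend_subset[OF keys])
      (use koszul_term_closed that in \<open>auto simp: free_module_carrier S_ring_carrier\<close>)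
  moreover have "koszul_map n p i = 0" if "i \<ge> n" for i
    unfolding koszul_map_def
    by (rule frag_extend_eq_0) (use koszul_term_closed that keys in \<open>auto simp: free_module_carrier\<close>)
  ultimately show ?thesis
    by (simp add: free_module_carrier)
qed

lemma lookup_mult_var:
  "lookup (p * var i) f =
    (if i \<in> keys f then lookup p (f - mvar i) else 0)"
proof (induction p rule: frag_induction[OF subset_UNIV])
  case (2 g)
  have "f = g + mvar i \<longleftrightarrow> i \<in> keys f \<and> f - mvar i = g"
    using minus_mvar_add[of i f] by (auto simp: keys_add_monom)
  then show ?case
    by (auto simp: var_eq mult_single)
next
  case (3 p q)
  then show ?case by (simp add: left_diff_distrib lookup_minus)
qed simp

text \<open>The products \<open>s\<^bsup>f\<^esup> e\<^sub>a\<close> with \<open>a \<le> min f\<close>; they are not leading terms, and \<open>koszul_d1\<close> is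
  injective on their span because \<open>a\<close> can be recovered as the least variable of \<open>s\<^sub>a s\<^bsup>f\<^esup>\<close>.\<close>

definition nonleading :: "(nat \<Rightarrow> ipoly) \<Rightarrow> bool" where
  "nonleading w \<longleftrightarrow> (\<forall>a. keys (w a) \<subseteq> {e. keys e \<subseteq> {a..}})"

lemma nonleading_add: "nonleading u \<Longrightarrow> nonleading v \<Longrightarrow> nonleading (\<lambda>j. u j + v j)"
  by (simp add: nonleading_def keys_add_subset)

lemma nonleading_diff: "nonleading u \<Longrightarrow> nonleading v \<Longrightarrow> nonleading (\<lambda>j. u j - v j)"
  by (simp add: nonleading_def keys_diff_subset)

lemma nonleading_eq_0:
  assumes w: "nonleading w" and d1: "koszul_d1 n w = 0" and out: "\<And>a. a \<ge> n \<Longrightarrow> w a = 0"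
  shows "w a = 0"
proof (rule ccontr)
  assume "w a \<noteq> 0"
  then obtain e where e: "e \<in> keys (w a)"
    by (metis all_not_in_conv keys_eq_empty)
  have a: "a < n"
    using out \<open>w a \<noteq> 0\<close> by (meson not_le)
  \<comment> \<open>A contribution from position i would need i in e, hence a < i; but then the
    cofactor still contains a, which is too small for position i.\<close>
  have "lookup (w i * var i) (e + mvar a) = 0" if "i \<noteq> a" for i
  proof (cases "i \<in> keys e")
    case True
    then have "a < i"
      using w e that by (fastforce simp: nonleading_def)
    moreover have "a \<in> keys (e + mvar a - mvar i)"
      using that by (simp add: in_keys_iff lookup_minus lookup_add lookup_mvar)
    ultimately have "e + mvar a - mvar i \<notin> keys (w i)"
      using w unfolding nonleading_def by fastforce
    then show ?thesis
      by (simp add: lookup_mult_var in_keys_iff)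
  next
    case False
    then show ?thesis
      using that by (simp add: lookup_mult_var keys_add_monom)
  qed
  then have "lookup (koszul_d1 n w) (e + mvar a) = lookup (w a * var a) (e + mvar a)"
    using a by (simp add: koszul_d1_def sum.remove[of _ a] lookup_add lookup_sum)
  also have "\<dots> = lookup (w a) e"
    by (simp add: lookup_mult_var keys_add_monom)
  finally show False
    using d1 e by (simp add: in_keys_iff)
qed

text \<open>One reduction step suffices. Removing a leading s^f e_a with b = min f < a leaves s^f
  e_b with one factor s_b replaced by s_a, and every variable in it is at least b. Linearity does
  the rest.\<close>

lemma nonleading_residue:
  assumes v: "v \<in> carrier (free_module n n)"
  shows "nonleading (\<lambda>j. v j - koszul_map n (koszul_section n v) j)"
proof -
  define res where "res v = (\<lambda>j. v j - koszul_map n (koszul_section n v) j)" for v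
  have res_diff: "res (\<lambda>j. u j - v j) = (\<lambda>j. res u j - res v j)"
    and res_add: "res (\<lambda>j. u j + v j) = (\<lambda>j. res u j + res v j)" for u v
    by (simp_all add: res_def koszul_section_diff koszul_map_diff koszul_section_add koszul_map_add
        fun_eq_iff)
  have monom: "nonleading (res (\<lambda>j. if j = a then frag_of f else 0))"
    if f: "keys f \<subseteq> {..<n}" and a: "a < n" for f a
  proof (cases rule: section_term_cases[of f a])
    case 1
    then have "koszul_section n (\<lambda>j. if j = a then frag_of f else 0) = 0"
      using a by (simp add: koszul_section_unit section_term_eq_0)
    then show ?thesis
      using 1 by (auto simp: res_def nonleading_def)
  next
    case (2 b)
    have b: "b < n" using 2 a by simp
    have e: "keys (f - mvar b) \<subseteq> keys f" "f - mvar b + mvar b = f"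
      using minus_mvar_add[OF 2(1)] keys_add_monom[of "f - mvar b" "mvar b"] by auto
    have "koszul_map n (koszul_section n (\<lambda>j. if j = a then frag_of f else 0)) =
        (\<lambda>j. (if j = a then frag_of f else 0) - (if j = b then frag_of (f - mvar b + mvar a) else 0))"
      using a b f e(1) koszul_map_ad_term[of "f - mvar b" n b a, unfolded e(2)]
      by (simp add: koszul_section_unit section_term_eq[OF 2])
    then have "res (\<lambda>j. if j = a then frag_of f else 0) = (\<lambda>j. if j = b then frag_of (f - mvar b + mvar a) else 0)"
      by (simp add: res_def fun_eq_iff)
    then show ?thesis
      using 2 e by (auto simp: nonleading_def keys_add_monom)
  qed
  have poly: "nonleading (res (\<lambda>j. if j = a then p else 0))"
    if p: "p \<in> carrier (S_ring n)" and a: "a < n" for p a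
    using p unfolding S_ring_carrier
  proof (induction p rule: frag_induction)
    case zero
    show ?case by (simp add: res_def nonleading_def)
  next
    case (one f)
    then show ?case using monom a by simp
  next
    case (diff p q)
    have "(\<lambda>j. if j = a then p - q else 0) =
      (\<lambda>j. (if j = a then p else 0) - (if j = a then q else 0))"
      by auto
    then show ?case
      using diff by (simp only: res_diff nonleading_diff)
  qed
  have "nonleading (res (\<lambda>j. if j < N then v j else 0))" if "N \<le> n" for N
    using that
  proof (induction N)
    case (Suc N)
    have "(\<lambda>j. if j < Suc N then v j else 0) =
      (\<lambda>j. (if j < N then v j else 0) + (if j = N then v N else 0))"
      by (auto simp: less_Suc_eq)
    moreover have "nonleading (res (\<lambda>j. if j = N then v N else 0))"
      using Suc.prems v by (intro poly) (auto simp: free_module_carrier)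
    ultimately show ?case
      using Suc by (simp only: res_add nonleading_add Suc_leD)
  qed (simp add: res_def nonleading_def)
  from this[of n] have "nonleading (res (\<lambda>j. if j < n then v j else 0))"
    by simp
  moreover have "(\<lambda>j. if j < n then v j else 0) = v"
    using v by (auto simp: free_module_carrier)
  ultimately show ?thesis
    by (simp only: res_def)
qed

text \<open>The difference of the two sides is a nonleading cycle, hence 0. Since brackets map to
  Koszul boundaries, this is exactness at d_1 with an explicit preimage.\<close>

theorem koszul_map_section:
  assumes v: "v \<in> carrier (free_module n n)" and d1: "koszul_d1 n v = 0"
  shows "koszul_map n (koszul_section n v) = v"
proof -
  let ?w = "\<lambda>j. v j - koszul_map n (koszul_section n v) j"
  have sec: "koszul_section n v \<in> fna_brackets n"
    by (rule koszul_section_brackets[OF v])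
  have "koszul_map n (koszul_section n v) \<in> carrier (free_module n n)"
    by (intro koszul_map_closed fna_brackets_closed sec)
  then have out: "?w a = 0" if "a \<ge> n" for a
    using that v by (simp add: free_module_carrier)
  have "koszul_d1 n ?w = 0"
    using d1 koszul_d1_brackets[OF sec] by (simp add: koszul_d1_diff)
  from nonleading_eq_0[OF nonleading_residue[OF v] this out] have "?w a = 0" for a .
  then show ?thesis
    by (simp add: fun_eq_iff)
qed

section \<open>Graded quotients of the module of Koszul cycles\<close>

definition koszul_kernel :: "nat \<Rightarrow> (nat \<Rightarrow> ipoly) set" where
  "koszul_kernel n = {v \<in> carrier (free_module n n). koszul_d1 n v = 0}"

lemma koszul_kernel_0: "(\<lambda>i. 0) \<in> koszul_kernel n"
  by (simp add: koszul_kernel_def free_module_carrier)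

lemma koszul_kernel_add: "u \<in> koszul_kernel n \<Longrightarrow> v \<in> koszul_kernel n \<Longrightarrow> (\<lambda>i. u i + v i) \<in> koszul_kernel n"
  by (simp add: koszul_kernel_def free_module_carrier koszul_d1_add S_ring_add)

lemma koszul_kernel_diff: "u \<in> koszul_kernel n \<Longrightarrow> v \<in> koszul_kernel n \<Longrightarrow> (\<lambda>i. u i - v i) \<in> koszul_kernel n"
  by (simp add: koszul_kernel_def free_module_carrier koszul_d1_diff S_ring_diff)

lemma koszul_kernel_mult:
  "p \<in> carrier (S_ring n) \<Longrightarrow> v \<in> koszul_kernel n \<Longrightarrow> (\<lambda>i. p * v i) \<in> koszul_kernel n"
  by (simp add: koszul_kernel_def free_module_carrier koszul_d1_mult S_ring_mult)

lemma koszul_kernel_sum: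
  "(\<And>d. d \<in> D \<Longrightarrow> u d \<in> koszul_kernel n) \<Longrightarrow> (\<lambda>i. \<Sum>d\<in>D. u d i) \<in> koszul_kernel n"
  by (induction D rule: infinite_finite_induct) (simp_all add: koszul_kernel_0 koszul_kernel_add)

definition filter_frag :: "('a \<Rightarrow> bool) \<Rightarrow> ('a \<Rightarrow>\<^sub>0 int) \<Rightarrow> ('a \<Rightarrow>\<^sub>0 int)" where
  "filter_frag P = frag_extend (\<lambda>e. if P e then frag_of e else 0)"

lemma lookup_filter_frag:
  "lookup (filter_frag P p) e = (if P e then lookup p e else 0)"
  by (induction p rule: frag_induction[OF subset_UNIV])
    (auto simp: filter_frag_def frag_extend_diff lookup_minus)

lemma keys_filter_frag: "keys (filter_frag P p) = {e \<in> keys p. P e}"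
  by (auto simp: in_keys_iff lookup_filter_frag split: if_splits)

lemma filter_frag_0 [simp]: "filter_frag P 0 = 0"
  by (simp add: filter_frag_def)

lemma filter_frag_diff: "filter_frag P (p - q) = filter_frag P p - filter_frag P q"
  by (simp add: filter_frag_def frag_extend_diff)

lemma filter_frag_sum: "filter_frag P (\<Sum>k\<in>K. p k) = (\<Sum>k\<in>K. filter_frag P (p k))"
  by (induction K rule: infinite_finite_induct) (simp_all add: filter_frag_def frag_extend_add)

lemma filter_frag_eq: "(\<And>e. e \<in> keys p \<Longrightarrow> P e) \<Longrightarrow> filter_frag P p = p"
  by (rule poly_mapping_eqI) (auto simp: lookup_filter_frag in_keys_iff)

lemma filter_frag_eq_0: "(\<And>e. e \<in> keys p \<Longrightarrow> \<not> P e) \<Longrightarrow> filter_frag P p = 0"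
  by (rule poly_mapping_eqI) (auto simp: lookup_filter_frag in_keys_iff)

lemma filter_frag_mult_var: "filter_frag P (p * var i) = filter_frag (\<lambda>e. P (e + mvar i)) p * var i"
  by (rule poly_mapping_eqI) (auto simp: lookup_filter_frag lookup_mult_var minus_mvar_add)

text \<open>The shift by 1 is the degree of the basis vectors.\<close>

definition vec_part :: "nat \<Rightarrow> (nat \<Rightarrow> ipoly) \<Rightarrow> (nat \<Rightarrow> ipoly)" where
  "vec_part d v = (\<lambda>i. filter_frag (\<lambda>e. monom_deg e + 1 = d) (v i))"

lemma vec_part_kernel:
  assumes "v \<in> koszul_kernel n"
  shows "vec_part d v \<in> koszul_kernel n"
proof -
  \<comment> \<open>The variable gained under d_1 makes up for the lost basis vector of degree 1, so
    d_1 preserves degrees and commutes with taking parts.\<close>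
  have "koszul_d1 n (vec_part d v) = filter_frag (\<lambda>e. monom_deg e = d) (koszul_d1 n v)"
    by (simp add: koszul_d1_def vec_part_def filter_frag_sum filter_frag_mult_var monom_deg_add)
  then show ?thesis
    using assms by (auto simp: koszul_kernel_def free_module_carrier vec_part_def S_ring_carrier
        keys_filter_frag)
qed

lemma vec_part_deg:
  assumes "v \<in> koszul_kernel n"
  shows "vec_part d v \<in> free_module_deg n d"
  using vec_part_kernel[OF assms, of d]
  by (auto simp: koszul_kernel_def free_module_deg_def) (simp add: vec_part_def keys_filter_frag)

lemma vec_part_of_deg:
  assumes "v \<in> free_module_deg n d"
  shows "vec_part d' v = (if d' = d then v else (\<lambda>i. 0))"
  using assms
  by (auto simp: free_module_deg_def vec_part_def fun_eq_iff intro!: filter_frag_eq filter_frag_eq_0)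

lemma vec_part_diff: "vec_part d (\<lambda>i. u i - v i) = (\<lambda>i. vec_part d u i - vec_part d v i)"
  by (simp add: vec_part_def filter_frag_diff)

lemma vec_part_sum: "vec_part d (\<lambda>i. \<Sum>k\<in>K. u k i) = (\<lambda>i. \<Sum>k\<in>K. vec_part d (u k) i)"
  by (simp add: vec_part_def filter_frag_sum)

lemma sum_vec_part:
  assumes "v \<in> carrier (free_module n n)"
  obtains D where "finite D" "\<And>d. d \<notin> D \<Longrightarrow> vec_part d v = (\<lambda>i. 0)"
    "v = (\<lambda>i. \<Sum>d\<in>D. vec_part d v i)"
proof
  let ?D = "(\<Union>i<n. (\<lambda>e. monom_deg e + 1) ` keys (v i))"
  show fin: "finite ?D" by simp
  have D: "monom_deg e + 1 \<in> ?D" if "e \<in> keys (v i)" for e i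
  proof -
    have "i < n"
      using assms that by (cases "i < n") (auto simp: free_module_carrier)
    then show ?thesis using that by blast
  qed
  show "vec_part d v = (\<lambda>i. 0)" if "d \<notin> ?D" for d
    unfolding vec_part_def by (rule ext, rule filter_frag_eq_0) (use D that in blast)
  show "v = (\<lambda>i. \<Sum>d\<in>?D. vec_part d v i)"
  proof (rule ext, rule poly_mapping_eqI)
    fix i e
    have "lookup (\<Sum>d\<in>?D. vec_part d v i) e =
        (\<Sum>d\<in>?D. if monom_deg e + 1 = d then lookup (v i) e else 0)"
      by (simp add: lookup_sum vec_part_def lookup_filter_frag)
    also have "\<dots> = (if monom_deg e + 1 \<in> ?D then lookup (v i) e else 0)"
      by (rule sum.delta'[OF fin])
    also have "\<dots> = lookup (v i) e"
      using D[of e i] by (auto simp: in_keys_iff)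
    finally show "lookup (v i) e = lookup (\<Sum>d\<in>?D. vec_part d v i) e"
      by simp
  qed
qed

section \<open>Graded modules presented as quotients of the Koszul cycles\<close>

locale homogeneous_relations =
  fixes n :: nat and Q :: "(nat \<Rightarrow> ipoly) set"
  assumes Q_kernel: "Q \<subseteq> koszul_kernel n"
    and Q_0: "(\<lambda>i. 0) \<in> Q"
    and Q_diff: "u \<in> Q \<Longrightarrow> v \<in> Q \<Longrightarrow> (\<lambda>i. u i - v i) \<in> Q"
    and Q_mult: "p \<in> carrier (S_ring n) \<Longrightarrow> v \<in> Q \<Longrightarrow> (\<lambda>i. p * v i) \<in> Q"
    and Q_part: "v \<in> Q \<Longrightarrow> vec_part d v \<in> Q"

text \<open>Identifies \<open>N\<close> with cycles modulo \<open>Q\<close>. The module and grading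
  laws of \<open>N\<close> are consequences, transported along \<open>f\<close>, so only these five
  conditions have to be verified for each invariant.\<close>

locale kernel_presentation = homogeneous_relations +
  fixes N :: "(ipoly, 'b) module" (structure) and f :: "(nat \<Rightarrow> ipoly) \<Rightarrow> 'b" and N_deg :: "nat \<Rightarrow> 'b set"
  assumes surj: "carrier N = f ` koszul_kernel n"
    and f_add: "u \<in> koszul_kernel n \<Longrightarrow> v \<in> koszul_kernel n \<Longrightarrow> f (\<lambda>i. u i + v i) = f u \<oplus> f v"
    and f_smult: "p \<in> carrier (S_ring n) \<Longrightarrow> v \<in> koszul_kernel n \<Longrightarrow> f (\<lambda>i. p * v i) = p \<odot> f v"
    and f_eq_0: "v \<in> koszul_kernel n \<Longrightarrow> f v = \<zero> \<longleftrightarrow> v \<in> Q"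
    and deg: "N_deg d = f ` (koszul_kernel n \<inter> free_module_deg n d)"
begin

lemma f_closed: "v \<in> koszul_kernel n \<Longrightarrow> f v \<in> carrier N"
  using surj by blast

lemma f_0: "f (\<lambda>i. 0) = \<zero>"
  using f_eq_0[OF koszul_kernel_0] Q_0 by simp

lemma abelian_group_N: "abelian_group N"
proof (rule abelian_groupI)
  fix x z w assume "x \<in> carrier N" "z \<in> carrier N" "w \<in> carrier N"
  then obtain u v t where "u \<in> koszul_kernel n" "v \<in> koszul_kernel n" "t \<in> koszul_kernel n"
      and "x = f u" "z = f v" "w = f t"
    unfolding surj by blast
  then show "x \<oplus> z \<oplus> w = x \<oplus> (z \<oplus> w)"
    by (simp add: f_add[symmetric] koszul_kernel_add add.assoc)
next
  fix x z assume "x \<in> carrier N" "z \<in> carrier N"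
  then obtain u v where uv: "u \<in> koszul_kernel n" "v \<in> koszul_kernel n" "x = f u" "z = f v"
    unfolding surj by blast
  then show "x \<oplus> z \<in> carrier N"
    by (simp add: f_add[symmetric] koszul_kernel_add f_closed)
  show "x \<oplus> z = z \<oplus> x"
    using uv by (simp add: f_add[symmetric] add.commute)
next
  show "\<zero> \<in> carrier N"
    using f_0 f_closed[OF koszul_kernel_0] by simp
next
  fix x assume "x \<in> carrier N"
  then obtain u where u: "u \<in> koszul_kernel n" "x = f u"
    unfolding surj by blast
  then show "\<zero> \<oplus> x = x"
    using f_add[OF koszul_kernel_0 u(1), symmetric] by (simp add: f_0)
  have "(\<lambda>i. 0 - u i) \<in> koszul_kernel n"
    by (intro koszul_kernel_diff koszul_kernel_0 u)
  then have "f (\<lambda>i. 0 - u i) \<in> carrier N" "f (\<lambda>i. 0 - u i) \<oplus> x = \<zero>"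
    using f_add[of "\<lambda>i. 0 - u i" u, symmetric] u by (simp_all add: f_0 f_closed)
  then show "\<exists>z\<in>carrier N. z \<oplus> x = \<zero>"
    by blast
qed

sublocale N: abelian_group N
  by (rule abelian_group_N)

lemma f_diff:
  assumes "u \<in> koszul_kernel n" "v \<in> koszul_kernel n"
  shows "f (\<lambda>i. u i - v i) = f u \<ominus> f v"
proof -
  have "f u = f (\<lambda>i. u i - v i) \<oplus> f v"
    using f_add[OF koszul_kernel_diff[OF assms] assms(2)] by simp
  then show ?thesis
    using f_closed[OF koszul_kernel_diff[OF assms]] f_closed[OF assms(2)]
    by (simp add: a_minus_def N.a_assoc N.r_neg)
qed

lemma f_eq_iff:
  assumes "u \<in> koszul_kernel n" "v \<in> koszul_kernel n"
  shows "f u = f v \<longleftrightarrow> (\<lambda>i. u i - v i) \<in> Q"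
proof -
  have cl: "f u \<in> carrier N" "f v \<in> carrier N"
    using assms by (auto intro: f_closed)
  then have "f u = (f u \<ominus> f v) \<oplus> f v"
    by (simp add: a_minus_def N.a_assoc N.l_neg)
  then have "f u = f v \<longleftrightarrow> f u \<ominus> f v = \<zero>"
    using cl by (metis N.l_zero N.r_neg a_minus_def)
  then show ?thesis
    using f_eq_0[OF koszul_kernel_diff[OF assms]] by (simp add: f_diff[OF assms])
qed

lemma module_N: "module (S_ring n) N"
proof (rule moduleI[OF cring_S_ring abelian_group_N])
  fix p x assume p: "p \<in> carrier (S_ring n)" and "x \<in> carrier N"
  then obtain u where u: "u \<in> koszul_kernel n" "x = f u"
    unfolding surj by blast
  then show "p \<odot> x \<in> carrier N"
    using p by (simp add: f_smult[symmetric] f_closed koszul_kernel_mult)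
next
  fix p q x assume pq: "p \<in> carrier (S_ring n)" "q \<in> carrier (S_ring n)" and "x \<in> carrier N"
  then obtain u where u: "u \<in> koszul_kernel n" "x = f u"
    unfolding surj by blast
  show "(p \<oplus>\<^bsub>S_ring n\<^esub> q) \<odot> x = p \<odot> x \<oplus> q \<odot> x"
    using pq u f_add[of "\<lambda>i. p * u i" "\<lambda>i. q * u i"] f_smult[of "p + q" u]
    by (simp add: S_ring_simps S_ring_add f_smult koszul_kernel_mult distrib_right)
  show "(p \<otimes>\<^bsub>S_ring n\<^esub> q) \<odot> x = p \<odot> (q \<odot> x)"
    using pq u f_smult[of p "\<lambda>i. q * u i"] f_smult[of "p * q" u]
    by (simp add: S_ring_simps S_ring_mult f_smult koszul_kernel_mult mult.assoc)
next
  fix p x z assume p: "p \<in> carrier (S_ring n)" and "x \<in> carrier N" "z \<in> carrier N"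
  then obtain u v where "u \<in> koszul_kernel n" "x = f u" "v \<in> koszul_kernel n" "z = f v"
    unfolding surj by blast
  then show "p \<odot> (x \<oplus> z) = p \<odot> x \<oplus> p \<odot> z"
    using p f_add[of "\<lambda>i. p * u i" "\<lambda>i. p * v i"] f_smult[of p "\<lambda>i. u i + v i"]
    by (simp add: f_smult f_add koszul_kernel_mult koszul_kernel_add distrib_left)
next
  fix x assume "x \<in> carrier N"
  then obtain u where "u \<in> koszul_kernel n" "x = f u"
    unfolding surj by blast
  then show "\<one>\<^bsub>S_ring n\<^esub> \<odot> x = x"
    using f_smult[of 1 u] by (simp add: S_ring_simps)
qed

lemma finsum_f:
  assumes "finite D" "\<And>d. d \<in> D \<Longrightarrow> u d \<in> koszul_kernel n"
  shows "(\<Oplus>d\<in>D. f (u d)) = f (\<lambda>i. \<Sum>d\<in>D. u d i)"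
  using assms
  by (induction D rule: finite_induct) (simp_all add: f_0 f_add f_closed koszul_kernel_sum Pi_def)

lemma N_deg_subgroup: "additive_subgroup (N_deg d) N"
proof (intro additive_subgroupI N.add.subgroupI)
  have zero: "(\<lambda>i. 0) \<in> koszul_kernel n \<inter> free_module_deg n d"
    by (auto simp: koszul_kernel_0 free_module_deg_def free_module_carrier)
  then show "N_deg d \<noteq> {}"
    unfolding deg by blast
  show "N_deg d \<subseteq> carrier N"
    unfolding deg surj by blast
  have diff: "(\<lambda>i. u i - v i) \<in> koszul_kernel n \<inter> free_module_deg n d"
    if "u \<in> koszul_kernel n \<inter> free_module_deg n d" "v \<in> koszul_kernel n \<inter> free_module_deg n d" for u v
    using that koszul_kernel_diff[of u n v]
    by (auto simp: free_module_deg_def koszul_kernel_def dest!: keys_diff[THEN subsetD])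
  show "\<ominus> x \<in> N_deg d" if "x \<in> N_deg d" for x
  proof -
    obtain u where u: "u \<in> koszul_kernel n \<inter> free_module_deg n d" "x = f u"
      using \<open>x \<in> N_deg d\<close> unfolding deg by blast
    have "\<ominus> x = f (\<lambda>i. 0 - u i)"
      using f_diff[OF koszul_kernel_0, of u] u f_closed[of u] by (simp add: f_0 a_minus_def)
    then show ?thesis
      using diff[OF zero u(1)] unfolding deg by blast
  qed
  show "x \<oplus> z \<in> N_deg d" if "x \<in> N_deg d" "z \<in> N_deg d" for x z
  proof -
    obtain u v where uv: "u \<in> koszul_kernel n \<inter> free_module_deg n d" "x = f u"
      "v \<in> koszul_kernel n \<inter> free_module_deg n d" "z = f v"
      using \<open>x \<in> N_deg d\<close> \<open>z \<in> N_deg d\<close> unfolding deg by blast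
    have "(\<lambda>i. u i - (0 - v i)) \<in> koszul_kernel n \<inter> free_module_deg n d"
      using diff[OF uv(1) diff[OF zero uv(3)]] .
    moreover have "x \<oplus> z = f (\<lambda>i. u i - (0 - v i))"
      using uv f_add[of u v] by simp
    ultimately show ?thesis
      unfolding deg by blast
  qed
qed

lemma smult_N_deg:
  assumes "p \<in> S_deg n a" "x \<in> N_deg b"
  shows "p \<odot> x \<in> N_deg (a + b)"
proof -
  obtain u where u: "u \<in> koszul_kernel n" "u \<in> free_module_deg n b" "x = f u"
    using assms(2) unfolding deg by blast
  have p: "p \<in> carrier (S_ring n)" "\<And>e. e \<in> keys p \<Longrightarrow> monom_deg e = a"
    using assms(1) by (auto simp: S_deg_def)
  have "monom_deg e + 1 = a + b" if "e \<in> keys (p * u i)" for e i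
  proof -
    obtain e1 e2 where "e = e1 + e2" "e1 \<in> keys p" "e2 \<in> keys (u i)"
      using \<open>e \<in> keys (p * u i)\<close> keys_mult[of p "u i"] by blast
    then show ?thesis
      using p(2) u(2) by (force simp: free_module_deg_def monom_deg_add)
  qed
  then have "(\<lambda>i. p * u i) \<in> koszul_kernel n \<inter> free_module_deg n (a + b)"
    using koszul_kernel_mult[OF p(1) u(1)] by (auto simp: free_module_deg_def koszul_kernel_def)
  then show ?thesis
    using f_smult[OF p(1) u(1)] u(3) unfolding deg by (metis imageI)
qed

lemma unique_decomposition:
  assumes "x \<in> carrier N"
  shows "\<exists>!g. (\<forall>d. g d \<in> N_deg d) \<and> finite {d. g d \<noteq> \<zero>} \<and> x = (\<Oplus>d\<in>{d. g d \<noteq> \<zero>}. g d)"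
proof -
  obtain v where v: "v \<in> koszul_kernel n" "x = f v"
    using assms unfolding surj by blast
  obtain D where D: "finite D" "\<And>d. d \<notin> D \<Longrightarrow> vec_part d v = (\<lambda>i. 0)"
      "v = (\<lambda>i. \<Sum>d\<in>D. vec_part d v i)"
    using v(1) sum_vec_part[of v n] unfolding koszul_kernel_def by blast
  let ?g = "\<lambda>d. f (vec_part d v)"
  \<comment> \<open>\<open>D\<close> may contain degrees in which the part of \<open>v\<close> is a
    nonzero cycle lying in \<open>Q\<close>, hence zero in \<open>N\<close>.\<close>
  have supp: "{d. ?g d \<noteq> \<zero>} \<subseteq> D"
    by (rule subsetI, rule ccontr) (simp add: D(2) f_0)
  show ?thesis
  proof (rule ex1I[of _ ?g], intro conjI allI)
    show "?g d \<in> N_deg d" for d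
      unfolding deg using vec_part_kernel[OF v(1)] vec_part_deg[OF v(1)] by blast
    show "finite {d. ?g d \<noteq> \<zero>}"
      using supp D(1) by (rule finite_subset)
    have "x = (\<Oplus>d\<in>D. ?g d)"
      using v D(1,3) by (simp add: finsum_f vec_part_kernel)
    also have "\<dots> = (\<Oplus>d\<in>{d. ?g d \<noteq> \<zero>}. ?g d)"
      using supp D(1) by (intro N.add.finprod_mono_neutral_cong_right) (auto simp: f_closed vec_part_kernel[OF v(1)])
    finally show "x = (\<Oplus>d\<in>{d. ?g d \<noteq> \<zero>}. ?g d)" .
  next
    fix g assume g: "(\<forall>d. g d \<in> N_deg d) \<and> finite {d. g d \<noteq> \<zero>} \<and> x = (\<Oplus>d\<in>{d. g d \<noteq> \<zero>}. g d)"
    let ?S = "{d. g d \<noteq> \<zero>}"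
    have "\<forall>d. \<exists>u. u \<in> koszul_kernel n \<and> u \<in> free_module_deg n d \<and> g d = f u"
      using g unfolding deg by blast
    then obtain u where u: "\<And>d. u d \<in> koszul_kernel n" "\<And>d. u d \<in> free_module_deg n d" "\<And>d. g d = f (u d)"
      by metis
    let ?w = "\<lambda>i. \<Sum>d\<in>?S. u d i"
    have w: "?w \<in> koszul_kernel n"
      by (rule koszul_kernel_sum) (rule u)
    have "f v = f ?w"
      using g finsum_f[of ?S u] u v(2) by simp
    then have Q: "(\<lambda>i. v i - ?w i) \<in> Q"
      using f_eq_iff[OF v(1) w] by simp
    show "g = ?g"
    proof
      fix d
      have "vec_part d ?w = (\<lambda>i. \<Sum>k\<in>?S. (if d = k then u k else (\<lambda>i. 0)) i)"
        unfolding vec_part_sum using vec_part_of_deg[OF u(2)] by simp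
      also have "\<dots> = (if d \<in> ?S then u d else (\<lambda>i. 0))"
        using g by (auto simp: fun_eq_iff if_distrib[of "\<lambda>h. h _"] cong: if_cong)
      finally have part: "vec_part d ?w = (if d \<in> ?S then u d else (\<lambda>i. 0))" .
      \<comment> \<open>Homogeneity of \<open>Q\<close> enters here: the part of a relation in
        degree d is again a relation, so components are determined in \<open>N\<close>.\<close>
      have "(\<lambda>i. vec_part d v i - vec_part d ?w i) \<in> Q"
        using Q_part[OF Q, of d] by (simp only: vec_part_diff)
      then have "f (vec_part d v) = f (vec_part d ?w)"
        using f_eq_iff[OF vec_part_kernel[OF v(1)] vec_part_kernel[OF w]] by blast
      also have "\<dots> = g d"
        unfolding part using u(3)[of d] f_0 by auto
      finally show "g d = f (vec_part d v)" ..
    qed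
  qed
qed

lemma graded_module_N: "graded_module (S_ring n) (S_deg n) N N_deg"
  unfolding graded_module_def
  using module_N N_deg_subgroup smult_N_deg unique_decomposition by blast

end

theorem graded_module_iso_of_presentations:
  assumes "kernel_presentation n Q M f M_deg" "kernel_presentation n Q N g N_deg"
  shows "graded_module_iso (S_ring n) (S_deg n) M M_deg N N_deg"
proof -
  interpret f: kernel_presentation n Q M f M_deg by fact
  interpret g: kernel_presentation n Q N g N_deg by fact
  \<comment> \<open>The choice of the preimage is harmless because \<open>f\<close> and
    \<open>g\<close> have the same kernel \<open>Q\<close>.\<close>
  define \<psi> where "\<psi> x = g (SOME v. v \<in> koszul_kernel n \<and> f v = x)" for x
  have \<psi>: "\<psi> (f v) = g v" if v: "v \<in> koszul_kernel n" for v
  proof -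
    let ?u = "SOME u. u \<in> koszul_kernel n \<and> f u = f v"
    have "?u \<in> koszul_kernel n \<and> f ?u = f v"
      by (rule someI[of "\<lambda>u. u \<in> koszul_kernel n \<and> f u = f v" v]) (simp add: v)
    then show ?thesis
      unfolding \<psi>_def using v f.f_eq_iff g.f_eq_iff by blast
  qed
  have "bij_betw \<psi> (carrier M) (carrier N)"
    unfolding bij_betw_def
  proof
    show "inj_on \<psi> (carrier M)"
      unfolding f.surj using f.f_eq_iff g.f_eq_iff by (auto simp: inj_on_def \<psi>)
    show "\<psi> ` carrier M = carrier N"
      unfolding f.surj g.surj by (force simp: \<psi> image_image)
  qed
  moreover have "\<psi> (x \<oplus>\<^bsub>M\<^esub> y) = \<psi> x \<oplus>\<^bsub>N\<^esub> \<psi> y" if "x \<in> carrier M" "y \<in> carrier M" for x y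
    using that unfolding f.surj
    by (auto simp: \<psi> f.f_add[symmetric] g.f_add[symmetric] koszul_kernel_add)
  moreover have "\<psi> (p \<odot>\<^bsub>M\<^esub> x) = p \<odot>\<^bsub>N\<^esub> \<psi> x" if "p \<in> carrier (S_ring n)" "x \<in> carrier M" for p x
    using that unfolding f.surj
    by (auto simp: \<psi> f.f_smult[symmetric] g.f_smult[symmetric] koszul_kernel_mult)
  moreover have "\<psi> ` M_deg d = N_deg d" for d
    unfolding f.deg g.deg by (force simp: \<psi> image_image)
  ultimately show ?thesis
    unfolding graded_module_iso_def using f.graded_module_N g.graded_module_N by blast
qed

section \<open>The module of linearized relations\<close>

abbreviation index_pairs :: "nat \<Rightarrow> (nat \<times> nat) set" where
  "index_pairs n \<equiv> {(i, j). i < j \<and> j < n}"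

text \<open>A lift to \<open>fna\<close> of an element of the exterior square, identified with
  degree two of the free Lie ring.\<close>

definition exterior_elt :: "nat \<Rightarrow> (nat \<Rightarrow> nat \<Rightarrow> int) \<Rightarrow> (lie_term \<Rightarrow>\<^sub>0 int)" where
  "exterior_elt n \<xi> =
    (\<Sum>ij\<in>index_pairs n. frag_cmul (\<xi> (fst ij) (snd ij)) (frag_of (Br (Gen (fst ij)) (Gen (snd ij)))))"

lemma finite_index_pairs: "finite (index_pairs n)"
  by (rule finite_subset[of _ "{..<n} \<times> {..<n}"]) auto

lemma koszul_map_sum: "koszul_map n (\<Sum>k\<in>K. p k) = (\<lambda>j. \<Sum>k\<in>K. koszul_map n (p k) j)"
  by (induction K rule: infinite_finite_induct) (simp_all add: koszul_map_add)

lemma koszul_map_cmul: "koszul_map n (frag_cmul c p) = (\<lambda>j. frag_cmul c (koszul_map n p j))"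
  by (simp add: koszul_map_def frag_extend_cmul)

lemma exterior_elt_brackets: "exterior_elt n \<xi> \<in> fna_brackets n"
proof -
  have "keys (frag_cmul (\<xi> (fst ij) (snd ij)) (frag_of (Br (Gen (fst ij)) (Gen (snd ij)))))
      \<subseteq> bracket_terms n" if "ij \<in> index_pairs n" for ij
  proof -
    obtain i j where "ij = (i, j)" "i < j" "j < n"
      using \<open>ij \<in> index_pairs n\<close> by auto
    then show ?thesis
      using keys_cmul[of "\<xi> i j" "frag_of (Br (Gen i) (Gen j))"] by auto
  qed
  then have "keys (exterior_elt n \<xi>) \<subseteq> bracket_terms n"
    unfolding exterior_elt_def by (rule keys_sum_subset)
  then show ?thesis
    by (simp add: fna_brackets_def)
qed

lemma exterior_elt_cong:
  "(\<And>i j. i < j \<Longrightarrow> j < n \<Longrightarrow> \<xi> i j = \<eta> i j) \<Longrightarrow> exterior_elt n \<xi> = exterior_elt n \<eta>"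
  unfolding exterior_elt_def by (rule sum.cong) auto

lemma frag_cmul_sum_left: "frag_cmul (\<Sum>k\<in>K. c k) p = (\<Sum>k\<in>K. frag_cmul (c k) p)"
  by (induction K rule: infinite_finite_induct) (simp_all add: frag_cmul_distrib)

lemma exterior_elt_sum:
  "exterior_elt n (\<lambda>i j. \<Sum>k\<in>K. t k * \<xi> k i j) = (\<Sum>k\<in>K. frag_cmul (t k) (exterior_elt n (\<xi> k)))"
  unfolding exterior_elt_def by (simp add: frag_cmul_sum frag_cmul_sum_left) (rule sum.swap)

lemma frag_cmul_diff: "frag_cmul k (p - q) = frag_cmul k p - frag_cmul k q"
  by (rule poly_mapping_eqI) (simp add: lookup_minus right_diff_distrib)

lemma frag_cmul_eq_mult: "frag_cmul k q = Poly_Mapping.single 0 k * (q :: ipoly)"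
proof (induction q rule: frag_induction[OF subset_UNIV])
  case (2 f)
  show ?case
    by (rule poly_mapping_eqI) (simp add: mult_single lookup_single when_def)
next
  case (3 p q)
  then show ?case by (simp add: frag_cmul_diff right_diff_distrib)
qed simp

text \<open>The coefficient of e_l collects \<xi>_il s_i for i < l and -\<xi>_lj s_j for l < j.
  Antisymmetry gives both the same shape and the zero diagonal supplies i = l, so a sum over ordered
  pairs becomes one over a full matrix column.\<close>

lemma koszul_map_exterior_elt:
  assumes diag: "\<And>i. \<xi> i i = 0" and anti: "\<And>i j. \<xi> i j = - \<xi> j i"
  shows "koszul_map n (exterior_elt n \<xi>) l = (if l < n then \<Sum>i<n. frag_cmul (\<xi> i l) (var i) else 0)"
proof (cases "l < n")
  case False
  have "koszul_map n (exterior_elt n \<xi>) \<in> carrier (free_module n n)"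
    by (intro koszul_map_closed fna_brackets_closed exterior_elt_brackets)
  then show ?thesis
    using False by (simp add: free_module_carrier)
next
  case True
  let ?c = "\<lambda>i. frag_cmul (\<xi> i l) (var i)"
  have "koszul_map n (exterior_elt n \<xi>) l =
      (\<Sum>ij\<in>index_pairs n. (if snd ij = l then ?c (fst ij) else 0) + (if fst ij = l then ?c (snd ij) else 0))"
    unfolding exterior_elt_def koszul_map_sum koszul_map_cmul
  proof (rule sum.cong)
    fix ij assume "ij \<in> index_pairs n"
    then obtain i j where ij: "ij = (i, j)" "i < j" "j < n" by auto
    have "koszul_map n (frag_of (Br (Gen i) (Gen j))) l = (if l = j then var i else 0) - (if l = i then var j else 0)"
      using koszul_map_ad_term[of 0 n i j] ij by (simp add: var_eq)
    then show "frag_cmul (\<xi> (fst ij) (snd ij)) (koszul_map n (frag_of (Br (Gen (fst ij)) (Gen (snd ij)))) l) =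
        (if snd ij = l then ?c (fst ij) else 0) + (if fst ij = l then ?c (snd ij) else 0)"
      using ij anti[of i j] by (auto simp: frag_cmul_diff)
  qed simp
  also have "\<dots> = (\<Sum>ij\<in>{ij \<in> index_pairs n. snd ij = l}. ?c (fst ij)) +
      (\<Sum>ij\<in>{ij \<in> index_pairs n. fst ij = l}. ?c (snd ij))"
    by (simp only: sum.distrib sum.inter_filter[OF finite_index_pairs])
  also have "(\<Sum>ij\<in>{ij \<in> index_pairs n. snd ij = l}. ?c (fst ij)) = (\<Sum>i<l. ?c i)"
    by (rule sum.reindex_bij_witness[where i = "\<lambda>i. (i, l)" and j = fst]) (use True in auto)
  also have "(\<Sum>ij\<in>{ij \<in> index_pairs n. fst ij = l}. ?c (snd ij)) = (\<Sum>i\<in>{l<..<n}. ?c i)"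
    by (rule sum.reindex_bij_witness[where i = "\<lambda>i. (l, i)" and j = snd]) auto
  also have "(\<Sum>i<l. ?c i) + (\<Sum>i\<in>{l<..<n}. ?c i) = (\<Sum>i\<in>{..<l} \<union> {l<..<n}. ?c i)"
    by (rule sum.union_disjoint[symmetric]) auto
  also have "\<dots> = (\<Sum>i<n. ?c i)"
    using True diag by (intro sum.mono_neutral_left) (auto simp: not_less)
  finally show ?thesis
    using True by simp
qed

lemma filter_frag_mult_linear:
  assumes "\<And>e i. P (e + mvar i) = P' e"
  shows "filter_frag P (p * (\<Sum>i<n. frag_cmul (c i) (var i))) =
    filter_frag P' p * (\<Sum>i<n. frag_cmul (c i) (var i))"
proof -
  have "q * (\<Sum>i<n. frag_cmul (c i) (var i)) = (\<Sum>i<n. frag_cmul (c i) (q * var i))" for q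
    by (simp add: sum_distrib_left frag_cmul_eq_mult mult.left_commute)
  moreover have "filter_frag P (frag_cmul k q) = frag_cmul k (filter_frag P q)" for k q
    by (simp add: filter_frag_def frag_extend_cmul)
  ultimately show ?thesis
    by (simp only: filter_frag_sum filter_frag_mult_var assms)
qed

text \<open>The correspondence between ideals containing \<open>I\<close> and ideals of the
  quotient. It is applied twice, to push an ideal of representatives down to the holonomy Lie
  algebra and to pull membership back.\<close>

lemma (in nonassoc_ideal) image_ideal:
  assumes J: "algebra_ideal L J" and IJ: "I \<subseteq> J"
  shows "algebra_ideal (L Quot I) ((\<lambda>x. I +> x) ` J)"
    and "x \<in> carrier L \<Longrightarrow> I +> x \<in> (\<lambda>x. I +> x) ` J \<longleftrightarrow> x \<in> J"
proof -
  interpret J: nonassoc_ideal L J by unfold_locales fact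
  interpret Q: nonassoc_ring "L Quot I" by (rule nonassoc_ring_Quot)
  show "algebra_ideal (L Quot I) ((\<lambda>x. I +> x) ` J)"
    unfolding algebra_ideal_def
  proof (intro conjI ballI additive_subgroupI Q.add.subgroupI)
    show "(\<lambda>x. I +> x) ` J \<subseteq> carrier (L Quot I)"
      using J.a_subset by (auto simp: carrier_Quot)
    show "(\<lambda>x. I +> x) ` J \<noteq> {}"
      using J.zero_closed by blast
  next
    fix a b assume "a \<in> (\<lambda>x. I +> x) ` J" "b \<in> (\<lambda>x. I +> x) ` J"
    then show "a \<oplus>\<^bsub>L Quot I\<^esub> b \<in> (\<lambda>x. I +> x) ` J"
      by (auto simp: coset_add[symmetric])
  next
    fix a assume "a \<in> (\<lambda>x. I +> x) ` J"
    then obtain u where u: "u \<in> J" "a = I +> u" by blast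
    have "(I +> (\<ominus> u)) \<oplus>\<^bsub>L Quot I\<^esub> a = \<zero>\<^bsub>L Quot I\<^esub>"
      using u by (simp add: coset_add[symmetric] l_neg coset_zero zero_Quot)
    then have "\<ominus>\<^bsub>L Quot I\<^esub> a = I +> (\<ominus> u)"
      using u by (intro Q.minus_equality) (auto simp: carrier_Quot)
    then show "\<ominus>\<^bsub>L Quot I\<^esub> a \<in> (\<lambda>x. I +> x) ` J"
      using u by blast
  next
    fix a u assume "a \<in> (\<lambda>x. I +> x) ` J" "u \<in> carrier (L Quot I)"
    then obtain b v where "b \<in> J" "a = I +> b" "v \<in> carrier L" "u = I +> v"
      unfolding carrier_Quot by blast
    moreover from this have "b \<otimes> v \<in> J" "v \<otimes> b \<in> J"
      by (simp_all add: J.ideal_mult)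
    ultimately show "a \<otimes>\<^bsub>L Quot I\<^esub> u \<in> (\<lambda>x. I +> x) ` J" "u \<otimes>\<^bsub>L Quot I\<^esub> a \<in> (\<lambda>x. I +> x) ` J"
      by (simp_all add: coset_mult[symmetric])
  qed
  show "I +> x \<in> (\<lambda>x. I +> x) ` J \<longleftrightarrow> x \<in> J" if x: "x \<in> carrier L"
  proof
    assume "I +> x \<in> (\<lambda>x. I +> x) ` J"
    then obtain u where u: "u \<in> J" "I +> x = I +> u" by blast
    then have "x \<ominus> u \<in> J"
      using coset_eq_iff[of x u] x IJ by auto
    then have "(x \<ominus> u) \<oplus> u \<in> J"
      using u(1) by (rule J.a_closed)
    then show "x \<in> J"
      using x u(1) by (simp add: a_minus_def a_assoc l_neg)
  qed blast
qed

context commutator_presentation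
begin

abbreviation lin_rels :: "(nat \<Rightarrow> ipoly) set" where
  "lin_rels \<equiv> linearized_map n m r ` carrier (free_module n m)"

text \<open>For a relator, a lift of its class modulo triple commutators, where the commutator
  subgroup of the free group becomes the exterior square.\<close>

definition rel_elt :: "nat \<Rightarrow> (lie_term \<Rightarrow>\<^sub>0 int)" where
  "rel_elt k = exterior_elt n (\<lambda>i j. mcoeff i j (r k))"

lemma rel_elt_brackets: "rel_elt k \<in> fna_brackets n"
  unfolding rel_elt_def by (rule exterior_elt_brackets)

text \<open>Vanishing exponent sums make the coefficient matrix alternating:
  \<open>mcoeff_shuffle\<close> gives antisymmetry and \<open>mcoeff_diag\<close> the zero diagonal,
  the integers having no 2-torsion.\<close>

lemma koszul_map_rel_elt:
  assumes k: "k < m"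
  shows "koszul_map n (rel_elt k) l = (if l < n then linearized_matrix n m r k l else 0)"
  unfolding rel_elt_def linearized_matrix_eq[OF k]
proof (rule koszul_map_exterior_elt)
  show diag: "mcoeff i i (r k) = 0" for i
    using mcoeff_diag[of i "r k"] word_exp_relator[OF k] by simp
  show "mcoeff i j (r k) = - mcoeff j i (r k)" for i j
    using mcoeff_shuffle[of i j "r k"] word_exp_relator[OF k] diag by (cases "i = j") auto
qed

lemma linearized_map_eq: "linearized_map n m r v = (\<lambda>j. \<Sum>k<m. v k * koszul_map n (rel_elt k) j)"
  unfolding linearized_map_def by (auto simp: koszul_map_rel_elt intro!: ext sum.cong)

lemma koszul_map_rel_elt_in_lin_rels:
  assumes "k < m"
  shows "koszul_map n (rel_elt k) \<in> lin_rels"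
proof -
  have "koszul_map n (rel_elt k) = linearized_map n m r (\<lambda>l. if l = k then 1 else 0)"
    unfolding linearized_map_eq using assms by (auto simp: if_distrib[of "\<lambda>p. p * _"] cong: if_cong)
  moreover have "(\<lambda>l. if l = k then 1 else 0) \<in> carrier (free_module n m)"
    using assms by (auto simp: free_module_carrier)
  ultimately show ?thesis
    by blast
qed

lemma homogeneous_relations_lin_rels: "homogeneous_relations n lin_rels"
proof
  have ker: "koszul_map n (rel_elt k) \<in> koszul_kernel n" for k
    using koszul_map_closed[OF fna_brackets_closed[OF rel_elt_brackets]] koszul_d1_brackets[OF rel_elt_brackets]
    by (simp add: koszul_kernel_def)
  show "lin_rels \<subseteq> koszul_kernel n"
    unfolding linearized_map_eq
    by (intro image_subsetI koszul_kernel_sum koszul_kernel_mult ker) (simp add: free_module_carrier)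
  have "linearized_map n m r (\<lambda>k. 0) = (\<lambda>i. 0)"
    by (simp add: linearized_map_eq)
  moreover have "(\<lambda>k. 0) \<in> carrier (free_module n m)"
    by (simp add: free_module_carrier)
  ultimately show "(\<lambda>i. 0) \<in> lin_rels"
    by (metis imageI)
  show "(\<lambda>i. u i - v i) \<in> lin_rels" if "u \<in> lin_rels" "v \<in> lin_rels" for u v
  proof -
    obtain a b where ab: "a \<in> carrier (free_module n m)" "b \<in> carrier (free_module n m)"
      "u = linearized_map n m r a" "v = linearized_map n m r b"
      using \<open>u \<in> lin_rels\<close> \<open>v \<in> lin_rels\<close> by blast
    then have "(\<lambda>i. u i - v i) = linearized_map n m r (\<lambda>k. a k - b k)"
      by (simp add: linearized_map_eq left_diff_distrib sum_subtractf)
    moreover have "(\<lambda>k. a k - b k) \<in> carrier (free_module n m)"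
      using ab by (simp add: free_module_carrier S_ring_diff)
    ultimately show ?thesis by blast
  qed
  show "(\<lambda>i. p * v i) \<in> lin_rels" if "p \<in> carrier (S_ring n)" "v \<in> lin_rels" for p v
  proof -
    obtain a where a: "a \<in> carrier (free_module n m)" "v = linearized_map n m r a"
      using \<open>v \<in> lin_rels\<close> by blast
    then have "(\<lambda>i. p * v i) = linearized_map n m r (\<lambda>k. p * a k)"
      by (simp add: linearized_map_eq sum_distrib_left mult.assoc)
    moreover have "(\<lambda>k. p * a k) \<in> carrier (free_module n m)"
      using a that(1) by (simp add: free_module_carrier S_ring_mult)
    ultimately show ?thesis by blast
  qed
  show "vec_part d v \<in> lin_rels" if "v \<in> lin_rels" for v d
  proof -
    obtain a where a: "a \<in> carrier (free_module n m)" "v = linearized_map n m r a"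
      using \<open>v \<in> lin_rels\<close> by blast
    \<comment> \<open>The shift by 2 is made up of degree 1 for the basis vector and degree 1 for
      the linear matrix entry.\<close>
    let ?b = "\<lambda>k. filter_frag (\<lambda>e. monom_deg e + 2 = d) (a k)"
    have "vec_part d v j = linearized_map n m r ?b j" for j
    proof (cases "j < n")
      case True
      have "filter_frag (\<lambda>e. monom_deg e + 1 = d) (a k * linearized_matrix n m r k j) =
          ?b k * linearized_matrix n m r k j" if "k < m" for k
        unfolding linearized_matrix_eq[OF that]
        by (rule filter_frag_mult_linear) (simp add: monom_deg_add)
      then show ?thesis
        using True by (simp add: a vec_part_def linearized_map_def filter_frag_sum)
    qed (simp add: a vec_part_def linearized_map_def)
    moreover have "?b \<in> carrier (free_module n m)"
      using a by (auto simp: free_module_carrier S_ring_carrier keys_filter_frag)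
    ultimately show ?thesis
      by (auto simp: image_iff fun_eq_iff intro!: bexI[of _ ?b])
  qed
qed

sublocale homogeneous_relations n lin_rels
  by (rule homogeneous_relations_lin_rels)

lemma lin_rels_add:
  assumes "u \<in> lin_rels" "v \<in> lin_rels"
  shows "(\<lambda>i. u i + v i) \<in> lin_rels"
  using Q_diff[OF assms(1) Q_diff[OF Q_0 assms(2)]] by simp

lemma lin_rels_sum:
  "(\<And>k. k \<in> K \<Longrightarrow> u k \<in> lin_rels) \<Longrightarrow> (\<lambda>i. \<Sum>k\<in>K. u k i) \<in> lin_rels"
  by (induction K rule: infinite_finite_induct) (simp_all add: Q_0 lin_rels_add)

lemma lin_rels_cmul:
  assumes "u \<in> lin_rels"
  shows "(\<lambda>i. frag_cmul c (u i)) \<in> lin_rels"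
proof -
  have "Poly_Mapping.single 0 c \<in> carrier (S_ring n)"
    by (simp add: S_ring_carrier)
  then show ?thesis
    using Q_mult assms unfolding frag_cmul_eq_mult by blast
qed

section \<open>The linearized Alexander invariant\<close>

abbreviation lin_coset :: "(nat \<Rightarrow> ipoly) \<Rightarrow> (nat \<Rightarrow> ipoly) set" where
  "lin_coset v \<equiv> lin_rels +>\<^bsub>free_module n n\<^esub> v"

lemma lin_coset_eq: "lin_coset v = {(\<lambda>i. h i + v i) | h. h \<in> lin_rels}"
  by (auto simp: a_r_coset_def' free_module_def)

lemma mem_lin_coset_iff: "u \<in> lin_coset v \<longleftrightarrow> (\<lambda>i. u i - v i) \<in> lin_rels"
proof
  assume "(\<lambda>i. u i - v i) \<in> lin_rels"
  then show "u \<in> lin_coset v"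
    unfolding lin_coset_eq by (intro CollectI exI[of _ "\<lambda>i. u i - v i"]) simp
qed (auto simp: lin_coset_eq)

lemma lin_coset_eq_iff: "lin_coset u = lin_coset v \<longleftrightarrow> (\<lambda>i. u i - v i) \<in> lin_rels"
proof
  assume "lin_coset u = lin_coset v"
  moreover have "u \<in> lin_coset u"
    by (simp add: mem_lin_coset_iff Q_0)
  ultimately show "(\<lambda>i. u i - v i) \<in> lin_rels"
    by (simp add: mem_lin_coset_iff)
next
  assume uv: "(\<lambda>i. u i - v i) \<in> lin_rels"
  have "(\<lambda>i. w i - u i) \<in> lin_rels \<longleftrightarrow> (\<lambda>i. w i - v i) \<in> lin_rels" for w
    using lin_rels_add[OF _ uv, of "\<lambda>i. w i - u i"] Q_diff[OF _ uv, of "\<lambda>i. w i - v i"] by auto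
  then show "lin_coset u = lin_coset v"
    by (auto simp: mem_lin_coset_iff set_eq_iff)
qed

lemma carrier_linearized_alexander_invariant:
  "carrier (linearized_alexander_invariant n m r) = lin_coset ` koszul_kernel n"
proof -
  \<comment> \<open>Relations are cycles, so \<open>koszul_d1 n\<close> is constant on a coset and
    the condition on a coset becomes one on any representative.\<close>
  have img: "koszul_d1 n ` lin_coset v = {koszul_d1 n v}" for v
  proof -
    have "koszul_d1 n u = koszul_d1 n v" if "u \<in> lin_coset v" for u
    proof -
      have "koszul_d1 n (\<lambda>i. u i - v i) = 0"
        using that Q_kernel by (auto simp: mem_lin_coset_iff koszul_kernel_def)
      then show ?thesis by (simp add: koszul_d1_diff)
    qed
    moreover have "v \<in> lin_coset v"
      by (simp add: mem_lin_coset_iff Q_0)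
    ultimately show ?thesis by blast
  qed
  have "carrier (linearized_alexander_module n m r) = lin_coset ` carrier (free_module n n)"
    by (auto simp: linearized_alexander_module_def quotient_module_def A_RCOSETS_def')
  then have "carrier (linearized_alexander_invariant n m r) =
      {C \<in> lin_coset ` carrier (free_module n n). koszul_d1 n ` C = {0}}"
    by (simp add: linearized_alexander_invariant_def)
  also have "\<dots> = lin_coset ` {v \<in> carrier (free_module n n). koszul_d1 n ` lin_coset v = {0}}"
    by blast
  also have "\<dots> = lin_coset ` koszul_kernel n"
    by (simp only: img koszul_kernel_def singleton_inject singleton_insert_inj_eq) simp
  finally show ?thesis .
qed

lemma linearized_presentation:
  "kernel_presentation n lin_rels (linearized_alexander_invariant n m r) lin_coset
    (linearized_alexander_invariant_deg n m r)"
proof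
  let ?B = "linearized_alexander_invariant n m r"
  show "carrier ?B = lin_coset ` koszul_kernel n"
    by (rule carrier_linearized_alexander_invariant)
  show "lin_coset (\<lambda>i. u i + v i) = lin_coset u \<oplus>\<^bsub>?B\<^esub> lin_coset v" for u v
  proof -
    have "lin_coset u \<oplus>\<^bsub>?B\<^esub> lin_coset v = {(\<lambda>i. a i + b i) | a b. a \<in> lin_coset u \<and> b \<in> lin_coset v}"
      by (auto simp: linearized_alexander_invariant_def linearized_alexander_module_def
          quotient_module_def set_add_def' free_module_def)
    also have "\<dots> = lin_coset (\<lambda>i. u i + v i)"
    proof (intro subset_antisym subsetI)
      fix w assume "w \<in> {(\<lambda>i. a i + b i) | a b. a \<in> lin_coset u \<and> b \<in> lin_coset v}"
      then obtain a b where w: "w = (\<lambda>i. a i + b i)" and ab: "a \<in> lin_coset u" "b \<in> lin_coset v"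
        by blast
      have "(\<lambda>i. (a i - u i) + (b i - v i)) \<in> lin_rels"
        using ab unfolding mem_lin_coset_iff by (rule lin_rels_add)
      moreover have "(\<lambda>i. (a i - u i) + (b i - v i)) = (\<lambda>i. w i - (u i + v i))"
        by (simp add: w algebra_simps)
      ultimately show "w \<in> lin_coset (\<lambda>i. u i + v i)"
        by (simp only: mem_lin_coset_iff)
    next
      fix w assume w: "w \<in> lin_coset (\<lambda>i. u i + v i)"
      have "(\<lambda>i. w i - v i) \<in> lin_coset u" "v \<in> lin_coset v"
        using w Q_0 by (simp_all add: mem_lin_coset_iff algebra_simps)
      moreover have "w = (\<lambda>i. (w i - v i) + v i)"
        by simp
      ultimately show "w \<in> {(\<lambda>i. a i + b i) | a b. a \<in> lin_coset u \<and> b \<in> lin_coset v}"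
        by (intro CollectI exI[of _ "\<lambda>i. w i - v i"] exI[of _ v] conjI)
    qed
    finally show ?thesis ..
  qed
  show "lin_coset (\<lambda>i. p * v i) = p \<odot>\<^bsub>?B\<^esub> lin_coset v" if p: "p \<in> carrier (S_ring n)" for p v
  proof -
    have "p \<odot>\<^bsub>?B\<^esub> lin_coset v = (\<Union>u\<in>lin_coset v. lin_coset (\<lambda>i. p * u i))"
      by (simp add: linearized_alexander_invariant_def linearized_alexander_module_def
          quotient_module_def free_module_def)
    also have "\<dots> = (\<Union>u\<in>lin_coset v. lin_coset (\<lambda>i. p * v i))"
    proof (rule SUP_cong[OF refl])
      fix u assume "u \<in> lin_coset v"
      then have "(\<lambda>i. p * (u i - v i)) \<in> lin_rels"
        using Q_mult[OF p] by (simp add: mem_lin_coset_iff)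
      then show "lin_coset (\<lambda>i. p * u i) = lin_coset (\<lambda>i. p * v i)"
        by (simp add: lin_coset_eq_iff right_diff_distrib)
    qed
    also have "\<dots> = lin_coset (\<lambda>i. p * v i)"
    proof -
      have "v \<in> lin_coset v"
        by (simp add: mem_lin_coset_iff Q_0)
      then show ?thesis by blast
    qed
    finally show ?thesis ..
  qed
  show "lin_coset v = \<zero>\<^bsub>?B\<^esub> \<longleftrightarrow> v \<in> lin_rels" for v
  proof -
    have "\<zero>\<^bsub>?B\<^esub> = lin_rels"
      by (simp add: linearized_alexander_invariant_def linearized_alexander_module_def quotient_module_def)
    also have "lin_rels = lin_coset (\<lambda>i. 0)"
      by (auto simp: mem_lin_coset_iff set_eq_iff simp del: image_iff)
    finally show ?thesis
      by (simp add: lin_coset_eq_iff)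
  qed
  show "linearized_alexander_invariant_deg n m r d = lin_coset ` (koszul_kernel n \<inter> free_module_deg n d)" for d
  proof (intro subset_antisym subsetI)
    fix C assume "C \<in> linearized_alexander_invariant_deg n m r d"
    then obtain v u where v: "v \<in> koszul_kernel n" "C = lin_coset v" and u: "u \<in> C" "u \<in> free_module_deg n d"
      by (auto simp: linearized_alexander_invariant_deg_def carrier_linearized_alexander_invariant)
    \<comment> \<open>The homogeneous element \<open>u\<close> of the coset need not be the given
      cycle \<open>v\<close>, but it differs from \<open>v\<close> by a relation and is therefore a
      cycle itself.\<close>
    then have uv: "(\<lambda>i. u i - v i) \<in> lin_rels"
      by (simp add: mem_lin_coset_iff)
    then have "(\<lambda>i. (u i - v i) + v i) \<in> koszul_kernel n"
      using Q_kernel v(1) by (intro koszul_kernel_add) auto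
    moreover have "lin_coset u = C"
      using uv v by (simp add: lin_coset_eq_iff)
    ultimately show "C \<in> lin_coset ` (koszul_kernel n \<inter> free_module_deg n d)"
      using u by auto
  next
    fix C assume "C \<in> lin_coset ` (koszul_kernel n \<inter> free_module_deg n d)"
    then obtain v where v: "v \<in> koszul_kernel n" "v \<in> free_module_deg n d" "C = lin_coset v"
      by blast
    moreover have "v \<in> lin_coset v"
      by (simp add: mem_lin_coset_iff Q_0)
    ultimately show "C \<in> linearized_alexander_invariant_deg n m r d"
      by (auto simp: linearized_alexander_invariant_deg_def carrier_linearized_alexander_invariant)
  qed
qed

end

section \<open>Degrees\<close>

definition homog :: "nat \<Rightarrow> ipoly \<Rightarrow> bool" where
  "homog d p \<longleftrightarrow> keys p \<subseteq> {e. monom_deg e = d}"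

lemma homog_diff: "homog d p \<Longrightarrow> homog d q \<Longrightarrow> homog d (p - q)"
  unfolding homog_def by (rule keys_diff_subset)

lemma homog_sum: "(\<And>k. k \<in> K \<Longrightarrow> homog d (p k)) \<Longrightarrow> homog d (\<Sum>k\<in>K. p k)"
  unfolding homog_def by (rule keys_sum_subset)

lemma homog_mult: "homog a p \<Longrightarrow> homog b q \<Longrightarrow> homog (a + b) (p * q)"
  unfolding homog_def using keys_mult[of p q] by (fastforce simp: monom_deg_add)

lemma homog_var: "homog 1 (var i)"
  by (simp add: homog_def var_eq)

lemma term_deg_pos: "0 < term_deg t"
  by (induction t) auto

text \<open>A basis vector has degree 1, so the entries have polynomial degree one less than the
  term; by \<open>term_deg_pos\<close> the subtraction is never truncated.\<close>

lemma koszul_term_homog: "homog (term_deg t - 1) (koszul_term n t i)"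
proof (induction t arbitrary: i)
  case (Br s t)
  have d1: "homog (term_deg u) (koszul_d1 n (koszul_term n u))"
    if "\<And>i. homog (term_deg u - 1) (koszul_term n u i)" for u
  proof -
    have "homog (term_deg u - 1 + 1) (koszul_term n u i * var i)" for i
      by (intro homog_mult homog_var that)
    then show ?thesis
      using term_deg_pos[of u] unfolding koszul_d1_def by (intro homog_sum) simp
  qed
  have "homog (term_deg s + (term_deg t - 1)) (koszul_d1 n (koszul_term n s) * koszul_term n t i)"
    "homog (term_deg t + (term_deg s - 1)) (koszul_d1 n (koszul_term n t) * koszul_term n s i)"
    by (intro homog_mult d1 Br)+
  then show ?case
    using term_deg_pos[of s] term_deg_pos[of t]
    by (simp add: koszul_bracket_def homog_diff add.commute)
qed (simp add: homog_def)

lemma koszul_map_deg: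
  assumes p: "p \<in> carrier (fna n)" and d: "\<And>t. t \<in> keys p \<Longrightarrow> term_deg t = d"
  shows "koszul_map n p \<in> free_module_deg n d"
proof -
  have "keys (koszul_map n p i) \<subseteq> {e. monom_deg e + 1 = d}" for i
    unfolding koszul_map_def
  proof (rule keys_frag_extend_subset[OF subset_refl])
    fix t assume "t \<in> keys p"
    then show "keys (koszul_term n t i) \<subseteq> {e. monom_deg e + 1 = d}"
      using koszul_term_homog[of t n i] d[of t] term_deg_pos[of t] by (auto simp: homog_def)
  qed
  then show ?thesis
    using koszul_map_closed[OF p] by (auto simp: free_module_deg_def)
qed

lemma term_deg_ad_term:
  assumes "keys e \<subseteq> {..<n}"
  shows "term_deg (ad_term n e t) = monom_deg e + term_deg t"
proof -
  have pow: "term_deg ((Br (Gen i) ^^ k) u) = k + term_deg u" for i k u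
    by (induction k) auto
  have "term_deg (foldr (\<lambda>i. Br (Gen i) ^^ l i) [0..<N] t) = (\<Sum>i<N. l i) + term_deg t" for N l
  proof (induction N arbitrary: t)
    case (Suc N)
    show ?case by (simp add: Suc.IH pow)
  qed simp
  then show ?thesis
    using monom_deg_superset[OF _ assms] by (simp add: ad_term_def)
qed

text \<open>If f has degree k, then s^f e_a has degree k + 1, and its section, when nonzero,
  consists of k - 1 adjoint steps applied to a bracket of degree two.\<close>

lemma term_deg_koszul_section:
  assumes v: "v \<in> free_module_deg n d" and t: "t \<in> keys (koszul_section n v)"
  shows "term_deg t = d"
proof -
  have "keys (koszul_section n v) \<subseteq> {t. term_deg t = d}"
    unfolding koszul_section_def
  proof (intro keys_sum_subset keys_frag_extend_subset[OF subset_refl])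
    fix a f assume "a \<in> {..<n}" and f: "f \<in> keys (v a)"
    then have fn: "keys f \<subseteq> {..<n}" and fd: "monom_deg f + 1 = d"
      using v by (auto simp: free_module_deg_def free_module_carrier S_ring_carrier)
    show "keys (section_term n f a) \<subseteq> {t. term_deg t = d}"
    proof (cases rule: section_term_cases[of f a])
      case 1
      then show ?thesis by (simp add: section_term_eq_0)
    next
      case (2 b)
      have "keys (f - mvar b) \<subseteq> {..<n}"
        using fn keys_add_monom[of "f - mvar b" "mvar b"] minus_mvar_add[OF 2(1)] by simp
      moreover have "monom_deg f = monom_deg (f - mvar b) + 1"
        using monom_deg_add[of "f - mvar b" "mvar b"] minus_mvar_add[OF 2(1)] by simp
      ultimately show ?thesis
        using fd by (simp add: section_term_eq[OF 2] term_deg_ad_term)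
    qed
  qed
  then show ?thesis using t by blast
qed

section \<open>The infinitesimal Alexander invariant\<close>

text \<open>A lift of the polynomial action to \<open>fna\<close>. It is linear in \<open>p\<close>,
  while compatibility with products of polynomials appears only after mapping brackets to a
  metabelian target.\<close>

definition poly_act :: "nat \<Rightarrow> ipoly \<Rightarrow> (lie_term \<Rightarrow>\<^sub>0 int) \<Rightarrow> (lie_term \<Rightarrow>\<^sub>0 int)" where
  "poly_act n p q = frag_extend (\<lambda>e. ad_op n e q) p"

lemma poly_act_brackets:
  assumes "q \<in> fna_brackets n"
  shows "poly_act n p q \<in> fna_brackets n"
  unfolding poly_act_def fna_brackets_def mem_Collect_eq
  by (rule keys_frag_extend_subset[OF subset_refl])
    (use ad_op_brackets[OF assms] in \<open>simp add: fna_brackets_def\<close>)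

lemma koszul_map_poly_act:
  assumes "p \<in> carrier (S_ring n)" "q \<in> fna_brackets n"
  shows "koszul_map n (poly_act n p q) = (\<lambda>j. p * koszul_map n q j)"
  using assms(1) unfolding S_ring_carrier
proof (induction p rule: frag_induction)
  case (one e)
  then show ?case
    using koszul_map_ad_op[of e n q] assms(2) by (simp add: poly_act_def)
next
  case (diff p p')
  then show ?case
    by (simp add: poly_act_def frag_extend_diff koszul_map_diff left_diff_distrib)
qed (simp add: poly_act_def)

lemma (in metabelian_hom) hom_poly_act:
  assumes "q \<in> carrier (fna n)"
  shows "\<pi> (poly_act n p q) = (\<Oplus>e\<in>keys p. [lookup p e] \<cdot> adM e (\<pi> q))"
proof -
  have "\<pi> (poly_act n p q) = (\<Oplus>e\<in>keys p. \<pi> (frag_cmul (lookup p e) (ad_op n e q)))"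
    unfolding poly_act_def frag_extend_def
    by (intro hom_finsum[THEN conjunct2]) (auto intro: fna_cmul_closed ad_op_closed[OF assms])
  also have "\<dots> = (\<Oplus>e\<in>keys p. [lookup p e] \<cdot> adM e (\<pi> q))"
    using assms by (simp add: hom_cmul hom_ad_op ad_op_closed)
  finally show ?thesis .
qed

lemma nonassoc_ideal_free_lie: "nonassoc_ideal (fna n) (free_lie_ideal n)"
proof -
  interpret nonassoc_ring "fna n" by (rule nonassoc_ring_fna)
  have "lie_relations (fna n) \<subseteq> carrier (fna n)"
    by (auto simp: lie_relations_def)
  then have "algebra_ideal (fna n) (free_lie_ideal n)"
    unfolding free_lie_ideal_def by (rule algebra_ideal_ideal_generated)
  then show ?thesis
    by unfold_locales
qed

lemma lie_ring_free_lie_algebra: "lie_ring (free_lie_algebra n)"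
proof -
  interpret nonassoc_ideal "fna n" "free_lie_ideal n" by (rule nonassoc_ideal_free_lie)
  interpret Q: nonassoc_ring "fna n Quot free_lie_ideal n" by (rule nonassoc_ring_Quot)
  have rel: "lie_relations (fna n) \<subseteq> free_lie_ideal n"
    unfolding free_lie_ideal_def by (rule ideal_generated_superset)
  show ?thesis
    unfolding free_lie_algebra_def
  proof unfold_locales
    fix x assume "x \<in> carrier (fna n Quot free_lie_ideal n)"
    then obtain p where p: "p \<in> carrier (fna n)" "x = free_lie_ideal n +>\<^bsub>fna n\<^esub> p"
      unfolding carrier_Quot by blast
    have "p \<otimes>\<^bsub>fna n\<^esub> p \<in> free_lie_ideal n"
      using p rel unfolding lie_relations_def by blast
    then show "x \<otimes>\<^bsub>fna n Quot free_lie_ideal n\<^esub> x = \<zero>\<^bsub>fna n Quot free_lie_ideal n\<^esub>"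
      using p by (simp add: coset_mult[symmetric] coset_eq_zero_iff zero_Quot)
  next
    let ?Q = "fna n Quot free_lie_ideal n"
    fix x y z assume "x \<in> carrier ?Q" "y \<in> carrier ?Q" "z \<in> carrier ?Q"
    then obtain p q w where p: "p \<in> carrier (fna n)" "q \<in> carrier (fna n)" "w \<in> carrier (fna n)"
      "x = free_lie_ideal n +>\<^bsub>fna n\<^esub> p" "y = free_lie_ideal n +>\<^bsub>fna n\<^esub> q" "z = free_lie_ideal n +>\<^bsub>fna n\<^esub> w"
      unfolding carrier_Quot by blast
    have "p \<otimes>\<^bsub>fna n\<^esub> (q \<otimes>\<^bsub>fna n\<^esub> w) \<oplus>\<^bsub>fna n\<^esub> q \<otimes>\<^bsub>fna n\<^esub> (w \<otimes>\<^bsub>fna n\<^esub> p) \<oplus>\<^bsub>fna n\<^esub> w \<otimes>\<^bsub>fna n\<^esub> (p \<otimes>\<^bsub>fna n\<^esub> q) \<in> free_lie_ideal n"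
      using p(1-3) rel unfolding lie_relations_def by blast
    then show "x \<otimes>\<^bsub>?Q\<^esub> (y \<otimes>\<^bsub>?Q\<^esub> z) \<oplus>\<^bsub>?Q\<^esub> y \<otimes>\<^bsub>?Q\<^esub> (z \<otimes>\<^bsub>?Q\<^esub> x) \<oplus>\<^bsub>?Q\<^esub> z \<otimes>\<^bsub>?Q\<^esub> (x \<otimes>\<^bsub>?Q\<^esub> y) = \<zero>\<^bsub>?Q\<^esub>"
      using p by (simp add: coset_mult[symmetric] coset_add[symmetric] coset_eq_zero_iff zero_Quot)
  qed
qed

section \<open>The tower of quotients down to the metabelian holonomy Lie algebra\<close>

context commutator_presentation
begin

abbreviation "LF \<equiv> free_lie_algebra n"
abbreviation "HL \<equiv> holonomy_lie_algebra G n gen"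
abbreviation "HI \<equiv> holonomy_ideal G n gen"
abbreviation "HE \<equiv> second_derived_subalgebra HL"
abbreviation "HM \<equiv> metabelian_quotient HL"

text \<open>With \<open>to_hol\<close> and \<open>to_met\<close>, the stages of one projection from
  \<open>fna\<close>; iterated cosets are handled throughout by representatives there.\<close>

definition to_free :: "(lie_term \<Rightarrow>\<^sub>0 int) \<Rightarrow> (lie_term \<Rightarrow>\<^sub>0 int) set" where
  "to_free p = free_lie_ideal n +>\<^bsub>fna n\<^esub> p"

definition to_hol :: "(lie_term \<Rightarrow>\<^sub>0 int) \<Rightarrow> (lie_term \<Rightarrow>\<^sub>0 int) set set" where
  "to_hol p = HI +>\<^bsub>LF\<^esub> to_free p"

definition to_met :: "(lie_term \<Rightarrow>\<^sub>0 int) \<Rightarrow> (lie_term \<Rightarrow>\<^sub>0 int) set set set" where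
  "to_met p = HE +>\<^bsub>HL\<^esub> to_hol p"

interpretation A: nonassoc_ideal "fna n" "free_lie_ideal n"
  by (rule nonassoc_ideal_free_lie)

interpretation LF: lie_ring LF
  by (rule lie_ring_free_lie_algebra)

lemma fna_hom_to_free: "fna_hom n LF to_free"
proof
  show "to_free p \<in> carrier LF" if "p \<in> carrier (fna n)" for p
    using that by (simp add: to_free_def free_lie_algebra_def A.carrier_Quot)
  show "to_free (p + q) = to_free p \<oplus>\<^bsub>LF\<^esub> to_free q" if "p \<in> carrier (fna n)" "q \<in> carrier (fna n)" for p q
    using A.coset_add[OF that] by (simp add: to_free_def free_lie_algebra_def fna_simps)
  show "to_free (p \<otimes>\<^bsub>fna n\<^esub> q) = to_free p \<otimes>\<^bsub>LF\<^esub> to_free q"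
    if "p \<in> carrier (fna n)" "q \<in> carrier (fna n)" for p q
    using A.coset_mult[OF that] by (simp add: to_free_def free_lie_algebra_def)
qed

interpretation to_free: fna_hom n LF to_free
  by (rule fna_hom_to_free)

lemma carrier_LF: "carrier LF = to_free ` carrier (fna n)"
  by (simp add: to_free_def[abs_def] free_lie_algebra_def A.carrier_Quot)

lemma dual_cup_eq:
  "dual_cup G n gen \<xi> = to_free (exterior_elt n (\<lambda>i j. \<xi> (cup G (ecls i) (ecls j))))"
proof -
  let ?c = "\<lambda>ij. \<xi> (cup G (ecls (fst ij)) (ecls (snd ij)))"
  let ?t = "\<lambda>ij. frag_of (Br (Gen (fst ij)) (Gen (snd ij)))"
  have t: "?t ij \<in> carrier (fna n)" "frag_of (Gen (fst ij)) \<in> carrier (fna n)"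
    "frag_of (Gen (snd ij)) \<in> carrier (fna n)" if "ij \<in> index_pairs n" for ij
    using that by (auto simp: fna_simps)
  have ct: "frag_cmul k (?t ij) \<in> carrier (fna n)" if "ij \<in> index_pairs n" for k ij
    by (rule fna_cmul_closed[OF t(1)[OF that]])
  have "to_free (exterior_elt n (\<lambda>i j. \<xi> (cup G (ecls i) (ecls j)))) =
      (\<Oplus>\<^bsub>LF\<^esub>ij\<in>index_pairs n. to_free (frag_cmul (?c ij) (?t ij)))"
    unfolding exterior_elt_def
    by (intro to_free.hom_finsum[THEN conjunct2] finite_index_pairs ct)
  also have "\<dots> = dual_cup G n gen \<xi>"
    unfolding dual_cup_def
  proof (rule LF.finsum_cong'[OF refl])
    fix ij assume ij: "ij \<in> index_pairs n"
    have "free_lie_gen n (fst ij) \<otimes>\<^bsub>LF\<^esub> free_lie_gen n (snd ij) = to_free (?t ij)"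
      using to_free.hom_mult[OF t(2,3)[OF ij]] by (simp add: fna_mult_frag_of free_lie_gen_def to_free_def)
    then show "to_free (frag_cmul (?c ij) (?t ij)) =
        [?c ij] \<cdot>\<^bsub>LF\<^esub> (free_lie_gen n (fst ij) \<otimes>\<^bsub>LF\<^esub> free_lie_gen n (snd ij))"
      using to_free.hom_cmul[OF t(1)[OF ij]] by simp
  next
    have "free_lie_gen n i \<in> carrier LF" if "i < n" for i
      using to_free.hom_closed[of "frag_of (Gen i)"] that
      by (simp add: free_lie_gen_def to_free_def) (simp add: fna_simps)
    then show "(\<lambda>ij. [?c ij] \<cdot>\<^bsub>LF\<^esub> (free_lie_gen n (fst ij) \<otimes>\<^bsub>LF\<^esub> free_lie_gen n (snd ij)))
        \<in> index_pairs n \<rightarrow> carrier LF"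
      by (auto intro!: LF.add.int_pow_closed LF.mult_closed)
  qed
  finally show ?thesis ..
qed

lemma holonomy_boundary_eq:
  assumes "z \<in> cycles2 G"
  shows "holonomy_boundary G n gen (homology_class2 G z) = to_free (exterior_elt n (\<lambda>i j. cup_pair i j z))"
  unfolding holonomy_boundary_def dual_cup_eq
  by (rule arg_cong[of _ _ to_free], rule exterior_elt_cong) (simp add: kronecker_cup[OF assms])

interpretation HI: nonassoc_ideal LF HI
proof
  have "holonomy_boundary G n gen ` homology2 G \<subseteq> carrier LF"
    unfolding homology2_def carrier_LF
    using exterior_elt_brackets fna_brackets_closed by (auto simp: holonomy_boundary_eq)
  then show "algebra_ideal LF HI"
    unfolding holonomy_ideal_def by (rule LF.algebra_ideal_ideal_generated)
qed

interpretation HL: lie_ring HL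
  unfolding holonomy_lie_algebra_def by (rule lie_ring_Quot[OF lie_ring_free_lie_algebra HI.ideal])

lemma fna_hom_to_hol: "fna_hom n HL to_hol"
proof
  show "to_hol p \<in> carrier HL" if "p \<in> carrier (fna n)" for p
    using that by (simp add: to_hol_def holonomy_lie_algebra_def HI.carrier_Quot)
  show "to_hol (p + q) = to_hol p \<oplus>\<^bsub>HL\<^esub> to_hol q" if "p \<in> carrier (fna n)" "q \<in> carrier (fna n)" for p q
    using HI.coset_add[OF to_free.hom_closed to_free.hom_closed] that
    by (simp add: to_hol_def holonomy_lie_algebra_def to_free.hom_add)
  show "to_hol (p \<otimes>\<^bsub>fna n\<^esub> q) = to_hol p \<otimes>\<^bsub>HL\<^esub> to_hol q"
    if "p \<in> carrier (fna n)" "q \<in> carrier (fna n)" for p q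
    using HI.coset_mult[OF to_free.hom_closed to_free.hom_closed] that
    by (simp add: to_hol_def holonomy_lie_algebra_def to_free.hom_mult)
qed

interpretation to_hol: fna_hom n HL to_hol
  by (rule fna_hom_to_hol)

lemma carrier_HL: "carrier HL = to_hol ` carrier (fna n)"
  by (simp add: to_hol_def[abs_def] holonomy_lie_algebra_def HI.carrier_Quot carrier_LF image_image)

lemma derived_HL: "derived_subalgebra HL = to_hol ` fna_brackets n"
proof
  have sub: "additive_subgroup (to_hol ` fna_brackets n) HL"
  proof (intro additive_subgroupI HL.add.subgroupI)
    show "to_hol ` fna_brackets n \<subseteq> carrier HL"
      using fna_brackets_closed by auto
    show "to_hol ` fna_brackets n \<noteq> {}"
      using fna_brackets_0 by blast
  next
    fix a assume "a \<in> to_hol ` fna_brackets n"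
    then obtain p where p: "p \<in> fna_brackets n" "a = to_hol p" by blast
    then have "\<ominus>\<^bsub>HL\<^esub> a = to_hol (0 - p)"
      using to_hol.hom_minus[OF fna_brackets_closed[OF p(1)]] by simp
    then show "\<ominus>\<^bsub>HL\<^esub> a \<in> to_hol ` fna_brackets n"
      using fna_brackets_diff[OF fna_brackets_0 p(1)] by blast
  next
    fix a b assume "a \<in> to_hol ` fna_brackets n" "b \<in> to_hol ` fna_brackets n"
    then obtain p q where pq: "p \<in> fna_brackets n" "a = to_hol p" "q \<in> fna_brackets n" "b = to_hol q"
      by blast
    then have "a \<oplus>\<^bsub>HL\<^esub> b = to_hol (p + q)"
      by (simp add: to_hol.hom_add fna_brackets_closed)
    then show "a \<oplus>\<^bsub>HL\<^esub> b \<in> to_hol ` fna_brackets n"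
      using fna_brackets_add pq by blast
  qed
  show "derived_subalgebra HL \<subseteq> to_hol ` fna_brackets n"
    unfolding derived_subalgebra_def
  proof (rule HL.bracket_span_least[OF sub])
    fix u v assume "u \<in> carrier HL" "v \<in> carrier HL"
    then obtain p q where pq: "p \<in> carrier (fna n)" "u = to_hol p" "q \<in> carrier (fna n)" "v = to_hol q"
      unfolding carrier_HL by blast
    then show "u \<otimes>\<^bsub>HL\<^esub> v \<in> to_hol ` fna_brackets n"
      using fna_mult_brackets[of p n q] by (metis imageI to_hol.hom_mult)
  qed
  show "to_hol ` fna_brackets n \<subseteq> derived_subalgebra HL"
  proof
    fix a assume "a \<in> to_hol ` fna_brackets n"
    then obtain q where q: "keys q \<subseteq> bracket_terms n" "a = to_hol q"
      by (auto simp: fna_brackets_def)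
    interpret D: additive_subgroup "derived_subalgebra HL" HL
      unfolding derived_subalgebra_def by (rule HL.bracket_span_subgroup) simp
    have "q \<in> carrier (fna n) \<and> to_hol q \<in> derived_subalgebra HL"
      using q(1)
    proof (induction q rule: frag_induction)
      case zero
      show ?case by (simp add: fna_simps)
    next
      case (one u)
      then obtain s t where u: "u = Br s t" "term_gens s \<subseteq> {..<n}" "term_gens t \<subseteq> {..<n}"
        by auto
      then have cl: "frag_of s \<in> carrier (fna n)" "frag_of t \<in> carrier (fna n)"
        by (simp_all add: fna_simps)
      have "to_hol s' \<otimes>\<^bsub>HL\<^esub> to_hol t' \<in> derived_subalgebra HL"
        if "s' \<in> carrier (fna n)" "t' \<in> carrier (fna n)" for s' t'
        unfolding derived_subalgebra_def using that by (intro HL.bracket_span_mem) auto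
      then show ?case
        using to_hol.hom_mult[OF cl] cl u by (simp add: fna_mult_frag_of) (simp add: fna_simps)
    next
      case (diff p q)
      then show ?case
        by (simp add: fna_diff_closed to_hol.hom_diff a_minus_def)
    qed
    then show "a \<in> derived_subalgebra HL"
      using q(2) by blast
  qed
qed

interpretation HE: nonassoc_ideal HL HE
  by unfold_locales (rule HL.algebra_ideal_second_derived)

lemma metabelian_hom_to_met: "metabelian_hom n HM to_met"
proof -
  interpret HM: lie_ring HM
    unfolding metabelian_quotient_def by (rule lie_ring_Quot[OF HL.lie_ring_axioms HE.ideal])
  show ?thesis
  proof
    show "to_met p \<in> carrier HM" if "p \<in> carrier (fna n)" for p
      using that by (simp add: to_met_def metabelian_quotient_def HE.carrier_Quot)
    show "to_met (p + q) = to_met p \<oplus>\<^bsub>HM\<^esub> to_met q" if "p \<in> carrier (fna n)" "q \<in> carrier (fna n)" for p q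
      using HE.coset_add[OF to_hol.hom_closed to_hol.hom_closed] that
      by (simp add: to_met_def metabelian_quotient_def to_hol.hom_add)
    show mult: "to_met (p \<otimes>\<^bsub>fna n\<^esub> q) = to_met p \<otimes>\<^bsub>HM\<^esub> to_met q"
      if "p \<in> carrier (fna n)" "q \<in> carrier (fna n)" for p q
      using HE.coset_mult[OF to_hol.hom_closed to_hol.hom_closed] that
      by (simp add: to_met_def metabelian_quotient_def to_hol.hom_mult)
    show "to_met p \<otimes>\<^bsub>HM\<^esub> to_met q = \<zero>\<^bsub>HM\<^esub>" if pq: "p \<in> fna_brackets n" "q \<in> fna_brackets n" for p q
    proof -
      have "to_hol p \<otimes>\<^bsub>HL\<^esub> to_hol q \<in> HE"
        unfolding second_derived_subalgebra_def
        using pq by (intro HL.bracket_span_mem) (auto simp: derived_HL)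
      then have "HE +>\<^bsub>HL\<^esub> (to_hol p \<otimes>\<^bsub>HL\<^esub> to_hol q) = HE"
        by (rule HE.a_rcos_const)
      then show ?thesis
        using pq mult fna_brackets_closed
        by (simp add: mult[symmetric] to_met_def to_hol.hom_mult metabelian_quotient_def HE.zero_Quot)
    qed
  qed
qed

interpretation to_met: metabelian_hom n HM to_met
  by (rule metabelian_hom_to_met)

text \<open>An element of the free nonassociative algebra dies in the metabelian quotient only if its image
  in the Koszul model is a linearized relation: such elements form an ideal which contains the
  Lie relations, the holonomy relations and the second derived subalgebra.\<close>

lemma to_met_eq_0_imp:
  assumes p: "p \<in> carrier (fna n)" and 0: "to_met p = \<zero>\<^bsub>HM\<^esub>"
  shows "koszul_map n p \<in> lin_rels"
proof -
  define J where "J = {p \<in> carrier (fna n). koszul_map n p \<in> lin_rels}"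
  \<comment> \<open>A relation \<open>u\<close> is a cycle, so its bracket with \<open>v\<close> is
    d_1(v) u up to sign, a polynomial multiple of a relation.\<close>
  have mult: "koszul_bracket n u v \<in> lin_rels \<and> koszul_bracket n v u \<in> lin_rels"
    if u: "u \<in> lin_rels" and v: "v \<in> carrier (free_module n n)" for u v
  proof -
    have "koszul_d1 n u = 0"
      using u Q_kernel by (auto simp: koszul_kernel_def)
    moreover have "(\<lambda>i. koszul_d1 n v * u i) \<in> lin_rels"
      using u koszul_d1_closed[OF v] Q_mult by blast
    moreover from this have "(\<lambda>i. 0 - koszul_d1 n v * u i) \<in> lin_rels"
      by (rule Q_diff[OF Q_0])
    ultimately show ?thesis
      by (simp add: koszul_bracket_def)
  qed
  have J: "algebra_ideal (fna n) J"
    unfolding algebra_ideal_def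
  proof (intro conjI ballI additive_subgroupI A.add.subgroupI)
    show "J \<subseteq> carrier (fna n)"
      by (auto simp: J_def)
    show "J \<noteq> {}"
      using Q_0 by (auto simp: J_def fna_simps intro!: exI[of _ 0])
  next
    fix p assume "p \<in> J"
    then have p: "p \<in> carrier (fna n)" "koszul_map n p \<in> lin_rels"
      by (auto simp: J_def)
    have "- p \<oplus>\<^bsub>fna n\<^esub> p = \<zero>\<^bsub>fna n\<^esub>" "- p \<in> carrier (fna n)"
      using p by (simp_all add: fna_simps)
    then have "\<ominus>\<^bsub>fna n\<^esub> p = 0 - p"
      using p(1) by (simp add: A.minus_equality)
    then show "\<ominus>\<^bsub>fna n\<^esub> p \<in> J"
      using p Q_diff[OF Q_0 p(2)] fna_diff_closed[of 0 n p]
      by (simp only: J_def mem_Collect_eq koszul_map_diff koszul_map_0) (simp add: fna_simps)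
  next
    fix p q assume "p \<in> J" "q \<in> J"
    moreover from this have "p \<oplus>\<^bsub>fna n\<^esub> q \<in> carrier (fna n)"
      by (simp add: J_def A.add.m_closed)
    ultimately show "p \<oplus>\<^bsub>fna n\<^esub> q \<in> J"
      using lin_rels_add[of "koszul_map n p" "koszul_map n q"]
      by (simp add: J_def fna_simps(1) koszul_map_add)
  next
    fix p q assume "p \<in> J" "q \<in> carrier (fna n)"
    then show "p \<otimes>\<^bsub>fna n\<^esub> q \<in> J" "q \<otimes>\<^bsub>fna n\<^esub> p \<in> J"
      using mult[OF _ koszul_map_closed[of q n]] by (auto simp: J_def koszul_map_mult)
  qed
  have "lie_relations (fna n) \<subseteq> J"
  proof -
    have "koszul_map n (p \<otimes>\<^bsub>fna n\<^esub> p) = (\<lambda>i. 0)" for p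
      using lie_ring.bracket_self[OF lie_ring_koszul_lie[of n], of "koszul_map n p"] by (simp add: koszul_map_mult)
    moreover have "koszul_map n (p \<otimes>\<^bsub>fna n\<^esub> (q \<otimes>\<^bsub>fna n\<^esub> w) \<oplus>\<^bsub>fna n\<^esub> q \<otimes>\<^bsub>fna n\<^esub> (w \<otimes>\<^bsub>fna n\<^esub> p) \<oplus>\<^bsub>fna n\<^esub> w \<otimes>\<^bsub>fna n\<^esub> (p \<otimes>\<^bsub>fna n\<^esub> q)) = (\<lambda>i. 0)"
      for p q w
      using lie_ring.jacobi[OF lie_ring_koszul_lie[of n], of "koszul_map n p" "koszul_map n q" "koszul_map n w"]
      by (simp add: fna_simps(1) koszul_map_add koszul_map_mult)
    ultimately show ?thesis
      using Q_0 unfolding lie_relations_def J_def by auto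
  qed
  then have "free_lie_ideal n \<subseteq> J"
    unfolding free_lie_ideal_def by (rule ideal_generated_least[OF J])
  \<comment> \<open>The second part of \<open>image_ideal\<close> is what finally pulls membership
    back from the quotient to \<open>p\<close>.\<close>
  note J1 = A.image_ideal[OF J this, folded free_lie_algebra_def to_free_def[abs_def], folded to_free_def]
  have "holonomy_boundary G n gen ` homology2 G \<subseteq> to_free ` J"
  proof (clarsimp simp: homology2_def)
    fix z assume z: "z \<in> cycles2 G"
    obtain t where t: "\<forall>i<n. \<forall>j<n. cup_pair i j z = (\<Sum>k<m. t k * mcoeff i j (r k))"
      using cup_pair_cycle[OF z] by blast
    have "exterior_elt n (\<lambda>i j. cup_pair i j z) = (\<Sum>k<m. frag_cmul (t k) (rel_elt k))"
      unfolding rel_elt_def exterior_elt_sum[symmetric] using t by (intro exterior_elt_cong) auto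
    moreover have "(\<lambda>j. \<Sum>k<m. frag_cmul (t k) (koszul_map n (rel_elt k) j)) \<in> lin_rels"
      by (rule lin_rels_sum, rule lin_rels_cmul) (simp add: koszul_map_rel_elt_in_lin_rels)
    ultimately have "koszul_map n (exterior_elt n (\<lambda>i j. cup_pair i j z)) \<in> lin_rels"
      by (simp add: koszul_map_sum koszul_map_cmul)
    then show "holonomy_boundary G n gen (homology_class2 G z) \<in> to_free ` J"
      unfolding holonomy_boundary_eq[OF z] J_def
      using exterior_elt_brackets fna_brackets_closed by blast
  qed
  then have "HI \<subseteq> to_free ` J"
    unfolding holonomy_ideal_def by (rule ideal_generated_least[OF J1(1)])
  note J2 = HI.image_ideal[OF J1(1) this, folded holonomy_lie_algebra_def, unfolded image_image, folded to_hol_def]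
  have "HE \<subseteq> to_hol ` J"
    unfolding second_derived_subalgebra_def derived_HL
  proof (rule HL.bracket_span_least)
    show "additive_subgroup (to_hol ` J) HL"
      using J2(1) by (simp add: algebra_ideal_def)
    fix u v assume "u \<in> to_hol ` fna_brackets n" "v \<in> to_hol ` fna_brackets n"
    then obtain p q where pq: "p \<in> fna_brackets n" "q \<in> fna_brackets n" "u = to_hol p" "v = to_hol q"
      by blast
    \<comment> \<open>Both factors are mapped to cycles, and cycles commute in the Koszul
      model.\<close>
    have "koszul_map n (p \<otimes>\<^bsub>fna n\<^esub> q) = (\<lambda>i. 0)"
      using pq by (simp add: koszul_map_mult koszul_bracket_def koszul_d1_brackets)
    then have "p \<otimes>\<^bsub>fna n\<^esub> q \<in> J"
      using pq fna_brackets_closed Q_0 by (auto simp: J_def)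
    then show "u \<otimes>\<^bsub>HL\<^esub> v \<in> to_hol ` J"
      using pq fna_brackets_closed by (metis imageI to_hol.hom_mult)
  qed
  moreover have "to_hol p \<in> HE"
    using 0 p by (simp add: to_met_def metabelian_quotient_def HE.zero_Quot HE.coset_eq_zero_iff)
  ultimately have "to_free p \<in> to_free ` J"
    using J2(2)[of "to_free p"] p by (auto simp: to_hol_def)
  then have "p \<in> J"
    using J1(2)[OF p] by blast
  then show ?thesis
    by (simp add: J_def)
qed

text \<open>\<open>relator_cycle\<close> supplies a homology class whose holonomy boundary is the
  class of \<open>rel_elt k\<close> in the free Lie ring.\<close>

lemma to_met_rel_elt:
  assumes k: "k < m"
  shows "to_met (rel_elt k) = \<zero>\<^bsub>HM\<^esub>"
proof -
  obtain z where z: "z \<in> cycles2 G"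
    "\<And>i j. i < n \<Longrightarrow> j < n \<Longrightarrow> i \<noteq> j \<Longrightarrow> cup_pair i j z = mcoeff i j (r k)"
    using relator_cycle[OF k] by blast
  have "exterior_elt n (\<lambda>i j. cup_pair i j z) = rel_elt k"
    unfolding rel_elt_def using z(2) by (intro exterior_elt_cong) auto
  then have "to_free (rel_elt k) = holonomy_boundary G n gen (homology_class2 G z)"
    by (simp add: holonomy_boundary_eq[OF z(1)])
  moreover have "homology_class2 G z \<in> homology2 G"
    unfolding homology2_def using z(1) by blast
  ultimately have "to_free (rel_elt k) \<in> HI"
    unfolding holonomy_ideal_def using ideal_generated_superset by fastforce
  then have "to_hol (rel_elt k) = \<zero>\<^bsub>HL\<^esub>"
    by (simp add: to_hol_def HI.a_rcos_const holonomy_lie_algebra_def HI.zero_Quot)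
  then show ?thesis
    by (simp add: to_met_def HE.coset_zero metabelian_quotient_def HE.zero_Quot)
qed

text \<open>Such a \<open>v\<close> is the Koszul image of a combination of the
  \<open>rel_elt k\<close> with polynomials acting by \<open>poly_act\<close>. By
  \<open>hom_koszul_section\<close> its section has the same image in the metabelian quotient as
  this combination, and there every \<open>rel_elt k\<close> is zero.\<close>

lemma to_met_section_lin_rels:
  assumes "v \<in> lin_rels"
  shows "to_met (koszul_section n v) = \<zero>\<^bsub>HM\<^esub>"
proof -
  obtain a where a: "a \<in> carrier (free_module n m)" "v = linearized_map n m r a"
    using assms by blast
  let ?q = "\<lambda>k. poly_act n (a k) (rel_elt k)"
  have "v = (\<lambda>j. \<Sum>k<m. koszul_map n (?q k) j)"
    unfolding a(2) linearized_map_eq using a(1)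
    by (simp add: free_module_carrier koszul_map_poly_act rel_elt_brackets)
  then have v: "v = koszul_map n (\<Sum>k<m. ?q k)"
    by (simp add: koszul_map_sum)
  have br: "?q k \<in> fna_brackets n" for k
    by (intro poly_act_brackets rel_elt_brackets)
  have "(\<Sum>k<m. ?q k) \<in> fna_brackets n"
    unfolding fna_brackets_def mem_Collect_eq
    by (rule keys_sum_subset) (use br in \<open>simp add: fna_brackets_def\<close>)
  then have "to_met (koszul_section n v) = to_met (\<Sum>k<m. ?q k)"
    unfolding v by (rule to_met.hom_koszul_section)
  also have "\<dots> = (\<Oplus>\<^bsub>HM\<^esub>k\<in>{..<m}. to_met (?q k))"
    using br fna_brackets_closed by (intro to_met.hom_finsum[THEN conjunct2]) auto
  also have "\<dots> = \<zero>\<^bsub>HM\<^esub>"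
  proof (rule to_met.add.finprod_one_eqI)
    fix k assume "k \<in> {..<m}"
    then have "to_met (?q k) = (\<Oplus>\<^bsub>HM\<^esub>e\<in>keys (a k). [lookup (a k) e] \<cdot>\<^bsub>HM\<^esub> \<zero>\<^bsub>HM\<^esub>)"
      using to_met.hom_poly_act[OF fna_brackets_closed[OF rel_elt_brackets]] by (simp add: to_met_rel_elt)
    then show "to_met (?q k) = \<zero>\<^bsub>HM\<^esub>"
      by (simp add: to_met.add.int_pow_one)
  qed
  finally show ?thesis .
qed

lemma ad_monom_eq: "ad_monom HL n (holonomy_gen G n gen) e c = to_met.adM e c"
proof -
  have "ad_gen HL (holonomy_gen G n gen i) = (\<lambda>c. to_met (frag_of (Gen i)) \<otimes>\<^bsub>HM\<^esub> c)" for i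
    by (rule ext) (simp add: ad_gen_def holonomy_gen_def free_lie_gen_def to_met_def to_hol_def to_free_def)
  then show ?thesis
    by (simp add: ad_monom_def to_met.adM_def)
qed

lemma holonomy_deg_eq:
  "holonomy_deg G n gen d = to_hol ` {p \<in> carrier (fna n). \<forall>t\<in>keys p. term_deg t = d}"
  by (auto simp: holonomy_deg_def free_lie_deg_def to_hol_def to_free_def)

lemma koszul_map_kernel: "q \<in> fna_brackets n \<Longrightarrow> koszul_map n q \<in> koszul_kernel n"
  by (simp add: koszul_kernel_def koszul_map_closed fna_brackets_closed koszul_d1_brackets)

text \<open>Surjectivity comes from \<open>hom_koszul_section\<close>. The kernel is found by
  combining \<open>to_met_eq_0_imp\<close>, applied to the section of a cycle, with
  \<open>to_met_section_lin_rels\<close>.\<close>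

lemma holonomy_presentation:
  "kernel_presentation n lin_rels (infinitesimal_alexander_invariant G n gen)
    (\<lambda>v. to_met (koszul_section n v)) (infinitesimal_alexander_invariant_deg G n gen)"
proof
  let ?B = "infinitesimal_alexander_invariant G n gen"
  let ?f = "\<lambda>v. to_met (koszul_section n v)"
  note B_def = infinitesimal_alexander_invariant_def lie_alexander_invariant_def
  have sec: "koszul_section n v \<in> fna_brackets n" if "v \<in> koszul_kernel n" for v
    using that by (intro koszul_section_brackets) (simp add: koszul_kernel_def)
  have sec': "koszul_section n v \<in> carrier (fna n)" if "v \<in> koszul_kernel n" for v
    using sec[OF that] by (rule fna_brackets_closed)
  have map_sec: "koszul_map n (koszul_section n v) = v" if "v \<in> koszul_kernel n" for v
    using that by (intro koszul_map_section) (simp_all add: koszul_kernel_def)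
  show "carrier ?B = ?f ` koszul_kernel n"
  proof -
    have "carrier ?B = to_met ` fna_brackets n"
      by (auto simp: B_def derived_HL to_met_def)
    also have "\<dots> = ?f ` koszul_kernel n"
    proof (intro subset_antisym subsetI)
      fix c assume "c \<in> to_met ` fna_brackets n"
      then obtain q where q: "q \<in> fna_brackets n" "c = to_met q" by blast
      then have "c = ?f (koszul_map n q)"
        by (simp add: to_met.hom_koszul_section)
      then show "c \<in> ?f ` koszul_kernel n"
        using koszul_map_kernel[OF q(1)] by blast
    qed (use sec in blast)
    finally show ?thesis .
  qed
  show add: "?f (\<lambda>i. u i + v i) = ?f u \<oplus>\<^bsub>?B\<^esub> ?f v"
    if "u \<in> koszul_kernel n" "v \<in> koszul_kernel n" for u v
    using that by (simp add: B_def koszul_section_add to_met.hom_add sec')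
  show "?f (\<lambda>i. p * v i) = p \<odot>\<^bsub>?B\<^esub> ?f v" if p: "p \<in> carrier (S_ring n)" and v: "v \<in> koszul_kernel n" for p v
  proof -
    \<comment> \<open>The section itself is merely additive; the multiple of \<open>v\<close> is
      rewritten as the Koszul image of the lifted action, to which \<open>hom_koszul_section\<close>
      applies.\<close>
    have "?f (\<lambda>i. p * v i) = to_met (koszul_section n (koszul_map n (poly_act n p (koszul_section n v))))"
      using p v by (simp add: koszul_map_poly_act sec map_sec)
    also have "\<dots> = to_met (poly_act n p (koszul_section n v))"
      using v by (intro to_met.hom_koszul_section poly_act_brackets sec)
    also have "\<dots> = p \<odot>\<^bsub>?B\<^esub> ?f v"
      using v by (simp add: to_met.hom_poly_act sec' B_def ad_monom_eq)
    finally show ?thesis .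
  qed
  show f_eq_0: "?f v = \<zero>\<^bsub>?B\<^esub> \<longleftrightarrow> v \<in> lin_rels" if v: "v \<in> koszul_kernel n" for v
    using to_met_eq_0_imp[OF sec'[OF v]] map_sec[OF v] to_met_section_lin_rels[of v]
    by (auto simp: B_def)
  show "infinitesimal_alexander_invariant_deg G n gen d = ?f ` (koszul_kernel n \<inter> free_module_deg n d)" for d
  proof (intro subset_antisym subsetI)
    fix c assume "c \<in> infinitesimal_alexander_invariant_deg G n gen d"
    \<comment> \<open>An element of degree d comes with two representatives: \<open>p\<close> is
      homogeneous and \<open>q\<close> consists of brackets. Their difference dies in the metabelian
      quotient, so the Koszul image of \<open>p\<close> is a homogeneous cycle.\<close>
    then obtain p q where p: "p \<in> carrier (fna n)" "\<forall>t\<in>keys p. term_deg t = d"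
      and q: "q \<in> fna_brackets n" "to_hol p = to_hol q" and c: "c = to_met q"
      unfolding infinitesimal_alexander_invariant_deg_def lie_alexander_invariant_deg_def
        derived_HL holonomy_deg_eq to_met_def by blast
    have pq: "p - q \<in> carrier (fna n)"
      by (rule fna_diff_closed[OF p(1) fna_brackets_closed[OF q(1)]])
    have "to_met p = to_met q"
      by (simp add: to_met_def q(2))
    then have "to_met (p - q) = \<zero>\<^bsub>HM\<^esub>"
      using p(1) fna_brackets_closed[OF q(1)] by (simp add: to_met.hom_diff a_minus_def to_met.r_neg)
    then have Q: "(\<lambda>j. koszul_map n p j - koszul_map n q j) \<in> lin_rels"
      using to_met_eq_0_imp[OF pq] by (simp add: koszul_map_diff)
    have "(\<lambda>j. (koszul_map n p j - koszul_map n q j) + koszul_map n q j) \<in> koszul_kernel n"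
      using Q Q_kernel koszul_map_kernel[OF q(1)] by (intro koszul_kernel_add) auto
    then have "koszul_map n p \<in> koszul_kernel n \<inter> free_module_deg n d"
      using koszul_map_deg[OF p(1)] p(2) by simp
    moreover have "?f (koszul_map n p) = c"
    proof -
      have "?f (\<lambda>j. (koszul_map n p j - koszul_map n q j) + koszul_map n q j) =
          \<zero>\<^bsub>HM\<^esub> \<oplus>\<^bsub>HM\<^esub> ?f (koszul_map n q)"
        using add[of "\<lambda>j. koszul_map n p j - koszul_map n q j" "koszul_map n q"]
          Q Q_kernel koszul_map_kernel[OF q(1)] to_met_section_lin_rels[OF Q]
        by (auto simp: B_def)
      then show ?thesis
        using q(1) fna_brackets_closed[OF q(1)] by (simp add: c to_met.hom_koszul_section)
    qed
    ultimately show "c \<in> ?f ` (koszul_kernel n \<inter> free_module_deg n d)"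
      by blast
  next
    fix c assume "c \<in> ?f ` (koszul_kernel n \<inter> free_module_deg n d)"
    then obtain v where v: "v \<in> koszul_kernel n" "v \<in> free_module_deg n d" "c = ?f v"
      by blast
    then have "to_hol (koszul_section n v) \<in> derived_subalgebra HL \<inter> holonomy_deg G n gen d"
      unfolding derived_HL holonomy_deg_eq using sec sec' term_deg_koszul_section by blast
    then show "c \<in> infinitesimal_alexander_invariant_deg G n gen d"
      unfolding infinitesimal_alexander_invariant_deg_def lie_alexander_invariant_deg_def v(3) to_met_def
      by blast
  qed
qed

end

theorem proposition9p6:
  fixes n m :: nat and r :: "nat \<Rightarrow> word"
  assumes "commutator_relators n m r"
  shows "graded_module_iso (S_ring n) (S_deg n)
    (linearized_alexander_invariant n m r)
    (linearized_alexander_invariant_deg n m r)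
    (infinitesimal_alexander_invariant (presented_group n m r) n (presented_gen n m r))
    (infinitesimal_alexander_invariant_deg (presented_group n m r) n (presented_gen n m r))"
proof -
  interpret commutator_presentation n m r by unfold_locales fact
  show ?thesis
    using linearized_presentation holonomy_presentation by (rule graded_module_iso_of_presentations)
qed

end
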